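(* Let $F$ be a Banach lattice such that $F^*$ has a Schauder basis formed by Riesz homomorphisms $F\to\mathbb{R}$. Then all Aron-Berner extensions of any $F$-valued Riesz multimorphism are Riesz multimorphisms; that is, for every $m\in\mathbb{N}$, all Banach lattices $E_1,\ldots,E_m$, every Riesz multimorphism $A\colon E_1\times\cdots\times E_m\longrightarrow F$ and every $\rho\in S_m$, the Aron-Berner extension $AB_m^\rho(A)\colon E_1^{**}\times\cdots\times E_m^{**}\longrightarrow F^{**}$ is a Riesz multimorphism.
   Context: All Banach lattices are real. For a Banach lattice $E$, the topological dual $E^*$ coincides with the order dual and the bidual $E^{**}$ with the second order dual. $S_m$ is the set of permutations of $\{1,\ldots,m\}$. An $m$-linear operator $A\colon E_1\times\cdots\times E_m\to F$ is positive if $A(x_1,\ldots,x_m)\ge 0$ whenever all $x_i\ge 0$, and regular if it is a difference of two positive $m$-linear operators; $\mathcal{L}_r(E_1,\ldots,E_m;F)$ is the space of regular $m$-linear operators. A Riesz multimorphism is an $A\in\mathcal{L}_r(E_1,\ldots,E_m;F)$ with $|A(x_1,\ldots,x_m)|=A(|x_1|,\ldots,|x_m|)$ for all $x_i\in E_i$. Aron-Berner extensions: fix $\rho\in S_m$. For $0\le k\le m$ let $I_k=\{1,\ldots,m\}\setminus\{\rho(1),\ldots,\rho(k)\}$ and let $\mathcal{L}^{\rho,k}$ be the space of regular $(m-k)$-linear forms on the product of the spaces $E_i$, $i\in I_k$ (in increasing order of indices), with $\mathcal{L}^{\rho,m}=\mathbb{R}$. For $1\le k\le m$ and $x^{**}\in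 E_{\rho(k)}^{**}$ define $\overline{x^{**}}^{\rho}\colon\mathcal{L}^{\rho,k-1}\to\mathcal{L}^{\rho,k}$ by letting $\overline{x^{**}}^{\rho}(B)\big((x_i)_{i\in I_k}\big)$ be the value of $x^{**}$ at the functional $x_{\rho(k)}\mapsto B\big((x_i)_{i\in I_{k-1}}\big)$ in $E_{\rho(k)}^*$. For $A\in\mathcal{L}_r(E_1,\ldots,E_m;F)$ the Aron-Berner extension $AB_m^\rho(A)\colon E_1^{**}\times\cdots\times E_m^{**}\to F^{**}$ is $$AB_m^\rho(A)(x_1^{**},\ldots,x_m^{**})(y^* )=\big(\overline{x_{\rho(m)}^{**}}^{\rho}\circ\cdots\circ\overline{x_{\rho(1)}^{**}}^{\rho}\big)(y^*\circ A),\quad y^*\in F^*.$$ *)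

theory Defs
  imports Complex_Main "HOL-Combinatorics.Permutations" "HOL-Algebra.Lattice" "HOL-Algebra.Group"
begin

text \<open>
  The factors of \<open>E\<^sub>1 \<times> \<dots> \<times> E\<^sub>m\<close> are unrelated Banach lattices and \<open>m\<close> varies, so they cannot be
  types. They are modelled as structures, each with its own operations, order and norm on an
  explicit carrier set in a common type \<^typ>\<open>'a\<close>. This is no restriction: since \<^typ>\<open>'a\<close> is arbitrary, any finite number of Banach lattices can be placed
  in it (their disjoint union is one choice of \<^typ>\<open>'a\<close>).
\<close>

record 'a ordered_normed_space = "'a gorder" +
  vzero :: 'a
  vadd :: "'a \<Rightarrow> 'a \<Rightarrow> 'a"
  vscale :: "real \<Rightarrow> 'a \<Rightarrow> 'a"
  vnorm :: "'a \<Rightarrow> real"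

definition vdiff :: "('a, 'z) ordered_normed_space_scheme \<Rightarrow> 'a \<Rightarrow> 'a \<Rightarrow> 'a" where
  "vdiff E x y = vadd E x (vscale E (- 1) y)"

definition vabs :: "('a, 'z) ordered_normed_space_scheme \<Rightarrow> 'a \<Rightarrow> 'a" where
  "vabs E x = x \<squnion>\<^bsub>E\<^esub> vscale E (- 1) x"

locale banach_lattice = lattice E for E (structure) +
  assumes add_group: "comm_group \<lparr>carrier = carrier E, mult = vadd E, one = vzero E\<rparr>"
    and scale_closed: "x \<in> carrier E \<Longrightarrow> vscale E c x \<in> carrier E"
    and scale_add_right: "\<lbrakk>x \<in> carrier E; y \<in> carrier E\<rbrakk>
          \<Longrightarrow> vscale E c (vadd E x y) = vadd E (vscale E c x) (vscale E c y)"
    and scale_add_left: "x \<in> carrier E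
          \<Longrightarrow> vscale E (c + d) x = vadd E (vscale E c x) (vscale E d x)"
    and scale_scale: "x \<in> carrier E \<Longrightarrow> vscale E c (vscale E d x) = vscale E (c * d) x"
    and scale_one: "x \<in> carrier E \<Longrightarrow> vscale E 1 x = x"
    and norm_nonneg: "x \<in> carrier E \<Longrightarrow> 0 \<le> vnorm E x"
    and norm_eq_0: "x \<in> carrier E \<Longrightarrow> vnorm E x = 0 \<longleftrightarrow> x = vzero E"
    and norm_triangle: "\<lbrakk>x \<in> carrier E; y \<in> carrier E\<rbrakk>
          \<Longrightarrow> vnorm E (vadd E x y) \<le> vnorm E x + vnorm E y"
    and norm_scale: "x \<in> carrier E \<Longrightarrow> vnorm E (vscale E c x) = \<bar>c\<bar> * vnorm E x"
    and add_mono: "\<lbrakk>x \<in> carrier E; y \<in> carrier E; z \<in> carrier E; x \<sqsubseteq> y\<rbrakk>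
          \<Longrightarrow> vadd E x z \<sqsubseteq> vadd E y z"
    and scale_mono: "\<lbrakk>x \<in> carrier E; vzero E \<sqsubseteq> x; 0 \<le> c\<rbrakk> \<Longrightarrow> vzero E \<sqsubseteq> vscale E c x"
    and norm_mono: "\<lbrakk>x \<in> carrier E; y \<in> carrier E; vabs E x \<sqsubseteq> vabs E y\<rbrakk>
          \<Longrightarrow> vnorm E x \<le> vnorm E y"
    and complete: "\<lbrakk>range s \<subseteq> carrier E;
           \<forall>\<epsilon>>0. \<exists>N::nat. \<forall>p\<ge>N. \<forall>q\<ge>N. vnorm E (vdiff E (s p) (s q)) < \<epsilon>\<rbrakk>
          \<Longrightarrow> \<exists>l\<in>carrier E. (\<lambda>n. vnorm E (vdiff E (s n) l)) \<longlonglongrightarrow> 0"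

definition real_lattice :: "real ordered_normed_space" where
  "real_lattice = \<lparr>carrier = UNIV, eq = (=), le = (\<le>),
     vzero = 0, vadd = (+), vscale = (*), vnorm = abs\<rparr>"

definition linear_operator ::
  "('a, 'y) ordered_normed_space_scheme \<Rightarrow> ('b, 'z) ordered_normed_space_scheme \<Rightarrow> ('a \<Rightarrow> 'b) \<Rightarrow> bool" where
  "linear_operator E F T \<longleftrightarrow> T \<in> carrier E \<rightarrow> carrier F \<and>
     (\<forall>x\<in>carrier E. \<forall>y\<in>carrier E. T (vadd E x y) = vadd F (T x) (T y)) \<and>
     (\<forall>c. \<forall>x\<in>carrier E. T (vscale E c x) = vscale F c (T x))"

definition riesz_homomorphism ::
  "('a, 'y) ordered_normed_space_scheme \<Rightarrow> ('b, 'z) ordered_normed_space_scheme \<Rightarrow> ('a \<Rightarrow> 'b) \<Rightarrow> bool" where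
  "riesz_homomorphism E F T \<longleftrightarrow> linear_operator E F T \<and>
     (\<forall>x\<in>carrier E. \<forall>y\<in>carrier E. T (x \<squnion>\<^bsub>E\<^esub> y) = T x \<squnion>\<^bsub>F\<^esub> T y)"

text \<open>
  The topological dual with the operator norm and the order given by the positive functionals.
  Functionals are made extensional (\<^const>\<open>undefined\<close> outside the carrier), so that equality
  of elements of the dual is equality of functionals on the carrier.
\<close>

definition dual_lattice :: "('a, 'z) ordered_normed_space_scheme \<Rightarrow> ('a \<Rightarrow> real) ordered_normed_space" where
  "dual_lattice E =
    \<lparr>carrier = {f \<in> extensional (carrier E). linear_operator E real_lattice f \<and>
                  (\<exists>C. \<forall>x\<in>carrier E. \<bar>f x\<bar> \<le> C * vnorm E x)},
     eq = (=),
     le = (\<lambda>f g. \<forall>x\<in>carrier E. vzero E \<sqsubseteq>\<^bsub>E\<^esub> x \<longrightarrow> f x \<le> g x),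
     vzero = (\<lambda>x\<in>carrier E. 0),
     vadd = (\<lambda>f g. \<lambda>x\<in>carrier E. f x + g x),
     vscale = (\<lambda>c f. \<lambda>x\<in>carrier E. c * f x),
     vnorm = (\<lambda>f. SUP x\<in>{x \<in> carrier E. vnorm E x \<le> 1}. \<bar>f x\<bar>)\<rparr>"

primrec partial_sum ::
  "('a, 'z) ordered_normed_space_scheme \<Rightarrow> (nat \<Rightarrow> real) \<Rightarrow> (nat \<Rightarrow> 'a) \<Rightarrow> nat \<Rightarrow> 'a" where
  "partial_sum E a e 0 = vzero E"
| "partial_sum E a e (Suc n) = vadd E (partial_sum E a e n) (vscale E (a n) (e n))"

definition schauder_basis :: "('a, 'z) ordered_normed_space_scheme \<Rightarrow> (nat \<Rightarrow> 'a) \<Rightarrow> bool" where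
  "schauder_basis E e \<longleftrightarrow> range e \<subseteq> carrier E \<and>
     (\<forall>x\<in>carrier E. \<exists>!a. (\<lambda>n. vnorm E (vdiff E x (partial_sum E a e n))) \<longlonglongrightarrow> 0)"

text \<open>
  Operators on \<open>\<Prod>\<^sub>i\<^sub>\<in>\<^sub>I E\<^sub>i\<close> take their argument as a function in the extensional product
  \<^const>\<open>PiE\<close>; only their values there are relevant. For \<open>I = {}\<close> the product has the single
  element \<open>\<lambda>_. undefined\<close>, and an operator is identified with its value there.
\<close>

definition prod_carrier ::
  "nat set \<Rightarrow> (nat \<Rightarrow> ('a, 'z) ordered_normed_space_scheme) \<Rightarrow> (nat \<Rightarrow> 'a) set" where
  "prod_carrier I E = (\<Pi>\<^sub>E i\<in>I. carrier (E i))"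

definition multilinear ::
  "nat set \<Rightarrow> (nat \<Rightarrow> ('a, 'y) ordered_normed_space_scheme) \<Rightarrow> ('b, 'z) ordered_normed_space_scheme
    \<Rightarrow> ((nat \<Rightarrow> 'a) \<Rightarrow> 'b) \<Rightarrow> bool" where
  "multilinear I E F A \<longleftrightarrow> A \<in> prod_carrier I E \<rightarrow> carrier F \<and>
     (\<forall>x\<in>prod_carrier I E. \<forall>i\<in>I. linear_operator (E i) F (\<lambda>u. A (x(i := u))))"

definition positive_multilinear ::
  "nat set \<Rightarrow> (nat \<Rightarrow> ('a, 'y) ordered_normed_space_scheme) \<Rightarrow> ('b, 'z) ordered_normed_space_scheme
    \<Rightarrow> ((nat \<Rightarrow> 'a) \<Rightarrow> 'b) \<Rightarrow> bool" where
  "positive_multilinear I E F A \<longleftrightarrow> multilinear I E F A \<and>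
     (\<forall>x\<in>prod_carrier I E. (\<forall>i\<in>I. vzero (E i) \<sqsubseteq>\<^bsub>E i\<^esub> x i) \<longrightarrow> vzero F \<sqsubseteq>\<^bsub>F\<^esub> A x)"

definition regular_multilinear ::
  "nat set \<Rightarrow> (nat \<Rightarrow> ('a, 'y) ordered_normed_space_scheme) \<Rightarrow> ('b, 'z) ordered_normed_space_scheme
    \<Rightarrow> ((nat \<Rightarrow> 'a) \<Rightarrow> 'b) \<Rightarrow> bool" where
  "regular_multilinear I E F A \<longleftrightarrow>
     (\<exists>P Q. positive_multilinear I E F P \<and> positive_multilinear I E F Q \<and>
        (\<forall>x\<in>prod_carrier I E. A x = vdiff F (P x) (Q x)))"

definition riesz_multimorphism ::
  "nat set \<Rightarrow> (nat \<Rightarrow> ('a, 'y) ordered_normed_space_scheme) \<Rightarrow> ('b, 'z) ordered_normed_space_scheme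
    \<Rightarrow> ((nat \<Rightarrow> 'a) \<Rightarrow> 'b) \<Rightarrow> bool" where
  "riesz_multimorphism I E F A \<longleftrightarrow> regular_multilinear I E F A \<and>
     (\<forall>x\<in>prod_carrier I E. vabs F (A x) = A (\<lambda>i\<in>I. vabs (E i) (x i)))"

text \<open>
  \<open>bar_map E m \<rho> k \<xi>\<close> sends forms on the factors in \<open>index_set m \<rho> (k - 1)\<close> to forms on those in
  \<open>index_set m \<rho> k\<close>: the variable with index \<open>\<rho> k\<close> is eliminated by applying \<open>\<xi>\<close>.
\<close>

definition index_set :: "nat \<Rightarrow> (nat \<Rightarrow> nat) \<Rightarrow> nat \<Rightarrow> nat set" where
  "index_set m \<rho> k = {1..m} - \<rho> ` {1..k}"

definition bar_map ::
  "(nat \<Rightarrow> ('a, 'z) ordered_normed_space_scheme) \<Rightarrow> nat \<Rightarrow> (nat \<Rightarrow> nat) \<Rightarrow> nat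
    \<Rightarrow> (('a \<Rightarrow> real) \<Rightarrow> real) \<Rightarrow> ((nat \<Rightarrow> 'a) \<Rightarrow> real) \<Rightarrow> ((nat \<Rightarrow> 'a) \<Rightarrow> real)" where
  "bar_map E m \<rho> k \<xi> B =
     (\<lambda>x\<in>prod_carrier (index_set m \<rho> k) E. \<xi> (\<lambda>u\<in>carrier (E (\<rho> k)). B (x(\<rho> k := u))))"

primrec bar_iter ::
  "(nat \<Rightarrow> ('a, 'z) ordered_normed_space_scheme) \<Rightarrow> nat \<Rightarrow> (nat \<Rightarrow> nat)
    \<Rightarrow> (nat \<Rightarrow> (('a \<Rightarrow> real) \<Rightarrow> real)) \<Rightarrow> ((nat \<Rightarrow> 'a) \<Rightarrow> real) \<Rightarrow> nat \<Rightarrow> ((nat \<Rightarrow> 'a) \<Rightarrow> real)" where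
  "bar_iter E m \<rho> \<xi> B 0 = B"
| "bar_iter E m \<rho> \<xi> B (Suc k) = bar_map E m \<rho> (Suc k) (\<xi> (\<rho> (Suc k))) (bar_iter E m \<rho> \<xi> B k)"

definition aron_berner ::
  "(nat \<Rightarrow> ('a, 'y) ordered_normed_space_scheme) \<Rightarrow> ('b, 'z) ordered_normed_space_scheme
    \<Rightarrow> nat \<Rightarrow> (nat \<Rightarrow> nat) \<Rightarrow> ((nat \<Rightarrow> 'a) \<Rightarrow> 'b)
    \<Rightarrow> (nat \<Rightarrow> (('a \<Rightarrow> real) \<Rightarrow> real)) \<Rightarrow> (('b \<Rightarrow> real) \<Rightarrow> real)" where
  "aron_berner E F m \<rho> A \<xi> =
     (\<lambda>\<phi>\<in>carrier (dual_lattice F).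
        bar_iter E m \<rho> \<xi> (\<lambda>x\<in>prod_carrier {1..m} E. \<phi> (A x)) m (\<lambda>_. undefined))"

end

theory Submission
  imports Defs
begin

text \<open>
  If \<open>B\<close> and \<open>C\<close> are bounded forms with \<open>\<bar>B x\<bar> = C \<bar>x\<bar>\<close>, then for fixed values of the remaining
  variables the functionals \<open>f = B(x, \<cdot>)\<close> and \<open>h = C(\<bar>x\<bar>, \<cdot>)\<close> satisfy \<open>\<bar>f u\<bar> = h \<bar>u\<bar>\<close>; this forces
  \<open>f = h\<close> or \<open>f = - h\<close>, and \<open>h\<close> is an atom of the dual, so that \<open>\<bar>\<xi> f\<bar> = \<bar>\<xi>\<bar> h\<close> for every \<open>\<xi>\<close> in the
  bidual. Hence the relation survives the elimination of one variable. Starting from \<open>e\<^sub>n \<circ> A\<close>, it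
  gives \<open>\<bar>AB(A)(\<xi>)(e\<^sub>n)\<bar> = AB(A)(\<bar>\<xi>\<bar>)(e\<^sub>n)\<close> on the basis. This decides
  \<open>\<bar>AB(A)(\<xi>)\<bar> = AB(A)(\<bar>\<xi>\<bar>)\<close>, since the positive functionals are exactly those that are
  limits of sums \<open>\<Sum> a\<^sub>k e\<^sub>k\<close> with nonnegative coefficients. All forms involved are norm bounded
  because a positive multilinear operator on Banach lattices is bounded.
\<close>

section \<open>Banach lattices\<close>

text \<open>For general \<xi> and \<open>h \<ge> 0\<close> one has
  \<open>|\<xi> h| \<le> |\<xi>| h\<close>, usually with strict inequality: by the Riesz-Kantorovich
  formula \<open>|\<xi>| h\<close> is the supremum of \<open>\<xi> g - \<xi> (h - g)\<close> over
  \<open>0 \<le> g \<le> h\<close>. Equality holds here because the order interval from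
  \<open>0\<close> to \<open>h\<close> consists of multiples of \<open>h\<close>. That is special to
  scalar forms obtained from Riesz homomorphisms, which is why \<open>A\<close> is tested with the
  \<open>e n\<close> and not with arbitrary functionals on \<open>F\<close>.

  Eliminating with \<xi> on one side and with its modulus on the other makes the two forms drift
  apart, so the induction has to carry a pair.

  The other obstacle is the order of the dual of \<open>F\<close>: nothing in the definition of a
  Schauder basis ties the coefficients of a vector to its positivity. The link comes from
  interpolation. Finitely many \<open>e k\<close>, being Riesz homomorphisms no two of which are
  proportional, take arbitrary joint values, and inside the interval from \<open>- x\<close> to
  \<open>x\<close> the signs of the \<open>e k x\<close> can be chosen at will. Hence replacing
  every \<open>a k\<close> by \<open>|a k|\<close> at most doubles the distance from a partial sum
  to a positive functional.\<close>

definition vpos :: "('a, 'z) ordered_normed_space_scheme \<Rightarrow> 'a \<Rightarrow> 'a" where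
  "vpos E x = x \<squnion>\<^bsub>E\<^esub> vzero E"

context banach_lattice
begin

section \<open>Vector space arithmetic on the carrier\<close>

lemma vadd_closed [simp]: "\<lbrakk>x \<in> carrier E; y \<in> carrier E\<rbrakk> \<Longrightarrow> vadd E x y \<in> carrier E"
  and vzero_closed [simp]: "vzero E \<in> carrier E"
  and vadd_assoc: "\<lbrakk>x \<in> carrier E; y \<in> carrier E; z \<in> carrier E\<rbrakk>
    \<Longrightarrow> vadd E (vadd E x y) z = vadd E x (vadd E y z)"
  and vadd_comm: "\<lbrakk>x \<in> carrier E; y \<in> carrier E\<rbrakk> \<Longrightarrow> vadd E x y = vadd E y x"
  and vadd_zero_left [simp]: "x \<in> carrier E \<Longrightarrow> vadd E (vzero E) x = x"
  and vadd_zero_right [simp]: "x \<in> carrier E \<Longrightarrow> vadd E x (vzero E) = x"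
  and vadd_left_imp_eq: "\<lbrakk>x \<in> carrier E; y \<in> carrier E; z \<in> carrier E; vadd E x y = vadd E x z\<rbrakk>
    \<Longrightarrow> y = z"
proof -
  interpret G: comm_group "\<lparr>carrier = carrier E, mult = vadd E, one = vzero E\<rparr>"
    by (rule add_group)
  show "\<lbrakk>x \<in> carrier E; y \<in> carrier E\<rbrakk> \<Longrightarrow> vadd E x y \<in> carrier E"
    using G.m_closed by simp
  show "vzero E \<in> carrier E"
    using G.one_closed by simp
  show "\<lbrakk>x \<in> carrier E; y \<in> carrier E; z \<in> carrier E\<rbrakk>
    \<Longrightarrow> vadd E (vadd E x y) z = vadd E x (vadd E y z)"
    using G.m_assoc by simp
  show "\<lbrakk>x \<in> carrier E; y \<in> carrier E\<rbrakk> \<Longrightarrow> vadd E x y = vadd E y x"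
    using G.m_comm by simp
  show "x \<in> carrier E \<Longrightarrow> vadd E (vzero E) x = x"
    using G.l_one by simp
  show "x \<in> carrier E \<Longrightarrow> vadd E x (vzero E) = x"
    using G.r_one by simp
  show "\<lbrakk>x \<in> carrier E; y \<in> carrier E; z \<in> carrier E; vadd E x y = vadd E x z\<rbrakk> \<Longrightarrow> y = z"
    using G.Units_l_cancel[of x y z] by simp
qed

lemma vadd_lcomm:
  "\<lbrakk>x \<in> carrier E; y \<in> carrier E; z \<in> carrier E\<rbrakk>
    \<Longrightarrow> vadd E x (vadd E y z) = vadd E y (vadd E x z)"
  by (metis vadd_assoc vadd_comm)

declare scale_closed [simp] scale_one [simp]

lemma scale_zero_left [simp]: "x \<in> carrier E \<Longrightarrow> vscale E 0 x = vzero E"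
  using scale_add_left[of x 0 0] vadd_left_imp_eq[of "vscale E 0 x" "vscale E 0 x" "vzero E"] by simp

lemma scale_zero_right [simp]: "vscale E c (vzero E) = vzero E"
  using scale_scale[of "vzero E" c 0] by simp

text \<open>
  Linear identities in three vectors reduce to real arithmetic in the coefficients: the
  function \<open>L\<close> is opaque, so that the equations can be used as rewrite rules.
\<close>

lemma linear_coordinates:
  assumes "x \<in> carrier E" "y \<in> carrier E" "z \<in> carrier E"
  obtains L :: "real \<Rightarrow> real \<Rightarrow> real \<Rightarrow> 'a" where
    "\<And>a b c. L a b c \<in> carrier E"
    "\<And>a b c a' b' c'. vadd E (L a b c) (L a' b' c') = L (a + a') (b + b') (c + c')"
    "\<And>d a b c. vscale E d (L a b c) = L (d * a) (d * b) (d * c)"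
    "x = L 1 0 0" "y = L 0 1 0" "z = L 0 0 1" "vzero E = L 0 0 0"
proof -
  define L where "L a b c = vadd E (vscale E a x) (vadd E (vscale E b y) (vscale E c z))" for a b c
  show ?thesis
  proof (rule that[of L])
    show "L a b c \<in> carrier E" for a b c
      using assms by (simp add: L_def)
    show "vadd E (L a b c) (L a' b' c') = L (a + a') (b + b') (c + c')" for a b c a' b' c'
      using assms by (simp add: L_def scale_add_left vadd_assoc vadd_lcomm)
    show "vscale E d (L a b c) = L (d * a) (d * b) (d * c)" for d a b c
      using assms by (simp add: L_def scale_add_right scale_scale)
  qed (use assms in \<open>simp_all add: L_def\<close>)
qed

lemma vdiff_closed [simp]: "\<lbrakk>x \<in> carrier E; y \<in> carrier E\<rbrakk> \<Longrightarrow> vdiff E x y \<in> carrier E"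
  by (simp add: vdiff_def)

lemma vdiff_zero_right [simp]: "x \<in> carrier E \<Longrightarrow> vdiff E x (vzero E) = x"
  by (simp add: vdiff_def)

lemma vdiff_zero_left: "x \<in> carrier E \<Longrightarrow> vdiff E (vzero E) x = vscale E (- 1) x"
  by (simp add: vdiff_def)

lemma vdiff_self [simp]: "x \<in> carrier E \<Longrightarrow> vdiff E x x = vzero E"
  unfolding vdiff_def by (rule linear_coordinates[of x x x]) auto

lemma vdiff_vadd_cancel [simp]:
  assumes "x \<in> carrier E" "y \<in> carrier E"
  shows "vadd E (vdiff E x y) y = x" "vdiff E (vadd E x y) y = x" "vadd E y (vdiff E x y) = x"
    "vdiff E (vadd E x y) x = y"
proof -
  obtain L where L: "\<And>a b c a' b' c'. vadd E (L a b c) (L a' b' c') = L (a + a') (b + b') (c + c')"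
    "\<And>d a b c. vscale E d (L a b c) = L (d * a) (d * b) (d * c)" "x = L 1 0 0" "y = L 0 1 0"
    using linear_coordinates[OF assms assms(1)] by metis
  show "vadd E (vdiff E x y) y = x" "vdiff E (vadd E x y) y = x" "vadd E y (vdiff E x y) = x"
    "vdiff E (vadd E x y) x = y"
    by (simp_all add: vdiff_def L)
qed

lemma vdiff_vdiff_cancel [simp]:
  assumes "x \<in> carrier E" "y \<in> carrier E"
  shows "vdiff E x (vdiff E x y) = y"
proof -
  obtain L where L: "\<And>a b c a' b' c'. vadd E (L a b c) (L a' b' c') = L (a + a') (b + b') (c + c')"
    "\<And>d a b c. vscale E d (L a b c) = L (d * a) (d * b) (d * c)" "x = L 1 0 0" "y = L 0 1 0"
    using linear_coordinates[OF assms assms(1)] by metis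
  show ?thesis
    by (simp add: vdiff_def L)
qed

lemma scale_minus_scale [simp]: "x \<in> carrier E \<Longrightarrow> vscale E (- 1) (vscale E (- 1) x) = x"
  by (simp add: scale_scale)

lemma scale_vdiff:
  "\<lbrakk>x \<in> carrier E; y \<in> carrier E\<rbrakk> \<Longrightarrow> vscale E c (vdiff E x y) = vdiff E (vscale E c x) (vscale E c y)"
  by (simp add: vdiff_def scale_add_right scale_scale)

lemma vadd_vdiff_vdiff:
  assumes "x \<in> carrier E" "y \<in> carrier E" "z \<in> carrier E" "w \<in> carrier E"
  shows "vadd E (vdiff E x y) (vdiff E z w) = vdiff E (vadd E x z) (vadd E y w)"
  using assms by (simp add: vdiff_def scale_add_right vadd_assoc vadd_lcomm)

lemma minus_vdiff:
  assumes "x \<in> carrier E" "y \<in> carrier E"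
  shows "vscale E (- 1) (vdiff E x y) = vdiff E y x"
  using assms by (simp add: vdiff_def scale_add_right scale_scale vadd_comm)

section \<open>Compatibility of the order with the linear structure\<close>

lemma vadd_mono:
  assumes "x \<sqsubseteq> y" "z \<sqsubseteq> w" "x \<in> carrier E" "y \<in> carrier E" "z \<in> carrier E" "w \<in> carrier E"
  shows "vadd E x z \<sqsubseteq> vadd E y w"
proof -
  have "vadd E x z \<sqsubseteq> vadd E y z"
    using assms by (simp add: add_mono)
  also have "vadd E y z \<sqsubseteq> vadd E y w"
    using assms add_mono[of z w y] by (simp add: vadd_comm)
  finally show ?thesis using assms by simp
qed

lemma vdiff_nonneg_iff:
  assumes "x \<in> carrier E" "y \<in> carrier E"
  shows "vzero E \<sqsubseteq> vdiff E y x \<longleftrightarrow> x \<sqsubseteq> y"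
proof
  assume "vzero E \<sqsubseteq> vdiff E y x"
  then have "vadd E (vzero E) x \<sqsubseteq> vadd E (vdiff E y x) x"
    using assms by (intro add_mono) auto
  then show "x \<sqsubseteq> y" using assms by simp
next
  assume "x \<sqsubseteq> y"
  then have "vadd E x (vscale E (- 1) x) \<sqsubseteq> vadd E y (vscale E (- 1) x)"
    using assms by (intro add_mono) auto
  then show "vzero E \<sqsubseteq> vdiff E y x" using assms vdiff_self[of x] by (simp add: vdiff_def)
qed

lemma scale_mono_le:
  assumes "x \<sqsubseteq> y" "0 \<le> c" "x \<in> carrier E" "y \<in> carrier E"
  shows "vscale E c x \<sqsubseteq> vscale E c y"
proof -
  have "vzero E \<sqsubseteq> vscale E c (vdiff E y x)"
    using assms by (intro scale_mono) (auto simp: vdiff_nonneg_iff)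
  also have "vscale E c (vdiff E y x) = vdiff E (vscale E c y) (vscale E c x)"
    using assms by (simp add: vdiff_def scale_add_right scale_scale)
  finally show ?thesis using assms by (simp add: vdiff_nonneg_iff)
qed

lemma vdiff_le_iff:
  assumes "x \<in> carrier E" "y \<in> carrier E" "z \<in> carrier E"
  shows "vdiff E x y \<sqsubseteq> z \<longleftrightarrow> x \<sqsubseteq> vadd E z y"
proof -
  obtain L where L: "\<And>a b c a' b' c'. vadd E (L a b c) (L a' b' c') = L (a + a') (b + b') (c + c')"
    "\<And>d a b c. vscale E d (L a b c) = L (d * a) (d * b) (d * c)"
    "x = L 1 0 0" "y = L 0 1 0" "z = L 0 0 1"
    using linear_coordinates[OF assms] by metis
  have "vdiff E z (vdiff E x y) = vdiff E (vadd E z y) x"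
    by (simp add: vdiff_def L)
  then show ?thesis
    using assms vdiff_nonneg_iff[of "vdiff E x y" z] vdiff_nonneg_iff[of x "vadd E z y"] by simp
qed

lemma minus_le_minus:
  assumes "x \<sqsubseteq> y" "x \<in> carrier E" "y \<in> carrier E"
  shows "vscale E (- 1) y \<sqsubseteq> vscale E (- 1) x"
proof -
  have "vdiff E (vscale E (- 1) x) (vscale E (- 1) y) = vdiff E y x"
    using assms by (simp add: vdiff_def scale_scale vadd_comm)
  then show ?thesis
    using assms vdiff_nonneg_iff[of x y]
      vdiff_nonneg_iff[of "vscale E (- 1) y" "vscale E (- 1) x"] by simp
qed

lemma vdiff_le_self:
  assumes "vzero E \<sqsubseteq> y" "x \<in> carrier E" "y \<in> carrier E"
  shows "vdiff E x y \<sqsubseteq> x"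
  using assms vadd_mono[of x x "vzero E" y] by (simp add: vdiff_le_iff)

lemma vadd_nonneg:
  "\<lbrakk>vzero E \<sqsubseteq> x; vzero E \<sqsubseteq> y; x \<in> carrier E; y \<in> carrier E\<rbrakk> \<Longrightarrow> vzero E \<sqsubseteq> vadd E x y"
  using vadd_mono[of "vzero E" x "vzero E" y] by simp

lemma le_antisym: "\<lbrakk>x \<sqsubseteq> y; y \<sqsubseteq> x; x \<in> carrier E; y \<in> carrier E\<rbrakk> \<Longrightarrow> x = y"
  using weak_le_antisym by (simp add: eq_is_equal)

section \<open>Positive part and modulus\<close>

lemma vpos_closed [simp]: "x \<in> carrier E \<Longrightarrow> vpos E x \<in> carrier E"
  by (simp add: vpos_def)

lemma le_vpos [simp]: "x \<in> carrier E \<Longrightarrow> x \<sqsubseteq> vpos E x"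
  by (simp add: vpos_def join_left)

lemma vpos_nonneg [simp]: "x \<in> carrier E \<Longrightarrow> vzero E \<sqsubseteq> vpos E x"
  by (simp add: vpos_def join_right)

lemma vpos_least:
  "\<lbrakk>x \<sqsubseteq> y; vzero E \<sqsubseteq> y; x \<in> carrier E; y \<in> carrier E\<rbrakk> \<Longrightarrow> vpos E x \<sqsubseteq> y"
  by (simp add: vpos_def join_le)

text \<open>For every \<open>y\<close> the vector \<open>vpos E y - y\<close> is an upper bound of
  \<open>- y\<close> and \<open>0\<close>, so it dominates the positive part of \<open>- y\<close>.
  The same fact for \<open>- x\<close> gives the reverse inequality.\<close>

lemma vpos_diff_vpos:
  assumes x: "x \<in> carrier E"
  shows "vdiff E (vpos E x) (vpos E (vscale E (- 1) x)) = x"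
proof -
  have half: "vpos E (vscale E (- 1) y) \<sqsubseteq> vdiff E (vpos E y) y" if y: "y \<in> carrier E" for y
  proof (rule vpos_least)
    show "vscale E (- 1) y \<sqsubseteq> vdiff E (vpos E y) y"
      using y vadd_mono[of "vzero E" "vpos E y" "vscale E (- 1) y" "vscale E (- 1) y"]
      by (simp add: vdiff_def)
    show "vzero E \<sqsubseteq> vdiff E (vpos E y) y"
      using y by (simp add: vdiff_nonneg_iff)
  qed (use y in simp_all)
  let ?p = "vpos E x" and ?n = "vpos E (vscale E (- 1) x)"
  have "vdiff E ?p ?n = x \<longleftrightarrow> ?n = vdiff E ?p x"
    using x by (metis scale_closed vpos_closed vdiff_vdiff_cancel)
  moreover have "vdiff E ?p x \<sqsubseteq> ?n"
  proof -
    have "?p \<sqsubseteq> vdiff E ?n (vscale E (- 1) x)"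
      using half[of "vscale E (- 1) x"] x by simp
    also have "vdiff E ?n (vscale E (- 1) x) = vadd E ?n x"
      using x by (simp add: vdiff_def)
    finally show ?thesis
      using x by (simp add: vdiff_le_iff)
  qed
  ultimately show ?thesis
    using x half[of x] by (metis le_antisym scale_closed vpos_closed vdiff_closed)
qed

lemma vabs_closed [simp]: "x \<in> carrier E \<Longrightarrow> vabs E x \<in> carrier E"
  by (simp add: vabs_def)

lemma le_vabs [simp]: "x \<in> carrier E \<Longrightarrow> x \<sqsubseteq> vabs E x"
  by (simp add: vabs_def join_left)

lemma minus_le_vabs [simp]: "x \<in> carrier E \<Longrightarrow> vscale E (- 1) x \<sqsubseteq> vabs E x"
  by (simp add: vabs_def join_right)

lemma vabs_least:
  "\<lbrakk>x \<sqsubseteq> y; vscale E (- 1) x \<sqsubseteq> y; x \<in> carrier E; y \<in> carrier E\<rbrakk> \<Longrightarrow> vabs E x \<sqsubseteq> y"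
  by (simp add: vabs_def join_le)

lemma vabs_nonneg [simp]:
  assumes "x \<in> carrier E"
  shows "vzero E \<sqsubseteq> vabs E x"
proof -
  have "vadd E x (vscale E (- 1) x) \<sqsubseteq> vadd E (vabs E x) (vabs E x)"
    using assms by (intro vadd_mono) auto
  then have "vzero E \<sqsubseteq> vadd E (vabs E x) (vabs E x)"
    using assms vdiff_self[of x] by (simp add: vdiff_def)
  then have "vzero E \<sqsubseteq> vscale E (1/2) (vadd E (vabs E x) (vabs E x))"
    using assms by (intro scale_mono) auto
  also have "vscale E (1/2) (vadd E (vabs E x) (vabs E x)) = vabs E x"
    using assms scale_add_left[of "vabs E x" "1/2" "1/2"] by (simp add: scale_add_right)
  finally show ?thesis .
qed

lemma minus_le_self:
  assumes "vzero E \<sqsubseteq> x" "x \<in> carrier E"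
  shows "vscale E (- 1) x \<sqsubseteq> x"
  using assms minus_le_minus[of "vzero E" x] le_trans[of "vscale E (- 1) x" "vzero E" x] by simp

lemma vabs_eq_self: "\<lbrakk>vzero E \<sqsubseteq> x; x \<in> carrier E\<rbrakk> \<Longrightarrow> vabs E x = x"
  by (rule le_antisym) (simp_all add: vabs_least minus_le_self)

text \<open>The sum of the two parts dominates both \<open>x\<close> and \<open>- x\<close>.
  Conversely, half of \<open>|x| + x\<close> is an upper bound of \<open>x\<close> and
  \<open>0\<close>, so twice the positive part is at most \<open>|x| + x\<close>, and twice the
  positive part minus \<open>x\<close> is the sum of the parts.\<close>

lemma vabs_eq_vpos_add:
  assumes x: "x \<in> carrier E"
  shows "vabs E x = vadd E (vpos E x) (vpos E (vscale E (- 1) x))"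
proof (rule le_antisym)
  let ?p = "vpos E x" and ?n = "vpos E (vscale E (- 1) x)"
  have x_le: "x \<sqsubseteq> vadd E ?p ?n" "vscale E (- 1) x \<sqsubseteq> vadd E ?p ?n"
    using x vadd_mono[of x ?p "vzero E" ?n] vadd_mono[of "vzero E" ?p "vscale E (- 1) x" ?n] by simp_all
  then show "vabs E x \<sqsubseteq> vadd E ?p ?n"
    using x by (intro vabs_least) auto
  obtain L where L: "\<And>a b c a' b' c'. vadd E (L a b c) (L a' b' c') = L (a + a') (b + b') (c + c')"
    "\<And>d a b c. vscale E d (L a b c) = L (d * a) (d * b) (d * c)"
    "?p = L 1 0 0" "?n = L 0 1 0" "vabs E x = L 0 0 1" "vzero E = L 0 0 0"
    using linear_coordinates[of ?p ?n "vabs E x"] x by (metis scale_closed vabs_closed vpos_closed)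
  have xL: "x = L 1 (-1) 0"
    using vpos_diff_vpos[OF x] by (simp add: L vdiff_def)
  have "vscale E 2 ?p \<sqsubseteq> vadd E (vabs E x) x"
  proof -
    have "?p \<sqsubseteq> vscale E (1/2) (vadd E (vabs E x) x)"
    proof (rule vpos_least)
      have "vzero E \<sqsubseteq> vadd E (vabs E x) x"
        using vdiff_le_iff[of "vzero E" x "vabs E x"] x by (simp add: vdiff_zero_left)
      then show "vzero E \<sqsubseteq> vscale E (1/2) (vadd E (vabs E x) x)"
        using x by (intro scale_mono) auto
      have "x = vscale E (1/2) (vadd E x x)"
        using xL by (simp add: L)
      moreover have "vscale E (1/2) (vadd E x x) \<sqsubseteq> vscale E (1/2) (vadd E (vabs E x) x)"
        using x by (intro scale_mono_le add_mono) auto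
      ultimately show "x \<sqsubseteq> vscale E (1/2) (vadd E (vabs E x) x)"
        by simp
    qed (use x in auto)
    then have "vscale E 2 ?p \<sqsubseteq> vscale E 2 (vscale E (1/2) (vadd E (vabs E x) x))"
      using x by (intro scale_mono_le) auto
    then show ?thesis using x by (simp add: scale_scale)
  qed
  then have "vdiff E (vscale E 2 ?p) x \<sqsubseteq> vabs E x"
    using x by (simp add: vdiff_le_iff)
  moreover have "vdiff E (vscale E 2 ?p) x = vadd E ?p ?n"
    unfolding vdiff_def by (subst (2) xL) (simp add: L)
  ultimately show "vadd E ?p ?n \<sqsubseteq> vabs E x" by simp
qed (use x in auto)

lemma vpos_le_vabs: "x \<in> carrier E \<Longrightarrow> vpos E x \<sqsubseteq> vabs E x"
  by (rule vpos_least) auto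

section \<open>Monotonicity of the norm, decomposition and limits\<close>

lemma vnorm_vabs [simp]:
  assumes "x \<in> carrier E"
  shows "vnorm E (vabs E x) = vnorm E x"
proof (rule antisym)
  have "vabs E (vabs E x) = vabs E x"
    using assms by (intro vabs_eq_self) auto
  then show "vnorm E (vabs E x) \<le> vnorm E x" "vnorm E x \<le> vnorm E (vabs E x)"
    using assms norm_mono[of "vabs E x" x] norm_mono[of x "vabs E x"] by simp_all
qed

lemma vnorm_le_of_between:
  assumes "vscale E (- 1) y \<sqsubseteq> x" "x \<sqsubseteq> y" "x \<in> carrier E" "y \<in> carrier E"
  shows "vnorm E x \<le> vnorm E y"
proof (rule norm_mono)
  have "vscale E (- 1) x \<sqsubseteq> y"
    using minus_le_minus[OF assms(1)] assms by simp
  then have "vabs E x \<sqsubseteq> y"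
    using assms by (intro vabs_least) auto
  then show "vabs E x \<sqsubseteq> vabs E y"
    using assms le_trans[of "vabs E x" y "vabs E y"] by simp
qed (use assms in auto)

lemma vnorm_mono:
  assumes "vzero E \<sqsubseteq> x" "x \<sqsubseteq> y" "x \<in> carrier E" "y \<in> carrier E"
  shows "vnorm E x \<le> vnorm E y"
proof (rule vnorm_le_of_between)
  show "vscale E (- 1) y \<sqsubseteq> x"
    using assms minus_le_minus[of "vzero E" y] le_trans[of "vzero E" x y]
      le_trans[of "vscale E (- 1) y" "vzero E" x] by simp
qed (use assms in auto)

lemma vnorm_vpos_le: "x \<in> carrier E \<Longrightarrow> vnorm E (vpos E x) \<le> vnorm E x"
  using vnorm_mono[of "vpos E x" "vabs E x"] by (simp add: vpos_le_vabs)

lemma vnorm_vpos_minus_le: "x \<in> carrier E \<Longrightarrow> vnorm E (vpos E (vscale E (- 1) x)) \<le> vnorm E x"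
  using vnorm_vpos_le[of "vscale E (- 1) x"] by (simp add: norm_scale)

lemma vnorm_zero [simp]: "vnorm E (vzero E) = 0"
  by (simp add: norm_eq_0)

lemma vnorm_vdiff_commute:
  "\<lbrakk>x \<in> carrier E; y \<in> carrier E\<rbrakk> \<Longrightarrow> vnorm E (vdiff E x y) = vnorm E (vdiff E y x)"
  using norm_scale[of "vdiff E x y" "- 1"] by (simp add: minus_vdiff)

text \<open>The excess of \<open>z\<close> over \<open>x\<close>, that is the positive part of
  \<open>z - x\<close>, is the share of \<open>y\<close>; what remains is the infimum of
  \<open>z\<close> and \<open>x\<close>. This splitting makes the Riesz-Kantorovich supremum
  additive.\<close>

lemma riesz_decomposition:
  assumes "vzero E \<sqsubseteq> z" "z \<sqsubseteq> vadd E x y" "vzero E \<sqsubseteq> x" "vzero E \<sqsubseteq> y"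
    and "x \<in> carrier E" "y \<in> carrier E" "z \<in> carrier E"
  obtains u v where "u \<in> carrier E" "v \<in> carrier E" "z = vadd E u v"
    "vzero E \<sqsubseteq> u" "u \<sqsubseteq> x" "vzero E \<sqsubseteq> v" "v \<sqsubseteq> y"
proof -
  define v where "v = vpos E (vdiff E z x)"
  define u where "u = vdiff E z v"
  have carr: "v \<in> carrier E" "u \<in> carrier E"
    using assms by (simp_all add: u_def v_def)
  have z: "z = vadd E u v"
    using assms carr by (simp add: u_def)
  have v_nonneg: "vzero E \<sqsubseteq> v"
    using assms by (simp add: v_def)
  have "vdiff E z x \<sqsubseteq> y"
    using assms by (simp add: vdiff_le_iff vadd_comm)
  then have v_le: "v \<sqsubseteq> y"
    using assms by (simp add: v_def vpos_least)
  have "v \<sqsubseteq> z"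
    unfolding v_def using assms by (intro vpos_least vdiff_le_self) auto
  then have u_nonneg: "vzero E \<sqsubseteq> u"
    using assms carr by (simp add: u_def vdiff_nonneg_iff)
  have "vdiff E z x \<sqsubseteq> v"
    using assms by (simp add: v_def)
  then have u_le: "u \<sqsubseteq> x"
    unfolding u_def using assms carr by (simp add: vdiff_le_iff vadd_comm)
  show ?thesis
    by (rule that[of u v]) (fact carr z u_nonneg u_le v_nonneg v_le)+
qed

text \<open>The positive cone is closed: once \<open>s n\<close> is positive, the negative part of
  \<open>l\<close> lies below the positive part of \<open>s n - l\<close>, so its norm is at most
  the distance from \<open>s n\<close> to \<open>l\<close>.\<close>

lemma nonneg_of_tendsto:
  assumes "range s \<subseteq> carrier E" "l \<in> carrier E" "\<forall>\<^sub>F n in sequentially. vzero E \<sqsubseteq> s n"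
    and lim: "(\<lambda>n. vnorm E (vdiff E (s n) l)) \<longlonglongrightarrow> 0"
  shows "vzero E \<sqsubseteq> l"
proof -
  let ?n = "vpos E (vscale E (- 1) l)"
  have s: "s n \<in> carrier E" for n using assms(1) by auto
  have "vnorm E ?n \<le> vnorm E (vdiff E (s n) l)" if "vzero E \<sqsubseteq> s n" for n
  proof -
    have "vscale E (- 1) l \<sqsubseteq> vdiff E (s n) l"
      using assms(2) s that vadd_mono[of "vzero E" "s n" "vscale E (- 1) l" "vscale E (- 1) l"]
      by (simp add: vdiff_def)
    then have "?n \<sqsubseteq> vpos E (vdiff E (s n) l)"
      using assms(2) s
      by (intro vpos_least le_trans[of "vscale E (- 1) l" "vdiff E (s n) l" "vpos E (vdiff E (s n) l)"]) auto
    then have "vnorm E ?n \<le> vnorm E (vpos E (vdiff E (s n) l))"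
      using assms(2) s by (intro vnorm_mono) auto
    also have "\<dots> \<le> vnorm E (vdiff E (s n) l)"
      using assms(2) s by (intro vnorm_vpos_le) auto
    finally show ?thesis .
  qed
  then have "vnorm E ?n \<le> 0"
    using assms(3) by (intro tendsto_lowerbound[OF lim]) (auto elim: eventually_mono)
  then have "?n = vzero E"
    using assms(2) norm_nonneg[of ?n] norm_eq_0[of ?n] by simp
  then have "vscale E (- 1) l \<sqsubseteq> vzero E"
    using assms(2) le_vpos[of "vscale E (- 1) l"] by simp
  then show ?thesis
    using assms(2) minus_le_minus[of "vscale E (- 1) l" "vzero E"] by simp
qed

text \<open>The bound is the sum of the series of the \<open>w n\<close>. Norm completeness gives
  its convergence; the partial sums increase and dominate each term, and closedness of the cone
  passes this to the limit.\<close>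

lemma upper_bound_of_small_sequence:
  assumes w: "\<And>n. w n \<in> carrier E" "\<And>n. vzero E \<sqsubseteq> w n" "\<And>n. vnorm E (w n) \<le> (1/2) ^ n"
  obtains y where "y \<in> carrier E" "\<And>n. w n \<sqsubseteq> y"
proof -
  define s where "s = rec_nat (vzero E) (\<lambda>n v. vadd E v (w n))"
  have s0: "s 0 = vzero E" and s_Suc: "s (Suc n) = vadd E (s n) (w n)" for n
    by (simp_all add: s_def)
  have s: "s n \<in> carrier E" for n
    by (induction n) (simp_all add: s0 s_Suc w)
  \<comment> \<open>The right-hand side is the exact geometric sum of \<open>(1/2) ^ j\<close> for
    \<open>j\<close> from \<open>n\<close> to \<open>n + k - 1\<close>, so the induction closes
    without loss.\<close>
  have step: "vnorm E (vdiff E (s (n + k)) (s n)) \<le> 2 * (1/2) ^ n - 2 * (1/2) ^ (n + k)" for n k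
  proof (induction k)
    case (Suc k)
    obtain L where L: "\<And>a b c a' b' c'. vadd E (L a b c) (L a' b' c') = L (a + a') (b + b') (c + c')"
      "\<And>d a b c. vscale E d (L a b c) = L (d * a) (d * b) (d * c)"
      "s (n + k) = L 1 0 0" "s n = L 0 1 0" "w (n + k) = L 0 0 1"
      using linear_coordinates[OF s[of "n + k"] s[of n] w(1)[of "n + k"]] by metis
    have "vdiff E (s (n + Suc k)) (s n) = vadd E (vdiff E (s (n + k)) (s n)) (w (n + k))"
      by (simp add: s_Suc L vdiff_def)
    then have "vnorm E (vdiff E (s (n + Suc k)) (s n)) \<le>
        vnorm E (vdiff E (s (n + k)) (s n)) + vnorm E (w (n + k))"
      by (simp add: norm_triangle s w)
    also have "\<dots> \<le> 2 * (1/2) ^ n - 2 * (1/2) ^ (n + k) + (1/2) ^ (n + k)"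
      using Suc w(3)[of "n + k"] by linarith
    finally show ?case by simp
  qed (simp add: s)
  \<comment> \<open>Comparison through \<open>s N\<close>: two tails, each at most
    \<open>2 * (1/2) ^ N\<close>.\<close>
  have near: "vnorm E (vdiff E (s p) (s q)) \<le> 4 * (1/2) ^ N" if "N \<le> p" "N \<le> q" for p q N
  proof -
    obtain L where L: "\<And>a b c a' b' c'. vadd E (L a b c) (L a' b' c') = L (a + a') (b + b') (c + c')"
      "\<And>d a b c. vscale E d (L a b c) = L (d * a) (d * b) (d * c)"
      "s p = L 1 0 0" "s q = L 0 1 0" "s N = L 0 0 1"
      using linear_coordinates[OF s[of p] s[of q] s[of N]] by metis
    have "vdiff E (s p) (s q) = vadd E (vdiff E (s p) (s N)) (vdiff E (s N) (s q))"
      by (simp add: L vdiff_def)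
    then have "vnorm E (vdiff E (s p) (s q)) \<le>
        vnorm E (vdiff E (s p) (s N)) + vnorm E (vdiff E (s N) (s q))"
      by (simp add: norm_triangle s)
    also have "\<dots> = vnorm E (vdiff E (s p) (s N)) + vnorm E (vdiff E (s q) (s N))"
      using vnorm_vdiff_commute[OF s s] by metis
    also have "\<dots> \<le> 4 * (1/2) ^ N - 2 * (1/2) ^ p - 2 * (1/2) ^ q"
      using step[of N "p - N"] step[of N "q - N"] that by simp
    also have "\<dots> \<le> 4 * (1/2) ^ N"
      using zero_le_power[of "1/2 :: real" p] zero_le_power[of "1/2 :: real" q] by linarith
    finally show ?thesis .
  qed
  have "\<exists>N. \<forall>p\<ge>N. \<forall>q\<ge>N. vnorm E (vdiff E (s p) (s q)) < \<epsilon>" if "\<epsilon> > 0" for \<epsilon>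
  proof -
    have "\<exists>N. (1/2 :: real) ^ N < \<epsilon> / 4"
      by (rule real_arch_pow_inv) (use that in simp_all)
    then obtain N where "4 * (1/2 :: real) ^ N < \<epsilon>" by (auto simp: field_simps)
    then show ?thesis using near by (meson le_less_trans)
  qed
  moreover have "range s \<subseteq> carrier E"
    using s by blast
  ultimately obtain l where l: "l \<in> carrier E" "(\<lambda>n. vnorm E (vdiff E (s n) l)) \<longlonglongrightarrow> 0"
    using complete[of s] by blast
  have s_mono: "s n \<sqsubseteq> s (n + k)" for n k
  proof (induction k)
    case (Suc k)
    have "s (n + k) \<sqsubseteq> s (n + Suc k)"
      using vadd_mono[of "s (n + k)" "s (n + k)" "vzero E" "w (n + k)"] s w by (simp add: s_Suc)
    with Suc show ?case
      by (rule le_trans) (rule s)+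
  qed (simp add: s)
  have s_nonneg: "vzero E \<sqsubseteq> s n" for n
    using s_mono[of 0 n] by (simp add: s0)
  have "w n \<sqsubseteq> l" for n
  proof -
    \<comment> \<open>The term \<open>w n\<close> enters the partial sums only at index
      \<open>Suc n\<close>.\<close>
    have le: "w n \<sqsubseteq> s q" if "q \<ge> Suc n" for q
    proof -
      have "w n \<sqsubseteq> s (Suc n)"
        using vadd_mono[of "vzero E" "s n" "w n" "w n"] s w s_nonneg by (simp add: s_Suc)
      then show ?thesis
        using s_mono[of "Suc n" "q - Suc n"] that s w le_trans[of "w n" "s (Suc n)" "s q"] by simp
    qed
    have "vzero E \<sqsubseteq> vdiff E l (w n)"
    proof (rule nonneg_of_tendsto)
      show "range (\<lambda>q. vdiff E (s q) (w n)) \<subseteq> carrier E" using s w by auto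
      show "\<forall>\<^sub>F q in sequentially. vzero E \<sqsubseteq> vdiff E (s q) (w n)"
        using eventually_ge_at_top[of "Suc n"] by eventually_elim (simp add: vdiff_nonneg_iff s w le)
      have "vdiff E (vdiff E (s q) (w n)) (vdiff E l (w n)) = vdiff E (s q) l" for q
      proof -
        obtain L where L: "\<And>a b c a' b' c'. vadd E (L a b c) (L a' b' c') = L (a + a') (b + b') (c + c')"
          "\<And>d a b c. vscale E d (L a b c) = L (d * a) (d * b) (d * c)"
          "s q = L 1 0 0" "l = L 0 1 0" "w n = L 0 0 1"
          using linear_coordinates[OF s[of q] l(1) w(1)[of n]] by metis
        show ?thesis by (simp add: L vdiff_def)
      qed
      then show "(\<lambda>q. vnorm E (vdiff E (vdiff E (s q) (w n)) (vdiff E l (w n)))) \<longlonglongrightarrow> 0"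
        using l by simp
    qed (use l w in auto)
    then show ?thesis using l w by (simp add: vdiff_nonneg_iff)
  qed
  then show ?thesis using l that by blast
qed

end

section \<open>The dual of a Banach lattice\<close>

lemma dual_lattice_simps:
  "f \<sqsubseteq>\<^bsub>dual_lattice E\<^esub> g \<longleftrightarrow> (\<forall>x\<in>carrier E. vzero E \<sqsubseteq>\<^bsub>E\<^esub> x \<longrightarrow> f x \<le> g x)"
  "f .=\<^bsub>dual_lattice E\<^esub> g \<longleftrightarrow> f = g"
  "vzero (dual_lattice E) = (\<lambda>x\<in>carrier E. 0)"
  "vadd (dual_lattice E) f g = (\<lambda>x\<in>carrier E. f x + g x)"
  "vscale (dual_lattice E) c f = (\<lambda>x\<in>carrier E. c * f x)"
  "vnorm (dual_lattice E) f = (SUP x\<in>{x \<in> carrier E. vnorm E x \<le> 1}. \<bar>f x\<bar>)"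
  by (simp_all add: dual_lattice_def)

lemma real_lattice_simps:
  "carrier real_lattice = UNIV" "x \<sqsubseteq>\<^bsub>real_lattice\<^esub> y \<longleftrightarrow> x \<le> y" "x .=\<^bsub>real_lattice\<^esub> y \<longleftrightarrow> x = y"
  "vzero real_lattice = 0" "vadd real_lattice = (+)" "vscale real_lattice = (*)" "vnorm real_lattice = abs"
  by (simp_all add: real_lattice_def)

lemma dual_carrier_iff:
  "f \<in> carrier (dual_lattice E) \<longleftrightarrow> f \<in> extensional (carrier E) \<and>
    (\<forall>x\<in>carrier E. \<forall>y\<in>carrier E. f (vadd E x y) = f x + f y) \<and>
    (\<forall>c. \<forall>x\<in>carrier E. f (vscale E c x) = c * f x) \<and>
    (\<exists>C. \<forall>x\<in>carrier E. \<bar>f x\<bar> \<le> C * vnorm E x)"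
  by (simp add: dual_lattice_def linear_operator_def real_lattice_simps)

lemma dual_vdiff_apply:
  "x \<in> carrier E \<Longrightarrow> vdiff (dual_lattice E) f g x = f x - g x"
  by (simp add: vdiff_def dual_lattice_simps)

lemma dual_add: "\<lbrakk>f \<in> carrier (dual_lattice E); x \<in> carrier E; y \<in> carrier E\<rbrakk>
    \<Longrightarrow> f (vadd E x y) = f x + f y"
  and dual_scale: "\<lbrakk>f \<in> carrier (dual_lattice E); x \<in> carrier E\<rbrakk> \<Longrightarrow> f (vscale E c x) = c * f x"
  by (simp_all add: dual_carrier_iff)

lemma dual_eqI:
  "\<lbrakk>f \<in> carrier (dual_lattice E); g \<in> carrier (dual_lattice E); \<And>x. x \<in> carrier E \<Longrightarrow> f x = g x\<rbrakk>
    \<Longrightarrow> f = g"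
  by (rule extensionalityI[of _ "carrier E"]) (auto simp: dual_carrier_iff)

context banach_lattice
begin

section \<open>Functionals and their operator norm\<close>

lemma dual_zero: "f \<in> carrier (dual_lattice E) \<Longrightarrow> f (vzero E) = 0"
  using dual_scale[of f E "vzero E" 0] by simp

lemma dual_vdiff:
  "\<lbrakk>f \<in> carrier (dual_lattice E); x \<in> carrier E; y \<in> carrier E\<rbrakk> \<Longrightarrow> f (vdiff E x y) = f x - f y"
  using dual_add[of f E x "vscale E (- 1) y"] by (simp add: vdiff_def dual_scale)

lemma dual_mono:
  assumes "f \<in> carrier (dual_lattice E)" "\<And>z. \<lbrakk>z \<in> carrier E; vzero E \<sqsubseteq> z\<rbrakk> \<Longrightarrow> 0 \<le> f z"
    and "x \<sqsubseteq> y" "x \<in> carrier E" "y \<in> carrier E"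
  shows "f x \<le> f y"
  using assms(2)[of "vdiff E y x"] assms by (simp add: vdiff_nonneg_iff dual_vdiff)

lemma dual_norm_set:
  assumes "f \<in> carrier (dual_lattice E)"
  shows "{x \<in> carrier E. vnorm E x \<le> 1} \<noteq> {}"
    and "bdd_above ((\<lambda>x. \<bar>f x\<bar>) ` {x \<in> carrier E. vnorm E x \<le> 1})"
proof -
  show "{x \<in> carrier E. vnorm E x \<le> 1} \<noteq> {}"
    by (auto intro!: exI[of _ "vzero E"])
  obtain C where C: "\<bar>f x\<bar> \<le> C * vnorm E x" if "x \<in> carrier E" for x
    using assms unfolding dual_carrier_iff by blast
  have "\<bar>f x\<bar> \<le> \<bar>C\<bar>" if "x \<in> carrier E" "vnorm E x \<le> 1" for x
  proof -
    have "C * vnorm E x \<le> \<bar>C\<bar> * 1"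
      using that norm_nonneg[of x] by (intro mult_mono) auto
    then show ?thesis using C[OF that(1)] by simp
  qed
  then show "bdd_above ((\<lambda>x. \<bar>f x\<bar>) ` {x \<in> carrier E. vnorm E x \<le> 1})"
    by (intro bdd_aboveI[of _ "\<bar>C\<bar>"]) auto
qed

lemma dual_norm_bound:
  assumes f: "f \<in> carrier (dual_lattice E)" and x: "x \<in> carrier E"
  shows "\<bar>f x\<bar> \<le> vnorm (dual_lattice E) f * vnorm E x"
proof (cases "vnorm E x = 0")
  case True
  then show ?thesis using x f by (simp add: norm_eq_0 dual_zero)
next
  case False
  then have pos: "vnorm E x > 0" using norm_nonneg[OF x] by simp
  let ?y = "vscale E (1 / vnorm E x) x"
  have "?y \<in> {x \<in> carrier E. vnorm E x \<le> 1}"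
    using x pos by (simp add: norm_scale)
  then have "\<bar>f ?y\<bar> \<le> vnorm (dual_lattice E) f"
    unfolding dual_lattice_simps by (intro cSUP_upper dual_norm_set f)
  then show ?thesis
    using x f pos by (simp add: dual_scale abs_mult field_simps)
qed

lemma dual_norm_le:
  assumes f: "f \<in> carrier (dual_lattice E)" and K: "0 \<le> K"
    and bound: "\<And>x. x \<in> carrier E \<Longrightarrow> \<bar>f x\<bar> \<le> K * vnorm E x"
  shows "vnorm (dual_lattice E) f \<le> K"
  unfolding dual_lattice_simps
proof (rule cSUP_least[OF dual_norm_set(1)[OF f]])
  fix x assume x: "x \<in> {x \<in> carrier E. vnorm E x \<le> 1}"
  have "K * vnorm E x \<le> K * 1"
    using x K by (intro mult_left_mono) auto
  then show "\<bar>f x\<bar> \<le> K" using bound[of x] x by simp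
qed

lemma dual_norm_nonneg:
  assumes f: "f \<in> carrier (dual_lattice E)"
  shows "0 \<le> vnorm (dual_lattice E) f"
proof -
  have "\<bar>f (vzero E)\<bar> \<le> vnorm (dual_lattice E) f"
    unfolding dual_lattice_simps by (intro cSUP_upper dual_norm_set f) simp
  then show ?thesis by linarith
qed

lemma dual_add_closed:
  assumes f: "f \<in> carrier (dual_lattice E)" and g: "g \<in> carrier (dual_lattice E)"
  shows "vadd (dual_lattice E) f g \<in> carrier (dual_lattice E)"
proof -
  let ?K = "vnorm (dual_lattice E) f + vnorm (dual_lattice E) g"
  have "\<bar>f x + g x\<bar> \<le> ?K * vnorm E x" if "x \<in> carrier E" for x
    using dual_norm_bound[OF f that] dual_norm_bound[OF g that] by (simp add: distrib_right)
  then have "\<exists>C. \<forall>x\<in>carrier E. \<bar>f x + g x\<bar> \<le> C * vnorm E x" by blast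
  then show ?thesis
    using f g by (simp add: dual_carrier_iff dual_lattice_simps algebra_simps)
qed

lemma dual_scale_closed:
  assumes f: "f \<in> carrier (dual_lattice E)"
  shows "vscale (dual_lattice E) c f \<in> carrier (dual_lattice E)"
proof -
  let ?K = "\<bar>c\<bar> * vnorm (dual_lattice E) f"
  have "\<bar>c * f x\<bar> \<le> ?K * vnorm E x" if "x \<in> carrier E" for x
    using dual_norm_bound[OF f that] by (simp add: abs_mult mult.assoc mult_left_mono)
  then have "\<exists>C. \<forall>x\<in>carrier E. \<bar>c * f x\<bar> \<le> C * vnorm E x" by blast
  then show ?thesis
    using f by (simp add: dual_carrier_iff dual_lattice_simps algebra_simps)
qed

lemma dual_vdiff_closed:
  "\<lbrakk>f \<in> carrier (dual_lattice E); g \<in> carrier (dual_lattice E)\<rbrakk>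
    \<Longrightarrow> vdiff (dual_lattice E) f g \<in> carrier (dual_lattice E)"
  unfolding vdiff_def by (intro dual_add_closed dual_scale_closed)

lemma dual_zero_closed: "vzero (dual_lattice E) \<in> carrier (dual_lattice E)"
  by (auto simp: dual_carrier_iff dual_lattice_simps intro!: exI[of _ 0])

section \<open>The order of the dual: extension from the cone and the Riesz-Kantorovich
  formula\<close>

lemma kantorovich_extension:
  assumes add: "\<And>x y. \<lbrakk>x \<in> carrier E; y \<in> carrier E; vzero E \<sqsubseteq> x; vzero E \<sqsubseteq> y\<rbrakk>
      \<Longrightarrow> h (vadd E x y) = h x + h y"
    and scale: "\<And>c x. \<lbrakk>x \<in> carrier E; vzero E \<sqsubseteq> x; 0 \<le> c\<rbrakk> \<Longrightarrow> h (vscale E c x) = c * h x"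
    and bound: "\<And>x. \<lbrakk>x \<in> carrier E; vzero E \<sqsubseteq> x\<rbrakk> \<Longrightarrow> \<bar>h x\<bar> \<le> K * vnorm E x"
  obtains g where "g \<in> carrier (dual_lattice E)"
    "\<And>x. \<lbrakk>x \<in> carrier E; vzero E \<sqsubseteq> x\<rbrakk> \<Longrightarrow> g x = h x"
proof -
  let ?n = "\<lambda>x. vpos E (vscale E (- 1) x)"
  define g where "g = (\<lambda>x\<in>carrier E. h (vpos E x) - h (?n x))"
  \<comment> \<open>Independence of the representation of a vector as a difference of positive ones.
    The equation between the two differences is rearranged into one between sums of positive
    vectors, where the additivity of \<open>h\<close> applies. Linearity of \<open>g\<close> follows
    by choosing convenient representations.\<close>
  have g_eq: "g (vdiff E a b) = h a - h b"
    if "a \<in> carrier E" "b \<in> carrier E" "vzero E \<sqsubseteq> a" "vzero E \<sqsubseteq> b" for a b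
  proof -
    let ?x = "vdiff E a b"
    have carr: "?x \<in> carrier E" "?n ?x \<in> carrier E" using that by simp_all
    have "vpos E ?x = vadd E (?n ?x) ?x"
      using vdiff_vadd_cancel(3)[of "vpos E ?x" "?n ?x"] carr
      by (simp add: vpos_diff_vpos)
    then have "vadd E (vpos E ?x) b = vadd E (?n ?x) (vadd E ?x b)"
      using carr(2) that by (simp add: vadd_assoc)
    also have "\<dots> = vadd E a (?n ?x)"
      using carr(2) that by (simp add: vadd_comm)
    finally have "vadd E (vpos E ?x) b = vadd E a (?n ?x)" .
    then have "h (vpos E ?x) + h b = h a + h (?n ?x)"
      using add[of "vpos E ?x" b] add[of a "?n ?x"] that carr by simp
    then show ?thesis using carr by (simp add: g_def)
  qed
  have g_split: "g x = h (vpos E x) - h (?n x)" if "x \<in> carrier E" for x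
    using that by (simp add: g_def)
  have g_add: "g (vadd E x y) = g x + g y" if x: "x \<in> carrier E" and y: "y \<in> carrier E" for x y
  proof -
    have "vadd E x y = vadd E (vdiff E (vpos E x) (?n x)) (vdiff E (vpos E y) (?n y))"
      using x y by (simp add: vpos_diff_vpos)
    also have "\<dots> = vdiff E (vadd E (vpos E x) (vpos E y)) (vadd E (?n x) (?n y))"
      using x y by (simp add: vadd_vdiff_vdiff)
    finally have "g (vadd E x y) = h (vadd E (vpos E x) (vpos E y)) - h (vadd E (?n x) (?n y))"
      using x y by (simp add: g_eq vadd_nonneg)
    then show ?thesis using x y by (simp add: add g_split)
  qed
  have g_scale: "g (vscale E c x) = c * g x" if x: "x \<in> carrier E" for c x
  proof -
    have nonneg: "g (vscale E d y) = d * g y" if "d \<ge> 0" "y \<in> carrier E" for d y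
    proof -
      have "g (vscale E d y) = g (vdiff E (vscale E d (vpos E y)) (vscale E d (?n y)))"
        using that vpos_diff_vpos[of y] scale_vdiff[of "vpos E y" "?n y" d] by simp
      also have "\<dots> = h (vscale E d (vpos E y)) - h (vscale E d (?n y))"
        using that by (intro g_eq) (auto intro: scale_mono)
      finally show ?thesis
        using that by (simp add: g_split scale right_diff_distrib)
    qed
    show ?thesis
    proof (cases "c \<ge> 0")
      case True
      then show ?thesis using nonneg x by simp
    next
      case False
      have "g (vscale E c x) = g (vscale E (- c) (vscale E (- 1) x))"
        using x by (simp add: scale_scale)
      also have "\<dots> = (- c) * g (vscale E (- 1) x)"
        using False x by (intro nonneg) auto
      also have "g (vscale E (- 1) x) = - g x"
        using x by (simp add: g_split)
      finally show ?thesis by simp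
    qed
  qed
  \<comment> \<open>The sign of \<open>K\<close> is unknown, hence its absolute value; the factor 2
    counts the positive and the negative part, both of norm at most that of
    \<open>x\<close>.\<close>
  have "\<bar>g x\<bar> \<le> 2 * \<bar>K\<bar> * vnorm E x" if x: "x \<in> carrier E" for x
  proof -
    have *: "\<bar>h a\<bar> \<le> \<bar>K\<bar> * vnorm E x" if "a \<in> carrier E" "vzero E \<sqsubseteq> a" "vnorm E a \<le> vnorm E x" for a
    proof -
      have "K * vnorm E a \<le> \<bar>K\<bar> * vnorm E x"
        using that norm_nonneg[of a] by (intro mult_mono) auto
      then show ?thesis using bound[of a] that by simp
    qed
    have "\<bar>h (vpos E x)\<bar> \<le> \<bar>K\<bar> * vnorm E x" "\<bar>h (?n x)\<bar> \<le> \<bar>K\<bar> * vnorm E x"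
      using x by (auto intro!: * vnorm_vpos_le vnorm_vpos_minus_le)
    then show ?thesis using x by (simp add: g_split)
  qed
  then have "g \<in> carrier (dual_lattice E)"
    using g_add g_scale by (auto simp: dual_carrier_iff g_def)
  moreover have "g x = h x" if "x \<in> carrier E" "vzero E \<sqsubseteq> x" for x
    using g_eq[of x "vzero E"] scale[of "vzero E" 0] that by simp
  ultimately show ?thesis using that by blast
qed

text \<open>Riesz-Kantorovich formula: on the cone, \<open>g x\<close> is the supremum of
  \<open>f y\<close> over \<open>0 \<le> y \<le> x\<close>, which is additive by the decomposition
  property and so extends to a functional. The last two conclusions are the two halves of the
  supremum property, so later arguments need not mention suprema of reals.\<close>

lemma dual_positive_part:
  assumes f: "f \<in> carrier (dual_lattice E)"
  obtains g where "g \<in> carrier (dual_lattice E)"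
    "\<And>x y. \<lbrakk>x \<in> carrier E; y \<in> carrier E; vzero E \<sqsubseteq> y; y \<sqsubseteq> x\<rbrakk> \<Longrightarrow> f y \<le> g x"
    "\<And>x c. \<lbrakk>x \<in> carrier E; vzero E \<sqsubseteq> x;
        \<And>y. \<lbrakk>y \<in> carrier E; vzero E \<sqsubseteq> y; y \<sqsubseteq> x\<rbrakk> \<Longrightarrow> f y \<le> c\<rbrakk> \<Longrightarrow> g x \<le> c"
proof -
  let ?I = "\<lambda>x. {y \<in> carrier E. vzero E \<sqsubseteq> y \<and> y \<sqsubseteq> x}" and ?N = "vnorm (dual_lattice E) f"
  define h where "h x = (SUP y\<in>?I x. f y)" for x
  have bd: "\<bar>f y\<bar> \<le> ?N * vnorm E x" if "x \<in> carrier E" "y \<in> ?I x" for x y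
  proof -
    have "?N * vnorm E y \<le> ?N * vnorm E x"
      using that dual_norm_nonneg[OF f] by (intro mult_left_mono vnorm_mono) auto
    then show ?thesis using dual_norm_bound[OF f, of y] that by simp
  qed
  have upper: "f y \<le> h x" if "x \<in> carrier E" "y \<in> ?I x" for x y
    unfolding h_def
    by (rule cSUP_upper[OF that(2)], rule bdd_aboveI[of _ "?N * vnorm E x"]) (use bd[OF that(1)] in force)
  have least: "h x \<le> c" if "x \<in> carrier E" "vzero E \<sqsubseteq> x" "\<And>y. y \<in> ?I x \<Longrightarrow> f y \<le> c" for x c
    unfolding h_def by (rule cSUP_least) (use that in auto)
  have nonneg: "0 \<le> h x" if "x \<in> carrier E" "vzero E \<sqsubseteq> x" for x
    using upper[of x "vzero E"] that by (simp add: dual_zero[OF f])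
  obtain g where g: "g \<in> carrier (dual_lattice E)" "\<And>x. \<lbrakk>x \<in> carrier E; vzero E \<sqsubseteq> x\<rbrakk> \<Longrightarrow> g x = h x"
  proof (rule kantorovich_extension[of h ?N])
    fix x y assume xy: "x \<in> carrier E" "y \<in> carrier E" "vzero E \<sqsubseteq> x" "vzero E \<sqsubseteq> y"
    show "h (vadd E x y) = h x + h y"
    proof (rule antisym)
      show "h (vadd E x y) \<le> h x + h y"
      proof (rule least)
        fix z assume z: "z \<in> ?I (vadd E x y)"
        then obtain u v where uv: "u \<in> ?I x" "v \<in> ?I y" "z = vadd E u v"
          using riesz_decomposition[of z x y] xy by blast
        then show "f z \<le> h x + h y"
          using upper[of x u] upper[of y v] xy by (simp add: dual_add[OF f])
      qed (use xy in \<open>auto simp: vadd_nonneg\<close>)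
      have sum_le: "f u + f v \<le> h (vadd E x y)" if "u \<in> ?I x" "v \<in> ?I y" for u v
        using upper[of "vadd E x y" "vadd E u v"] that xy
        by (simp add: dual_add[OF f] vadd_nonneg vadd_mono)
      have h_y: "h y \<le> h (vadd E x y) - f u" if "u \<in> ?I x" for u
      proof (rule least)
        fix v assume "v \<in> ?I y"
        from sum_le[OF that this] show "f v \<le> h (vadd E x y) - f u" by simp
      qed (use xy in auto)
      have "h x \<le> h (vadd E x y) - h y"
      proof (rule least)
        fix u assume "u \<in> ?I x"
        from h_y[OF this] show "f u \<le> h (vadd E x y) - h y" by simp
      qed (use xy in auto)
      then show "h x + h y \<le> h (vadd E x y)" by simp
    qed
  next
    fix c :: real and x assume x: "x \<in> carrier E" "vzero E \<sqsubseteq> x" and c: "0 \<le> c"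
    \<comment> \<open>One inequality for all positive factors is enough: applied with
      \<open>1 / c\<close> at the vector \<open>c x\<close> it yields the reverse one.\<close>
    have le: "h (vscale E c x) \<le> c * h x" if "0 < c" "x \<in> carrier E" "vzero E \<sqsubseteq> x" for c x
    proof (rule least)
      fix z assume z: "z \<in> ?I (vscale E c x)"
      have "vscale E (1 / c) z \<sqsubseteq> vscale E (1 / c) (vscale E c x)"
        using that z by (intro scale_mono_le) auto
      then have "vscale E (1 / c) z \<in> ?I x"
        using that z by (auto simp: scale_scale intro: scale_mono)
      from upper[OF that(2) this] show "f z \<le> c * h x"
        using that z by (simp add: dual_scale[OF f] field_simps)
    qed (use that in \<open>auto intro: scale_mono\<close>)
    show "h (vscale E c x) = c * h x"
    proof (cases "c = 0")
      case True
      have "h (vzero E) \<le> 0"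
      proof (rule least)
        fix z assume "z \<in> ?I (vzero E)"
        then have "z = vzero E" using le_antisym by auto
        then show "f z \<le> 0" by (simp add: dual_zero[OF f])
      qed auto
      then show ?thesis using True x nonneg[of "vzero E"] by simp
    next
      case False
      then have c: "0 < c" using c by simp
      have "h (vscale E (1 / c) (vscale E c x)) \<le> 1 / c * h (vscale E c x)"
        using c x by (intro le) (auto intro: scale_mono)
      then show ?thesis
        using le[OF c x] c x by (simp add: scale_scale field_simps)
    qed
  next
    fix x assume x: "x \<in> carrier E" "vzero E \<sqsubseteq> x"
    have "h x \<le> ?N * vnorm E x"
      using x bd[of x] by (intro least) (auto simp: abs_le_iff)
    then show "\<bar>h x\<bar> \<le> ?N * vnorm E x" using nonneg[OF x] by simp
  next
    fix g assume "g \<in> carrier (dual_lattice E)" "\<And>x. \<lbrakk>x \<in> carrier E; vzero E \<sqsubseteq> x\<rbrakk> \<Longrightarrow> g x = h x"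
    then show thesis by (rule that)
  qed
  show ?thesis
  proof (rule that[OF g(1)])
    fix x y assume "x \<in> carrier E" "y \<in> carrier E" "vzero E \<sqsubseteq> y" "y \<sqsubseteq> x"
    then show "f y \<le> g x"
      using upper[of x y] g(2)[of x] le_trans[of "vzero E" y x] by simp
  next
    fix x c assume "x \<in> carrier E" "vzero E \<sqsubseteq> x"
      "\<And>y. \<lbrakk>y \<in> carrier E; vzero E \<sqsubseteq> y; y \<sqsubseteq> x\<rbrakk> \<Longrightarrow> f y \<le> c"
    then show "g x \<le> c"
      using least[of x c] g(2)[of x] by auto
  qed
qed

text \<open>The supremum of \<open>f\<close> and \<open>g\<close> is \<open>g\<close> plus the
  positive part of \<open>f - g\<close>; infima come from suprema by negation. Antisymmetry holds
  because a functional is determined by its values on the cone.\<close>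

lemma lattice_dual: "lattice (dual_lattice E)"
proof -
  let ?D = "dual_lattice E"
  have antisym: "f = g" if fg: "f \<in> carrier ?D" "g \<in> carrier ?D" "f \<sqsubseteq>\<^bsub>?D\<^esub> g" "g \<sqsubseteq>\<^bsub>?D\<^esub> f" for f g
  proof (rule dual_eqI[OF fg(1,2)])
    fix x assume x: "x \<in> carrier E"
    have pos: "f y = g y" if "y \<in> carrier E" "vzero E \<sqsubseteq> y" for y
      using fg that by (intro antisym) (auto simp: dual_lattice_simps)
    show "f x = g x"
      using dual_vdiff[OF fg(1), of "vpos E x" "vpos E (vscale E (- 1) x)"]
        dual_vdiff[OF fg(2), of "vpos E x" "vpos E (vscale E (- 1) x)"] x
      by (simp add: vpos_diff_vpos pos)
  qed
  interpret D: partial_order ?D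
  proof unfold_locales
    fix f g h assume "f \<sqsubseteq>\<^bsub>?D\<^esub> g" "g \<sqsubseteq>\<^bsub>?D\<^esub> h"
    then show "f \<sqsubseteq>\<^bsub>?D\<^esub> h" by (force simp: dual_lattice_simps)
  qed (use antisym in \<open>auto simp: dual_lattice_simps fun_eq_iff\<close>)
  have sup: "\<exists>s. least ?D s (Upper ?D {f, g})" if f: "f \<in> carrier ?D" and g: "g \<in> carrier ?D" for f g
  proof -
    obtain p where p: "p \<in> carrier ?D"
      "\<And>x y. \<lbrakk>x \<in> carrier E; y \<in> carrier E; vzero E \<sqsubseteq> y; y \<sqsubseteq> x\<rbrakk> \<Longrightarrow> vdiff ?D f g y \<le> p x"
      "\<And>x c. \<lbrakk>x \<in> carrier E; vzero E \<sqsubseteq> x;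
        \<And>y. \<lbrakk>y \<in> carrier E; vzero E \<sqsubseteq> y; y \<sqsubseteq> x\<rbrakk> \<Longrightarrow> vdiff ?D f g y \<le> c\<rbrakk> \<Longrightarrow> p x \<le> c"
      using dual_positive_part[OF dual_vdiff_closed[OF f g]] by metis
    have "least ?D (vadd ?D g p) (Upper ?D {f, g})"
    proof (rule least_UpperI)
      fix u assume "u \<in> {f, g}"
      moreover have "f x \<le> g x + p x" "g x \<le> g x + p x" if "x \<in> carrier E" "vzero E \<sqsubseteq> x" for x
        using p(2)[of x x] p(2)[of x "vzero E"] that
        by (simp_all add: dual_vdiff_apply dual_zero f g)
      ultimately show "u \<sqsubseteq>\<^bsub>?D\<^esub> vadd ?D g p" by (auto simp: dual_lattice_simps)
    next
      fix u assume "u \<in> Upper ?D {f, g}"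
      then have u: "u \<in> carrier ?D" "f \<sqsubseteq>\<^bsub>?D\<^esub> u" "g \<sqsubseteq>\<^bsub>?D\<^esub> u"
        using f g by (auto simp: Upper_def)
      \<comment> \<open>For \<open>0 \<le> y \<le> x\<close>, \<open>f\<close> is compared with
        \<open>u\<close> at \<open>y\<close> and \<open>g\<close> with \<open>u\<close> at
        \<open>x - y\<close>; adding the two gives \<open>f y - g y \<le> u x - g x\<close>.\<close>
      have "p x \<le> u x - g x" if x: "x \<in> carrier E" "vzero E \<sqsubseteq> x" for x
      proof (rule p(3)[OF x])
        fix y assume y: "y \<in> carrier E" "vzero E \<sqsubseteq> y" "y \<sqsubseteq> x"
        have "g (vdiff E x y) \<le> u (vdiff E x y)"
          using u x y by (simp add: dual_lattice_simps vdiff_nonneg_iff)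
        moreover have "f y \<le> u y" using u y by (simp add: dual_lattice_simps)
        ultimately show "vdiff ?D f g y \<le> u x - g x"
          using x y u g by (simp add: dual_vdiff_apply dual_vdiff)
      qed
      then show "vadd ?D g p \<sqsubseteq>\<^bsub>?D\<^esub> u" by (force simp: dual_lattice_simps)
    qed (use f g p in \<open>auto simp: dual_add_closed\<close>)
    then show ?thesis by blast
  qed
  have inf: "\<exists>i. greatest ?D i (Lower ?D {f, g})" if f: "f \<in> carrier ?D" and g: "g \<in> carrier ?D" for f g
  proof -
    let ?m = "vscale ?D (- 1)"
    obtain s where s: "least ?D s (Upper ?D {?m f, ?m g})"
      using sup[OF dual_scale_closed dual_scale_closed] f g by blast
    have m_le: "?m u \<sqsubseteq>\<^bsub>?D\<^esub> v \<longleftrightarrow> ?m v \<sqsubseteq>\<^bsub>?D\<^esub> u" for u v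
      by (force simp: dual_lattice_simps)
    have mm: "u \<sqsubseteq>\<^bsub>?D\<^esub> ?m v \<longleftrightarrow> v \<sqsubseteq>\<^bsub>?D\<^esub> ?m u" for u v
      by (force simp: dual_lattice_simps)
    have sc: "s \<in> carrier ?D" "?m f \<sqsubseteq>\<^bsub>?D\<^esub> s" "?m g \<sqsubseteq>\<^bsub>?D\<^esub> s"
      using s f g by (auto simp: least_def Upper_def dual_scale_closed)
    have "greatest ?D (?m s) (Lower ?D {f, g})"
    proof (rule greatest_LowerI)
      show "?m s \<sqsubseteq>\<^bsub>?D\<^esub> u" if "u \<in> {f, g}" for u
        using that sc m_le by auto
      fix u assume u: "u \<in> Lower ?D {f, g}"
      then have "u \<in> carrier ?D" "u \<sqsubseteq>\<^bsub>?D\<^esub> f" "u \<sqsubseteq>\<^bsub>?D\<^esub> g"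
        using f g by (auto simp: Lower_def)
      then have "?m u \<in> Upper ?D {?m f, ?m g}"
        using f g by (auto simp: Upper_def dual_scale_closed) (auto simp: dual_lattice_simps)
      then have "s \<sqsubseteq>\<^bsub>?D\<^esub> ?m u" using s by (auto simp: least_def)
      then show "u \<sqsubseteq>\<^bsub>?D\<^esub> ?m s" using mm by blast
    qed (use f g sc in \<open>auto simp: dual_scale_closed\<close>)
    then show ?thesis by blast
  qed
  show ?thesis
    by unfold_locales (fact sup inf)+
qed

text \<open>The modulus of \<open>f\<close> lies below the positive part of \<open>2 f\<close> minus
  \<open>f\<close>. The factor 2 produces the symmetric expression of the hypothesis, since
  \<open>2 f y - f x = f y - f (x - y)\<close>.\<close>

lemma vabs_dual_le:
  assumes f: "f \<in> carrier (dual_lattice E)" and x: "x \<in> carrier E" "vzero E \<sqsubseteq> x"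
    and bound: "\<And>y. \<lbrakk>y \<in> carrier E; vzero E \<sqsubseteq> y; y \<sqsubseteq> x\<rbrakk> \<Longrightarrow> f y - f (vdiff E x y) \<le> c"
  shows "vabs (dual_lattice E) f x \<le> c"
proof -
  let ?D = "dual_lattice E"
  interpret D: lattice ?D by (rule lattice_dual)
  obtain p where p: "p \<in> carrier ?D"
    "\<And>x y. \<lbrakk>x \<in> carrier E; y \<in> carrier E; vzero E \<sqsubseteq> y; y \<sqsubseteq> x\<rbrakk> \<Longrightarrow> vscale ?D 2 f y \<le> p x"
    "\<And>x c. \<lbrakk>x \<in> carrier E; vzero E \<sqsubseteq> x;
        \<And>y. \<lbrakk>y \<in> carrier E; vzero E \<sqsubseteq> y; y \<sqsubseteq> x\<rbrakk> \<Longrightarrow> vscale ?D 2 f y \<le> c\<rbrakk> \<Longrightarrow> p x \<le> c"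
    using dual_positive_part[OF dual_scale_closed[OF f, of 2]] by metis
  let ?u = "vdiff ?D p f"
  have "f \<sqsubseteq>\<^bsub>?D\<^esub> ?u" "vscale ?D (- 1) f \<sqsubseteq>\<^bsub>?D\<^esub> ?u"
    using p(2) p(2)[of _ "vzero E"] f
    by (force simp: dual_lattice_simps(1) dual_lattice_simps(5) dual_vdiff_apply dual_zero)+
  then have "vabs ?D f \<sqsubseteq>\<^bsub>?D\<^esub> ?u"
    unfolding vabs_def by (intro D.join_le) (auto simp: f p dual_scale_closed dual_vdiff_closed)
  then have "vabs ?D f x \<le> p x - f x"
    using x by (simp add: dual_lattice_simps(1) dual_vdiff_apply)
  moreover have "p x \<le> c + f x"
    by (rule p(3)[OF x]) (use bound x f in \<open>auto simp: dual_vdiff dual_lattice_simps field_simps\<close>)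
  ultimately show ?thesis by simp
qed

lemma le_vabs_dual:
  assumes f: "f \<in> carrier (dual_lattice E)" and x: "x \<in> carrier E" "vzero E \<sqsubseteq> x"
  shows "\<bar>f x\<bar> \<le> vabs (dual_lattice E) f x"
proof -
  interpret D: lattice "dual_lattice E" by (rule lattice_dual)
  have "f \<sqsubseteq>\<^bsub>dual_lattice E\<^esub> vabs (dual_lattice E) f"
    "vscale (dual_lattice E) (- 1) f \<sqsubseteq>\<^bsub>dual_lattice E\<^esub> vabs (dual_lattice E) f"
    unfolding vabs_def by (intro D.join_left D.join_right f dual_scale_closed)+
  then show ?thesis
    using x by (auto simp: dual_lattice_simps abs_le_iff)
qed

lemma abs_dual_le_vabs:
  assumes f: "f \<in> carrier (dual_lattice E)" and x: "x \<in> carrier E"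
  shows "\<bar>f x\<bar> \<le> vabs (dual_lattice E) f (vabs E x)"
proof -
  interpret D: lattice "dual_lattice E" by (rule lattice_dual)
  have abs_f: "vabs (dual_lattice E) f \<in> carrier (dual_lattice E)"
    unfolding vabs_def by (intro D.join_closed f dual_scale_closed)
  let ?p = "vpos E x" and ?n = "vpos E (vscale E (- 1) x)"
  have "f x = f ?p - f ?n"
    using dual_vdiff[OF f, of ?p ?n] x by (simp add: vpos_diff_vpos)
  then have "\<bar>f x\<bar> \<le> vabs (dual_lattice E) f ?p + vabs (dual_lattice E) f ?n"
    using le_vabs_dual[OF f, of ?p] le_vabs_dual[OF f, of ?n] x by simp
  also have "\<dots> = vabs (dual_lattice E) f (vabs E x)"
    using x by (simp add: vabs_eq_vpos_add dual_add[OF abs_f])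
  finally show ?thesis .
qed

text \<open>For \<open>0 \<le> y \<le> x\<close> the vector \<open>y - (x - y)\<close> lies between
  \<open>- x\<close> and \<open>x\<close>, so its norm does not exceed that of \<open>x\<close>.
  This is what makes the operator norm a lattice norm.\<close>

lemma vabs_dual_bound:
  assumes f: "f \<in> carrier (dual_lattice E)" and x: "x \<in> carrier E" "vzero E \<sqsubseteq> x"
  shows "vabs (dual_lattice E) f x \<le> vnorm (dual_lattice E) f * vnorm E x"
proof (rule vabs_dual_le[OF f x])
  fix y assume y: "y \<in> carrier E" "vzero E \<sqsubseteq> y" "y \<sqsubseteq> x"
  let ?z = "vdiff E y (vdiff E x y)"
  have "vscale E (- 1) x \<sqsubseteq> ?z"
  proof -
    have "vdiff E x y \<sqsubseteq> x" using x y by (simp add: vdiff_le_self)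
    then have "vscale E (- 1) x \<sqsubseteq> vscale E (- 1) (vdiff E x y)"
      using x y by (intro minus_le_minus) auto
    also have "vscale E (- 1) (vdiff E x y) \<sqsubseteq> ?z"
      using x y vadd_mono[of "vzero E" y "vscale E (- 1) (vdiff E x y)" "vscale E (- 1) (vdiff E x y)"]
      by (simp add: vdiff_def)
    finally show ?thesis using x y by simp
  qed
  moreover have "?z \<sqsubseteq> x"
    using vdiff_le_self[of "vdiff E x y" y] x y le_trans[of ?z y x] by (simp add: vdiff_nonneg_iff)
  ultimately have "vnorm E ?z \<le> vnorm E x"
    using x y by (intro vnorm_le_of_between) auto
  then have "vnorm (dual_lattice E) f * vnorm E ?z \<le> vnorm (dual_lattice E) f * vnorm E x"
    using dual_norm_nonneg[OF f] by (rule mult_left_mono)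
  moreover have "f y - f (vdiff E x y) \<le> vnorm (dual_lattice E) f * vnorm E ?z"
    using dual_norm_bound[OF f, of ?z] x y by (simp add: dual_vdiff[OF f])
  ultimately show "f y - f (vdiff E x y) \<le> vnorm (dual_lattice E) f * vnorm E x" by simp
qed

section \<open>Completeness of the dual and its Banach lattice structure\<close>

lemma dual_complete:
  assumes s: "range s \<subseteq> carrier (dual_lattice E)"
    and Cauchy: "\<forall>\<epsilon>>0. \<exists>N::nat. \<forall>p\<ge>N. \<forall>q\<ge>N.
      vnorm (dual_lattice E) (vdiff (dual_lattice E) (s p) (s q)) < \<epsilon>"
  shows "\<exists>l\<in>carrier (dual_lattice E).
    (\<lambda>n. vnorm (dual_lattice E) (vdiff (dual_lattice E) (s n) l)) \<longlonglongrightarrow> 0"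
proof -
  let ?D = "dual_lattice E"
  have sc: "s n \<in> carrier ?D" for n using s by auto
  have near: "\<bar>s p x - s q x\<bar> \<le> vnorm ?D (vdiff ?D (s p) (s q)) * vnorm E x"
    if "x \<in> carrier E" for p q x
    using dual_norm_bound[OF dual_vdiff_closed[OF sc sc] that] that by (simp add: dual_vdiff_apply)
  have conv: "convergent (\<lambda>n. s n x)" if x: "x \<in> carrier E" for x
  proof -
    have "Cauchy (\<lambda>n. s n x)"
    proof (rule metric_CauchyI)
      fix \<epsilon> :: real assume "\<epsilon> > 0"
      \<comment> \<open>The summand 1 avoids a division by zero at \<open>x = 0\<close>.\<close>
      then have "\<epsilon> / (vnorm E x + 1) > 0" using norm_nonneg[OF x] by simp
      then obtain N where N: "\<forall>p\<ge>N. \<forall>q\<ge>N. vnorm ?D (vdiff ?D (s p) (s q)) < \<epsilon> / (vnorm E x + 1)"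
        using Cauchy by blast
      have "dist (s p x) (s q x) < \<epsilon>" if "p \<ge> N" "q \<ge> N" for p q
      proof -
        let ?d = "vnorm ?D (vdiff ?D (s p) (s q))"
        have "\<bar>s p x - s q x\<bar> \<le> ?d * vnorm E x" using near[OF x] .
        also have "\<dots> \<le> ?d * (vnorm E x + 1)"
          using dual_norm_nonneg[OF dual_vdiff_closed[OF sc sc]] by (intro mult_left_mono) auto
        also have "\<dots> < \<epsilon>"
          using N that norm_nonneg[OF x] by (simp add: pos_less_divide_eq add_nonneg_pos)
        finally show ?thesis by (simp add: dist_real_def)
      qed
      then show "\<exists>N. \<forall>p\<ge>N. \<forall>q\<ge>N. dist (s p x) (s q x) < \<epsilon>" by blast
    qed
    then show ?thesis by (simp add: Cauchy_convergent)
  qed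
  define l where "l = (\<lambda>x\<in>carrier E. lim (\<lambda>n. s n x))"
  have lim: "(\<lambda>n. s n x) \<longlonglongrightarrow> l x" if "x \<in> carrier E" for x
    using conv[OF that] that by (simp add: l_def convergent_LIMSEQ_iff)
  \<comment> \<open>Letting \<open>q\<close> tend to infinity in the Cauchy estimate at a fixed
    \<open>x\<close> gives a bound whose \<open>N\<close> does not depend on \<open>x\<close>, that
    is, convergence in the operator norm.\<close>
  have unif: "\<bar>s p x - l x\<bar> \<le> \<epsilon> * vnorm E x"
    if N: "\<forall>p\<ge>N. \<forall>q\<ge>N. vnorm ?D (vdiff ?D (s p) (s q)) < \<epsilon>" and "p \<ge> N" and x: "x \<in> carrier E"
    for N p \<epsilon> x
  proof (rule tendsto_upperbound)
    show "(\<lambda>q. \<bar>s p x - s q x\<bar>) \<longlonglongrightarrow> \<bar>s p x - l x\<bar>"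
      by (intro tendsto_intros lim x)
    show "\<forall>\<^sub>F q in sequentially. \<bar>s p x - s q x\<bar> \<le> \<epsilon> * vnorm E x"
      using eventually_ge_at_top[of N]
    proof eventually_elim
      case (elim q)
      have "vnorm ?D (vdiff ?D (s p) (s q)) * vnorm E x \<le> \<epsilon> * vnorm E x"
        using N elim \<open>p \<ge> N\<close> norm_nonneg[OF x] by (intro mult_right_mono) (auto intro: less_imp_le)
      then show ?case using near[OF x, of p q] by linarith
    qed
  qed simp
  have "l \<in> carrier ?D"
  proof -
    have "l (vadd E x y) = l x + l y" if "x \<in> carrier E" "y \<in> carrier E" for x y
    proof (rule LIMSEQ_unique[OF lim])
      show "(\<lambda>n. s n (vadd E x y)) \<longlonglongrightarrow> l x + l y"
        using tendsto_add[OF lim lim, of x y] that by (simp add: dual_add[OF sc])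
    qed (use that in simp)
    moreover have "l (vscale E c x) = c * l x" if "x \<in> carrier E" for c x
    proof (rule LIMSEQ_unique[OF lim])
      show "(\<lambda>n. s n (vscale E c x)) \<longlonglongrightarrow> c * l x"
        using tendsto_mult_left[OF lim, of x c] that by (simp add: dual_scale[OF sc])
    qed (use that in simp)
    moreover have "\<exists>C. \<forall>x\<in>carrier E. \<bar>l x\<bar> \<le> C * vnorm E x"
    proof -
      obtain N where N: "\<forall>p\<ge>N. \<forall>q\<ge>N. vnorm ?D (vdiff ?D (s p) (s q)) < 1"
        using Cauchy zero_less_one by blast
      have "\<bar>l x\<bar> \<le> (vnorm ?D (s N) + 1) * vnorm E x" if "x \<in> carrier E" for x
        using unif[OF N _ that, of N] dual_norm_bound[OF sc that, of N] by (simp add: distrib_right)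
      then show ?thesis by blast
    qed
    ultimately show ?thesis by (simp add: dual_carrier_iff l_def)
  qed
  moreover have "(\<lambda>n. vnorm ?D (vdiff ?D (s n) l)) \<longlonglongrightarrow> 0"
  proof (rule LIMSEQ_I)
    fix \<epsilon> :: real assume "\<epsilon> > 0"
    then obtain N where N: "\<forall>p\<ge>N. \<forall>q\<ge>N. vnorm ?D (vdiff ?D (s p) (s q)) < \<epsilon> / 2"
      using Cauchy half_gt_zero by blast
    \<comment> \<open>Only a weak inequality survives the limit; half of \<epsilon> leaves room for
      the strict one.\<close>
    have "vnorm ?D (vdiff ?D (s n) l) \<le> \<epsilon> / 2" if "n \<ge> N" for n
      using unif[OF N that] \<open>\<epsilon> > 0\<close> \<open>l \<in> carrier ?D\<close>
      by (intro dual_norm_le dual_vdiff_closed sc) (auto simp: dual_vdiff_apply)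
    then have "norm (vnorm ?D (vdiff ?D (s n) l) - 0) < \<epsilon>" if "n \<ge> N" for n
      using that \<open>\<epsilon> > 0\<close> dual_norm_nonneg[OF dual_vdiff_closed[OF sc \<open>l \<in> carrier ?D\<close>], of n] by force
    then show "\<exists>N. \<forall>n\<ge>N. norm (vnorm ?D (vdiff ?D (s n) l) - 0) < \<epsilon>" by blast
  qed
  ultimately show ?thesis by blast
qed

text \<open>Applied twice, this turns every bidual into a Banach lattice, so facts proved once for
  functionals on \<open>E\<close> also serve one level up.\<close>

theorem banach_lattice_dual: "banach_lattice (dual_lattice E)"
proof -
  let ?D = "dual_lattice E"
  interpret D: lattice ?D by (rule lattice_dual)
  \<comment> \<open>The reverse inequality, for nonzero \<open>c\<close>, is this one with the
    factor \<open>1 / c\<close> applied to \<open>c f\<close>.\<close>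
  have norm_scale_le: "vnorm ?D (vscale ?D c f) \<le> \<bar>c\<bar> * vnorm ?D f" if f: "f \<in> carrier ?D" for c f
    using dual_norm_bound[OF f] dual_norm_nonneg[OF f] f
    by (intro dual_norm_le dual_scale_closed)
      (auto simp: dual_lattice_simps(5) abs_mult mult.assoc intro!: mult_left_mono)
  show ?thesis
  proof (rule banach_lattice.intro[OF lattice_dual], rule banach_lattice_axioms.intro)
    let ?G = "\<lparr>carrier = carrier ?D, mult = vadd ?D, one = vzero ?D\<rparr>"
    show "comm_group ?G"
    proof (rule comm_groupI)
      fix f assume f: "f \<in> carrier ?G"
      then have "vscale ?D (- 1) f \<in> carrier ?G" by (simp add: dual_scale_closed)
      moreover have "vscale ?D (- 1) f \<otimes>\<^bsub>?G\<^esub> f = \<one>\<^bsub>?G\<^esub>"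
        using f by (simp add: dual_lattice_simps fun_eq_iff restrict_def)
      ultimately show "\<exists>g\<in>carrier ?G. g \<otimes>\<^bsub>?G\<^esub> f = \<one>\<^bsub>?G\<^esub>" by blast
    next
      fix f assume f: "f \<in> carrier ?G"
      then show "\<one>\<^bsub>?G\<^esub> \<otimes>\<^bsub>?G\<^esub> f = f"
        by (auto simp: dual_lattice_simps intro!: extensionalityI[of _ "carrier E"])
          (simp add: dual_carrier_iff)
    qed (auto simp: dual_add_closed dual_zero_closed,
        auto simp: dual_lattice_simps restrict_def fun_eq_iff)
  next
    fix f assume f: "f \<in> carrier ?D"
    show "vscale ?D c f \<in> carrier ?D" for c
      using f by (rule dual_scale_closed)
    show "vscale ?D (c + d) f = vadd ?D (vscale ?D c f) (vscale ?D d f)" for c d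
      by (auto simp: dual_lattice_simps restrict_def fun_eq_iff distrib_right)
    show "vscale ?D c (vscale ?D d f) = vscale ?D (c * d) f" for c d
      by (auto simp: dual_lattice_simps restrict_def fun_eq_iff)
    show "vscale ?D 1 f = f"
      by (intro dual_eqI[OF dual_scale_closed[OF f] f]) (auto simp: dual_lattice_simps)
    show "0 \<le> vnorm ?D f"
      using f by (rule dual_norm_nonneg)
    show "vnorm ?D f = 0 \<longleftrightarrow> f = vzero ?D"
    proof
      assume "vnorm ?D f = 0"
      then show "f = vzero ?D"
        using dual_norm_bound[OF f]
        by (intro dual_eqI[OF f dual_zero_closed]) (auto simp: dual_lattice_simps(3))
    next
      assume "f = vzero ?D"
      then have "vnorm ?D f \<le> 0"
        using f by (intro dual_norm_le) (auto simp: dual_lattice_simps(3))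
      then show "vnorm ?D f = 0" using dual_norm_nonneg[OF f] by simp
    qed
    show "vnorm ?D (vscale ?D c f) = \<bar>c\<bar> * vnorm ?D f" for c
    proof (cases "c = 0")
      case True
      then show ?thesis
        using norm_scale_le[OF f, of c] dual_norm_nonneg[OF dual_scale_closed[OF f, of c]] by simp
    next
      case False
      have "vscale ?D (1 / c) (vscale ?D c f) = f"
        using False f
        by (intro dual_eqI[OF dual_scale_closed[OF dual_scale_closed[OF f]] f]) (auto simp: dual_lattice_simps)
      then have "vnorm ?D f \<le> \<bar>1 / c\<bar> * vnorm ?D (vscale ?D c f)"
        using norm_scale_le[OF dual_scale_closed[OF f], of "1 / c" c] by simp
      then have "\<bar>c\<bar> * vnorm ?D f \<le> vnorm ?D (vscale ?D c f)"
        using False by (simp add: field_simps)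
      then show ?thesis using norm_scale_le[OF f, of c] by simp
    qed
    show "vzero ?D \<sqsubseteq>\<^bsub>?D\<^esub> vscale ?D c f" if "vzero ?D \<sqsubseteq>\<^bsub>?D\<^esub> f" "0 \<le> c" for c
      using that by (simp add: dual_lattice_simps)
    fix g assume g: "g \<in> carrier ?D"
    show "vscale ?D c (vadd ?D f g) = vadd ?D (vscale ?D c f) (vscale ?D c g)" for c
      by (auto simp: dual_lattice_simps restrict_def fun_eq_iff distrib_left)
    show "vnorm ?D (vadd ?D f g) \<le> vnorm ?D f + vnorm ?D g"
    proof (rule dual_norm_le[OF dual_add_closed[OF f g]])
      show "\<bar>vadd ?D f g x\<bar> \<le> (vnorm ?D f + vnorm ?D g) * vnorm E x" if "x \<in> carrier E" for x
        using dual_norm_bound[OF f that] dual_norm_bound[OF g that] that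
        by (simp add: dual_lattice_simps(4) distrib_right)
    qed (simp add: dual_norm_nonneg f g)
    show "vadd ?D f h \<sqsubseteq>\<^bsub>?D\<^esub> vadd ?D g h" if "f \<sqsubseteq>\<^bsub>?D\<^esub> g" for h
      using that by (simp add: dual_lattice_simps)
    show "vnorm ?D f \<le> vnorm ?D g" if le: "vabs ?D f \<sqsubseteq>\<^bsub>?D\<^esub> vabs ?D g"
    proof (rule dual_norm_le[OF f dual_norm_nonneg[OF g]])
      fix x assume x: "x \<in> carrier E"
      have "\<bar>f x\<bar> \<le> vabs ?D f (vabs E x)" using f x by (rule abs_dual_le_vabs)
      also have "\<dots> \<le> vabs ?D g (vabs E x)" using le x by (simp add: dual_lattice_simps)
      also have "\<dots> \<le> vnorm ?D g * vnorm E x"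
        using vabs_dual_bound[OF g, of "vabs E x"] x by simp
      finally show "\<bar>f x\<bar> \<le> vnorm ?D g * vnorm E x" .
    qed
  qed (rule dual_complete)
qed

end

section \<open>Riesz homomorphisms in the dual\<close>

context banach_lattice
begin

lemma dual_split:
  assumes "f \<in> carrier (dual_lattice E)" "x \<in> carrier E"
  shows "f x = f (vpos E x) - f (vpos E (vscale E (- 1) x))"
  using dual_vdiff[OF assms(1), of "vpos E x" "vpos E (vscale E (- 1) x)"] assms(2)
  by (simp add: vpos_diff_vpos)

lemma dual_eqI_positive:
  assumes f: "f \<in> carrier (dual_lattice E)" and g: "g \<in> carrier (dual_lattice E)"
    and eq: "\<And>x. \<lbrakk>x \<in> carrier E; vzero E \<sqsubseteq> x\<rbrakk> \<Longrightarrow> f x = g x"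
  shows "f = g"
proof (rule dual_eqI[OF f g])
  fix x assume x: "x \<in> carrier E"
  show "f x = g x"
    unfolding dual_split[OF f x] dual_split[OF g x] using x by (simp add: eq)
qed

text \<open>
  On the positive cone \<open>\<bar>f\<bar>\<close> agrees with the additive function \<open>h\<close>, so \<open>\<bar>f u + f v\<bar> = \<bar>f u\<bar> + \<bar>f v\<bar>\<close>
  there, which rules out values of opposite sign.
\<close>

lemma dual_eq_or_eq_minus:
  assumes f: "f \<in> carrier (dual_lattice E)" and h: "h \<in> carrier (dual_lattice E)"
    and abs: "\<And>u. u \<in> carrier E \<Longrightarrow> \<bar>f u\<bar> = h (vabs E u)"
  shows "f = h \<or> f = vscale (dual_lattice E) (- 1) h"
proof -
  have abs_pos: "\<bar>f u\<bar> = h u" if "u \<in> carrier E" "vzero E \<sqsubseteq> u" for u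
    using abs[OF that(1)] that by (simp add: vabs_eq_self)
  have same_sign: "0 \<le> f u * f v" if "u \<in> carrier E" "vzero E \<sqsubseteq> u" "v \<in> carrier E" "vzero E \<sqsubseteq> v" for u v
  proof -
    have "\<bar>f u + f v\<bar> = h u + h v"
      using abs_pos[of "vadd E u v"] that by (simp add: vadd_nonneg dual_add[OF f] dual_add[OF h])
    then have "\<bar>f u + f v\<bar> = \<bar>f u\<bar> + \<bar>f v\<bar>"
      using abs_pos that by simp
    then have "(0 \<le> f u \<and> 0 \<le> f v) \<or> (f u \<le> 0 \<and> f v \<le> 0)" by linarith
    then show ?thesis by (rule split_mult_pos_le)
  qed
  show ?thesis
  proof (cases "\<exists>v\<in>carrier E. vzero E \<sqsubseteq> v \<and> f v < 0")
    case True
    then obtain v where v: "v \<in> carrier E" "vzero E \<sqsubseteq> v" "f v < 0" by blast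
    have pos: "f u = - h u" if "u \<in> carrier E" "vzero E \<sqsubseteq> u" for u
      using same_sign[of u v] abs_pos[of u] v that by (auto simp: zero_le_mult_iff)
    have "f = vscale (dual_lattice E) (- 1) h"
      by (rule dual_eqI_positive[OF f dual_scale_closed[OF h]]) (simp add: dual_lattice_simps(5) pos)
    then show ?thesis by blast
  next
    case False
    have pos: "f u = h u" if "u \<in> carrier E" "vzero E \<sqsubseteq> u" for u
      using False abs_pos[of u] that by force
    have "f = h"
      by (rule dual_eqI_positive[OF f h pos])
    then show ?thesis by blast
  qed
qed

text \<open>If \<open>h x = 0\<close> then \<open>h |x| = 0\<close>, and
  \<open>0 \<le> g \<le> h\<close> forces \<open>g\<close> to vanish on both parts of
  \<open>x\<close>. The kernel of \<open>h\<close> thus lies in that of \<open>g\<close>, which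
  makes \<open>g\<close> a multiple of \<open>h\<close>.\<close>

lemma riesz_functional_atom:
  assumes h: "h \<in> carrier (dual_lattice E)" and abs: "\<And>u. u \<in> carrier E \<Longrightarrow> \<bar>h u\<bar> = h (vabs E u)"
    and g: "g \<in> carrier (dual_lattice E)" "vzero (dual_lattice E) \<sqsubseteq>\<^bsub>dual_lattice E\<^esub> g"
    and le: "g \<sqsubseteq>\<^bsub>dual_lattice E\<^esub> h"
  obtains c where "0 \<le> c" "c \<le> 1" "g = vscale (dual_lattice E) c h"
proof (cases "\<exists>v\<in>carrier E. h v \<noteq> 0")
  case False
  have "g u = 0" if "u \<in> carrier E" "vzero E \<sqsubseteq> u" for u
    using le g(2) that False by (force simp: dual_lattice_simps)
  then have "g = vscale (dual_lattice E) 0 h"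
    by (intro dual_eqI_positive[OF g(1) dual_scale_closed[OF h]]) (simp add: dual_lattice_simps(5))
  then show ?thesis using that[of 0] by simp
next
  case True
  then obtain v where v: "v \<in> carrier E" "h v \<noteq> 0" by blast
  \<comment> \<open>A positive vector normalised to \<open>h w = 1\<close>; the multiple sought is
    \<open>g w\<close>, and \<open>0 \<le> g w \<le> h w\<close> places it between 0 and 1.\<close>
  define w where "w = vscale E (1 / \<bar>h v\<bar>) (vabs E v)"
  have w: "w \<in> carrier E" "vzero E \<sqsubseteq> w" "h w = 1"
    using v abs[OF v(1)] by (auto simp: w_def scale_mono dual_scale[OF h])
  have ker: "g x = 0" if x: "x \<in> carrier E" and "h x = 0" for x
  proof -
    have "h (vabs E x) = 0" using abs[OF x] \<open>h x = 0\<close> by simp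
    moreover have "vpos E x \<sqsubseteq> vabs E x" "vpos E (vscale E (- 1) x) \<sqsubseteq> vabs E x"
      using x by (auto intro!: vpos_least)
    then have "g (vpos E x) \<le> g (vabs E x)" "g (vpos E (vscale E (- 1) x)) \<le> g (vabs E x)"
      using x g by (auto intro!: dual_mono[OF g(1)] simp: dual_lattice_simps)
    moreover have "g (vabs E x) \<le> h (vabs E x)" "0 \<le> g (vpos E x)" "0 \<le> g (vpos E (vscale E (- 1) x))"
      using le g(2) x by (auto simp: dual_lattice_simps)
    ultimately show ?thesis using dual_split[OF g(1) x] by simp
  qed
  have "g x = g w * h x" if x: "x \<in> carrier E" for x
    using ker[of "vdiff E x (vscale E (h x) w)"] x w
    by (simp add: dual_vdiff g(1) h dual_scale[OF h] dual_scale[OF g(1)] mult.commute)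
  then have "g = vscale (dual_lattice E) (g w) h"
    by (intro dual_eqI[OF g(1) dual_scale_closed[OF h]]) (simp add: dual_lattice_simps(5))
  moreover have "0 \<le> g w" "g w \<le> 1"
    using le g(2) w by (auto simp: dual_lattice_simps)
  ultimately show ?thesis using that by blast
qed

text \<open>A functional \<open>g\<close> between \<open>0\<close> and \<open>h\<close> has the form
  \<open>c h\<close> with \<open>0 \<le> c \<le> 1\<close>, hence
  \<open>\<xi> g - \<xi> (h - g) = (2 c - 1) \<xi> h\<close>, which is at most
  \<open>|\<xi> h|\<close>. So the supremum defining the modulus of \<xi> at \<open>h\<close> does
  not exceed \<open>|\<xi> h|\<close>, and \<open>f\<close> is \<open>h\<close> up to sign.\<close>

lemma abs_bidual_eq:
  assumes f: "f \<in> carrier (dual_lattice E)" and h: "h \<in> carrier (dual_lattice E)"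
    and abs: "\<And>u. u \<in> carrier E \<Longrightarrow> \<bar>f u\<bar> = h (vabs E u)"
    and \<xi>: "\<xi> \<in> carrier (dual_lattice (dual_lattice E))"
  shows "\<bar>\<xi> f\<bar> = vabs (dual_lattice (dual_lattice E)) \<xi> h"
proof -
  let ?D = "dual_lattice E"
  interpret D: banach_lattice ?D by (rule banach_lattice_dual)
  have f_h: "f = h \<or> f = vscale ?D (- 1) h"
    by (rule dual_eq_or_eq_minus[OF f h abs])
  then have "\<bar>f u\<bar> = \<bar>h u\<bar>" if "u \<in> carrier E" for u
    using that by (auto simp: dual_lattice_simps(5))
  then have h_abs: "\<bar>h u\<bar> = h (vabs E u)" if "u \<in> carrier E" for u
    using abs that by simp
  have h_pos: "vzero ?D \<sqsubseteq>\<^bsub>?D\<^esub> h"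
    unfolding dual_lattice_simps using h_abs vabs_eq_self by (metis abs_ge_zero restrict_apply')
  have "\<bar>\<xi> f\<bar> = \<bar>\<xi> h\<bar>"
    using f_h h by (auto simp: dual_scale[OF \<xi>])
  moreover have "vabs (dual_lattice ?D) \<xi> h \<le> \<bar>\<xi> h\<bar>"
  proof (rule D.vabs_dual_le[OF \<xi> h h_pos])
    fix g assume g: "g \<in> carrier ?D" "vzero ?D \<sqsubseteq>\<^bsub>?D\<^esub> g" "g \<sqsubseteq>\<^bsub>?D\<^esub> h"
    obtain c where c: "0 \<le> c" "c \<le> 1" "g = vscale ?D c h"
      using riesz_functional_atom[OF h h_abs g] .
    have "\<xi> g - \<xi> (vdiff ?D h g) = (2 * c - 1) * \<xi> h"
      using g h by (simp add: D.dual_vdiff[OF \<xi>] c(3) dual_scale[OF \<xi>] algebra_simps)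
    also have "\<dots> \<le> \<bar>2 * c - 1\<bar> * \<bar>\<xi> h\<bar>"
      using abs_ge_self[of "(2 * c - 1) * \<xi> h"] by (simp add: abs_mult)
    also have "\<dots> \<le> 1 * \<bar>\<xi> h\<bar>"
      using c by (intro mult_right_mono) auto
    finally show "\<xi> g - \<xi> (vdiff ?D h g) \<le> \<bar>\<xi> h\<bar>" by simp
  qed
  ultimately show ?thesis
    using D.le_vabs_dual[OF \<xi> h h_pos] by simp
qed

end

section \<open>Multilinear operators\<close>

lemma prod_carrier_upd:
  "\<lbrakk>x \<in> prod_carrier I E; i \<in> I; u \<in> carrier (E i)\<rbrakk> \<Longrightarrow> x(i := u) \<in> prod_carrier I E"
  by (auto simp: prod_carrier_def PiE_def extensional_def)

lemma prod_carrier_insert: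
  "\<lbrakk>x \<in> prod_carrier (I - {i}) E; i \<in> I; u \<in> carrier (E i)\<rbrakk> \<Longrightarrow> x(i := u) \<in> prod_carrier I E"
  by (auto simp: prod_carrier_def PiE_def extensional_def Pi_def)

lemma prod_carrier_mem: "\<lbrakk>x \<in> prod_carrier I E; i \<in> I\<rbrakk> \<Longrightarrow> x i \<in> carrier (E i)"
  by (auto simp: prod_carrier_def)

lemma multilinear_closed:
  "\<lbrakk>multilinear I E F A; x \<in> prod_carrier I E\<rbrakk> \<Longrightarrow> A x \<in> carrier F"
  by (auto simp: multilinear_def)

lemma multilinear_add:
  "\<lbrakk>multilinear I E F A; x \<in> prod_carrier I E; i \<in> I; u \<in> carrier (E i); v \<in> carrier (E i)\<rbrakk>
    \<Longrightarrow> A (x(i := vadd (E i) u v)) = vadd F (A (x(i := u))) (A (x(i := v)))"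
  by (simp add: multilinear_def linear_operator_def)

lemma multilinear_scale:
  "\<lbrakk>multilinear I E F A; x \<in> prod_carrier I E; i \<in> I; u \<in> carrier (E i)\<rbrakk>
    \<Longrightarrow> A (x(i := vscale (E i) c u)) = vscale F c (A (x(i := u)))"
  by (simp add: multilinear_def linear_operator_def)

text \<open>Stated for a subset \<open>J\<close> of the index set so that the coordinates can be
  rescaled one at a time by induction.\<close>

lemma multilinear_scale_all:
  assumes A: "multilinear I E F A" and x: "x \<in> prod_carrier I E" and fin: "finite J" and JI: "J \<subseteq> I"
    and E: "\<And>i. i \<in> I \<Longrightarrow> banach_lattice (E i)" and F: "banach_lattice F"
  shows "A (\<lambda>i. if i \<in> J then vscale (E i) (c i) (x i) else x i) = vscale F (\<Prod>i\<in>J. c i) (A x)"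
  using fin JI
proof (induction J rule: finite_induct)
  case empty
  then show ?case
    using banach_lattice.scale_one[OF F multilinear_closed[OF A x]] by simp
next
  case (insert j J)
  let ?z = "\<lambda>i. if i \<in> J then vscale (E i) (c i) (x i) else x i"
  have "?z i \<in> carrier (E i)" if "i \<in> I" for i
    using prod_carrier_mem[OF x that] banach_lattice.scale_closed[OF E[OF that]] by simp
  moreover have "?z i = undefined" if "i \<notin> I" for i
    using that insert.prems x by (auto simp: prod_carrier_def PiE_def extensional_def)
  ultimately have z: "?z \<in> prod_carrier I E"
    by (auto simp: prod_carrier_def PiE_def extensional_def)
  have j: "j \<in> I" using insert by simp
  have "A (\<lambda>i. if i \<in> insert j J then vscale (E i) (c i) (x i) else x i) =
      A (?z(j := vscale (E j) (c j) (x j)))"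
    by (rule arg_cong[of _ _ A]) auto
  also have "\<dots> = vscale F (c j) (A (?z(j := x j)))"
    using multilinear_scale[OF A z j prod_carrier_mem[OF x j]] .
  also have "?z(j := x j) = ?z" using insert.hyps by auto
  finally show ?case
    using insert banach_lattice.scale_scale[OF F multilinear_closed[OF A x]] by simp
qed

text \<open>The coordinates of \<open>x\<close> are replaced by those of \<open>y\<close> one at a
  time. Each replacement adds the value of \<open>A\<close> at a point whose changed coordinate is
  \<open>y j - x j\<close> and whose other coordinates are positive as well.\<close>

lemma positive_multilinear_mono:
  assumes A: "positive_multilinear I E F A" and x: "x \<in> prod_carrier I E" and y: "y \<in> prod_carrier I E"
    and x_pos: "\<And>i. i \<in> I \<Longrightarrow> vzero (E i) \<sqsubseteq>\<^bsub>E i\<^esub> x i"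
    and le: "\<And>i. i \<in> I \<Longrightarrow> x i \<sqsubseteq>\<^bsub>E i\<^esub> y i" and fin: "finite I"
    and E: "\<And>i. i \<in> I \<Longrightarrow> banach_lattice (E i)" and F: "banach_lattice F"
  shows "A x \<sqsubseteq>\<^bsub>F\<^esub> A y"
proof -
  interpret F: banach_lattice F by (rule F)
  have lin: "multilinear I E F A" using A by (simp add: positive_multilinear_def)
  have "A x \<sqsubseteq>\<^bsub>F\<^esub> A (\<lambda>i. if i \<in> J then y i else x i)" if "finite J" "J \<subseteq> I" for J
    using that
  proof (induction J rule: finite_induct)
    case empty
    then show ?case using multilinear_closed[OF lin x] by simp
  next
    case (insert j J)
    let ?z = "\<lambda>i. if i \<in> J then y i else x i"
    have z: "?z \<in> prod_carrier I E"
      using x y insert.prems by (auto simp: prod_carrier_def PiE_def extensional_def Pi_def)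
    have j: "j \<in> I" using insert by simp
    interpret Ej: banach_lattice "E j" by (rule E[OF j])
    have xj: "x j \<in> carrier (E j)" and yj: "y j \<in> carrier (E j)"
      using prod_carrier_mem[OF x j] prod_carrier_mem[OF y j] .
    let ?d = "vdiff (E j) (y j) (x j)"
    have zd: "?z(j := ?d) \<in> prod_carrier I E"
      using z j xj yj by (intro prod_carrier_upd) auto
    have "vzero (E i) \<sqsubseteq>\<^bsub>E i\<^esub> (?z(j := ?d)) i" if "i \<in> I" for i
    proof (cases "i = j")
      case True
      then show ?thesis using le[OF j] xj yj by (simp add: Ej.vdiff_nonneg_iff)
    next
      case False
      interpret Ei: banach_lattice "E i" by (rule E[OF that])
      have "vzero (E i) \<sqsubseteq>\<^bsub>E i\<^esub> y i"
        using x_pos[OF that] le[OF that] prod_carrier_mem[OF x that] prod_carrier_mem[OF y that]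
          Ei.le_trans[of "vzero (E i)" "x i" "y i"] by simp
      then show ?thesis using False x_pos[OF that] by simp
    qed
    then have pos: "vzero F \<sqsubseteq>\<^bsub>F\<^esub> A (?z(j := ?d))"
      using A zd by (simp add: positive_multilinear_def)
    have "A (\<lambda>i. if i \<in> insert j J then y i else x i) = A (?z(j := vadd (E j) (x j) ?d))"
      by (rule arg_cong[of _ _ A]) (use xj yj in auto)
    also have "\<dots> = vadd F (A (?z(j := x j))) (A (?z(j := ?d)))"
      using xj yj by (intro multilinear_add[OF lin z j]) auto
    also have "?z(j := x j) = ?z" using insert.hyps by auto
    finally have eq: "A (\<lambda>i. if i \<in> insert j J then y i else x i) = vadd F (A ?z) (A (?z(j := ?d)))" .
    have "vadd F (A x) (vzero F) \<sqsubseteq>\<^bsub>F\<^esub> vadd F (A ?z) (A (?z(j := ?d)))"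
      using insert.IH insert.prems pos multilinear_closed[OF lin x] multilinear_closed[OF lin z]
        multilinear_closed[OF lin zd]
      by (intro F.vadd_mono) auto
    then show ?case
      unfolding eq using multilinear_closed[OF lin x] by simp
  qed
  from this[OF fin subset_refl] have "A x \<sqsubseteq>\<^bsub>F\<^esub> A (\<lambda>i. if i \<in> I then y i else x i)" .
  also have "(\<lambda>i. if i \<in> I then y i else x i) = y"
    using x y by (auto simp: prod_carrier_def PiE_def extensional_def)
  finally show ?thesis
    using multilinear_closed[OF lin x] multilinear_closed[OF lin y] by simp
qed

lemma regular_imp_multilinear:
  assumes "regular_multilinear I E F A" and E: "\<And>i. i \<in> I \<Longrightarrow> banach_lattice (E i)"
    and F: "banach_lattice F"
  shows "multilinear I E F A"
proof -
  interpret F: banach_lattice F by (rule F)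
  obtain P Q where "positive_multilinear I E F P" "positive_multilinear I E F Q"
    and A: "\<And>x. x \<in> prod_carrier I E \<Longrightarrow> A x = vdiff F (P x) (Q x)"
    using assms(1) by (auto simp: regular_multilinear_def)
  then have P: "multilinear I E F P" and Q: "multilinear I E F Q"
    by (simp_all add: positive_multilinear_def)
  have closed: "A x \<in> carrier F" "P x \<in> carrier F" "Q x \<in> carrier F" if "x \<in> prod_carrier I E" for x
    using that multilinear_closed[OF P that] multilinear_closed[OF Q that] by (simp_all add: A)
  show ?thesis
    unfolding multilinear_def linear_operator_def
  proof (intro conjI ballI allI funcsetI)
    show "A x \<in> carrier F" if "x \<in> prod_carrier I E" for x
      using that by (rule closed)
  next
    fix x i assume x: "x \<in> prod_carrier I E" and i: "i \<in> I"
    interpret Ei: banach_lattice "E i" by (rule E[OF i])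
    show "A (x(i := u)) \<in> carrier F" if "u \<in> carrier (E i)" for u
      using x i that by (intro closed prod_carrier_upd)
    fix u assume u: "u \<in> carrier (E i)"
    have xu: "x(i := u) \<in> prod_carrier I E" using x i u by (rule prod_carrier_upd)
    show "A (x(i := vscale (E i) c u)) = vscale F c (A (x(i := u)))" for c
    proof -
      have "x(i := vscale (E i) c u) \<in> prod_carrier I E"
        using x i u by (intro prod_carrier_upd) auto
      then show ?thesis
        using multilinear_scale[OF P x i u] multilinear_scale[OF Q x i u] xu closed
        by (simp add: A F.scale_vdiff)
    qed
    fix v assume v: "v \<in> carrier (E i)"
    have xv: "x(i := v) \<in> prod_carrier I E" using x i v by (rule prod_carrier_upd)
    have "x(i := vadd (E i) u v) \<in> prod_carrier I E"
      using x i u v by (intro prod_carrier_upd) auto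
    then show "A (x(i := vadd (E i) u v)) = vadd F (A (x(i := u))) (A (x(i := v)))"
      using multilinear_add[OF P x i u v] multilinear_add[OF Q x i u v] xu xv closed
      by (simp add: A F.vadd_vdiff_vdiff)
  qed
qed

lemma vabs_prod_carrier:
  assumes "x \<in> prod_carrier I E" and "\<And>i. i \<in> I \<Longrightarrow> banach_lattice (E i)"
  shows "(\<lambda>i\<in>I. vabs (E i) (x i)) \<in> prod_carrier I E"
  using assms banach_lattice.vabs_closed by (fastforce simp: prod_carrier_def)

lemma vabs_prod_carrier_eq_self:
  assumes x: "x \<in> prod_carrier I E" and E: "\<And>i. i \<in> I \<Longrightarrow> banach_lattice (E i)"
    and pos: "\<And>i. i \<in> I \<Longrightarrow> vzero (E i) \<sqsubseteq>\<^bsub>E i\<^esub> x i"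
  shows "(\<lambda>i\<in>I. vabs (E i) (x i)) = x"
  using prod_carrier_mem[OF x] banach_lattice.vabs_eq_self[OF E] pos x
  by (auto simp: fun_eq_iff prod_carrier_def PiE_def extensional_def)

text \<open>At a positive argument the defining identity reads \<open>|A x| = A x\<close>.\<close>

lemma riesz_multimorphism_positive:
  assumes A: "riesz_multimorphism I E F A" and E: "\<And>i. i \<in> I \<Longrightarrow> banach_lattice (E i)"
    and F: "banach_lattice F"
  shows "positive_multilinear I E F A"
proof -
  have lin: "multilinear I E F A"
    using A regular_imp_multilinear[OF _ E F] by (simp add: riesz_multimorphism_def)
  have "vzero F \<sqsubseteq>\<^bsub>F\<^esub> A x"
    if x: "x \<in> prod_carrier I E" and pos: "\<forall>i\<in>I. vzero (E i) \<sqsubseteq>\<^bsub>E i\<^esub> x i" for x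
  proof -
    have "vabs F (A x) = A x"
      using A x pos vabs_prod_carrier_eq_self[OF x E] by (simp add: riesz_multimorphism_def)
    then show ?thesis
      using banach_lattice.vabs_nonneg[OF F multilinear_closed[OF lin x]] by simp
  qed
  then show ?thesis using lin by (simp add: positive_multilinear_def)
qed

text \<open>A gliding argument: arguments violating larger and larger bounds are rescaled to
  positive vectors \<open>w n\<close> of summable norms, all dominated by one \<open>y\<close>.
  Monotonicity then makes the norm of \<open>A y\<close> exceed every natural number.\<close>

lemma riesz_multimorphism_bounded:
  assumes A: "riesz_multimorphism I E F A" and fin: "finite I"
    and E: "\<And>i. i \<in> I \<Longrightarrow> banach_lattice (E i)" and F: "banach_lattice F"
  obtains K where "0 \<le> K"
    "\<And>x. x \<in> prod_carrier I E \<Longrightarrow> vnorm F (A x) \<le> K * (\<Prod>i\<in>I. vnorm (E i) (x i))"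
proof -
  interpret F: banach_lattice F by (rule F)
  have pos: "positive_multilinear I E F A"
    by (rule riesz_multimorphism_positive[OF A E F])
  then have lin: "multilinear I E F A" by (simp add: positive_multilinear_def)
  \<comment> \<open>Rescaling \<open>card I\<close> coordinates to norm \<open>(1/2) ^ n\<close>
    costs the factor \<open>2 ^ (n * card I)\<close>; the factor \<open>real n\<close> is what
    survives it.\<close>
  let ?b = "\<lambda>n::nat. real n * 2 ^ (n * card I)"
  have "\<exists>n. \<forall>x\<in>prod_carrier I E. vnorm F (A x) \<le> ?b n * (\<Prod>i\<in>I. vnorm (E i) (x i))"
  proof (rule ccontr)
    assume "\<not> ?thesis"
    then have "\<forall>n. \<exists>x. x \<in> prod_carrier I E \<and> ?b n * (\<Prod>i\<in>I. vnorm (E i) (x i)) < vnorm F (A x)"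
      by (simp add: not_le Bex_def)
    from choice[OF this] obtain x where x: "\<And>n. x n \<in> prod_carrier I E"
      and large: "\<And>n. ?b n * (\<Prod>i\<in>I. vnorm (E i) (x n i)) < vnorm F (A (x n))"
      by blast
    \<comment> \<open>Needed for the division in \<open>c\<close>. A vanishing coordinate would give
      \<open>A (x n) = 0\<close>, contradicting the strict inequality in
      \<open>large\<close>.\<close>
    have norm_pos: "vnorm (E i) (x n i) > 0" if i: "i \<in> I" for n i
    proof (rule ccontr)
      interpret Ei: banach_lattice "E i" by (rule E[OF i])
      have xi: "x n i \<in> carrier (E i)" using prod_carrier_mem[OF x i] .
      assume "\<not> vnorm (E i) (x n i) > 0"
      then have zero: "vnorm (E i) (x n i) = 0" using Ei.norm_nonneg[OF xi] by simp
      then have "x n = (x n)(i := vscale (E i) 0 (vzero (E i)))"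
        using xi by (simp add: Ei.norm_eq_0 fun_upd_idem)
      then have "A (x n) = vscale F 0 (A ((x n)(i := vzero (E i))))"
        using multilinear_scale[OF lin x i Ei.vzero_closed] by metis
      also have "\<dots> = vzero F"
        using multilinear_closed[OF lin prod_carrier_upd[OF x i Ei.vzero_closed]] by simp
      finally have "A (x n) = vzero F" .
      moreover have "(\<Prod>i\<in>I. vnorm (E i) (x n i)) = 0"
        using zero i fin by (auto intro: prod_zero)
      ultimately show False using large[of n] by simp
    qed
    define c where "c n i = (1/2) ^ n / vnorm (E i) (x n i)" for n i
    \<comment> \<open>Passing to moduli makes the coordinates positive, while the norm of the value
      is kept, since \<open>A\<close> at the moduli is the modulus of
      \<open>A (x n)\<close>.\<close>
    define w where "w n i = vscale (E i) (c n i) (vabs (E i) (x n i))" for n i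
    have w: "w n i \<in> carrier (E i)" "vzero (E i) \<sqsubseteq>\<^bsub>E i\<^esub> w n i" "vnorm (E i) (w n i) \<le> (1/2) ^ n"
      if i: "i \<in> I" for n i
    proof -
      interpret Ei: banach_lattice "E i" by (rule E[OF i])
      have xi: "x n i \<in> carrier (E i)" by (rule prod_carrier_mem[OF x i])
      have c: "0 \<le> c n i" using norm_pos[OF i, of n] by (simp add: c_def)
      show "w n i \<in> carrier (E i)" "vzero (E i) \<sqsubseteq>\<^bsub>E i\<^esub> w n i"
        using xi c by (simp_all add: w_def Ei.scale_mono)
      have "vnorm (E i) (w n i) = c n i * vnorm (E i) (x n i)"
        using xi c by (simp add: w_def Ei.norm_scale)
      then show "vnorm (E i) (w n i) \<le> (1/2) ^ n"
        using norm_pos[OF i, of n] by (simp add: c_def)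
    qed
    have "\<exists>v. v \<in> carrier (E i) \<and> (\<forall>n. w n i \<sqsubseteq>\<^bsub>E i\<^esub> v)" if i: "i \<in> I" for i
    proof -
      obtain v where "v \<in> carrier (E i)" "\<And>n. w n i \<sqsubseteq>\<^bsub>E i\<^esub> v"
        by (rule banach_lattice.upper_bound_of_small_sequence[where w = "\<lambda>n. w n i", OF E[OF i] w[OF i]])
          (rule that)
      then show ?thesis by blast
    qed
    then have "\<forall>i\<in>I. \<exists>v. v \<in> carrier (E i) \<and> (\<forall>n. w n i \<sqsubseteq>\<^bsub>E i\<^esub> v)" by blast
    from bchoice[OF this] obtain y0 where y0: "\<And>i. i \<in> I \<Longrightarrow> y0 i \<in> carrier (E i)"
      "\<And>i n. i \<in> I \<Longrightarrow> w n i \<sqsubseteq>\<^bsub>E i\<^esub> y0 i"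
      by blast
    define y where "y = restrict y0 I"
    have y: "y \<in> prod_carrier I E" using y0 by (simp add: y_def prod_carrier_def)
    have bound: "real n < vnorm F (A y)" for n
    proof -
      let ?a = "\<lambda>i\<in>I. vabs (E i) (x n i)" and ?w = "restrict (w n) I"
      have a: "?a \<in> prod_carrier I E" by (rule vabs_prod_carrier[OF x E])
      have wn: "?w \<in> prod_carrier I E" using w by (simp add: prod_carrier_def)
      let ?p = "\<Prod>i\<in>I. vnorm (E i) (x n i)"
      have "?p > 0" using norm_pos by (simp add: prod_pos)
      have "(\<Prod>i\<in>I. c n i) = (1/2) ^ (n * card I) / ?p"
        by (simp add: c_def prod_dividef power_mult)
      have "?w = (\<lambda>i. if i \<in> I then vscale (E i) (c n i) (?a i) else ?a i)"
        by (auto simp: w_def)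
      then have "A ?w = vscale F (\<Prod>i\<in>I. c n i) (A ?a)"
        using multilinear_scale_all[OF lin a fin subset_refl E F, of "c n"] by simp
      moreover have "vnorm F (A ?a) = vnorm F (A (x n))"
      proof -
        have "A ?a = vabs F (A (x n))"
          using A x by (simp add: riesz_multimorphism_def)
        then show ?thesis using multilinear_closed[OF lin x] by simp
      qed
      ultimately have "vnorm F (A ?w) = (1/2) ^ (n * card I) / ?p * vnorm F (A (x n))"
        using \<open>?p > 0\<close> \<open>(\<Prod>i\<in>I. c n i) = _\<close> multilinear_closed[OF lin a] by (simp add: F.norm_scale)
      also have "\<dots> > (1/2) ^ (n * card I) / ?p * (?b n * ?p)"
        using \<open>?p > 0\<close> large[of n] by (intro mult_strict_left_mono) auto
      also have "(1/2) ^ (n * card I) / ?p * (?b n * ?p) = real n"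
        using \<open>?p > 0\<close> by (simp add: power_one_over)
      finally have "real n < vnorm F (A ?w)" .
      also have "\<dots> \<le> vnorm F (A y)"
      proof (rule F.vnorm_mono)
        show "A ?w \<sqsubseteq>\<^bsub>F\<^esub> A y"
          by (rule positive_multilinear_mono[OF pos wn y _ _ fin E F]) (use w y0 in \<open>auto simp: y_def\<close>)
        show "vzero F \<sqsubseteq>\<^bsub>F\<^esub> A ?w"
          using pos wn w by (simp add: positive_multilinear_def)
      qed (use multilinear_closed[OF lin] wn y in auto)
      finally show ?thesis .
    qed
    obtain n where "vnorm F (A y) \<le> real n" using real_arch_simple by blast
    then show False using bound[of n] by simp
  qed
  then obtain n where "\<forall>x\<in>prod_carrier I E. vnorm F (A x) \<le> ?b n * (\<Prod>i\<in>I. vnorm (E i) (x i))" ..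
  then show ?thesis by (intro that[of "?b n"]) auto
qed

section \<open>Eliminating a variable of a bounded form\<close>

text \<open>The constant is a parameter because its dependence on the functional \<phi> has to
  survive all eliminations: it yields the boundedness of the Aron-Berner extension as a functional
  of \<phi>.\<close>

definition bounded_form ::
  "nat set \<Rightarrow> (nat \<Rightarrow> ('a, 'z) ordered_normed_space_scheme) \<Rightarrow> real \<Rightarrow> ((nat \<Rightarrow> 'a) \<Rightarrow> real) \<Rightarrow> bool" where
  "bounded_form I E K B \<longleftrightarrow> 0 \<le> K \<and> multilinear I E real_lattice B \<and>
     (\<forall>x\<in>prod_carrier I E. \<bar>B x\<bar> \<le> K * (\<Prod>i\<in>I. vnorm (E i) (x i)))"

definition nonneg_form ::
  "nat set \<Rightarrow> (nat \<Rightarrow> ('a, 'z) ordered_normed_space_scheme) \<Rightarrow> ((nat \<Rightarrow> 'a) \<Rightarrow> real) \<Rightarrow> bool" where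
  "nonneg_form I E B \<longleftrightarrow>
     (\<forall>x\<in>prod_carrier I E. (\<forall>i\<in>I. vzero (E i) \<sqsubseteq>\<^bsub>E i\<^esub> x i) \<longrightarrow> 0 \<le> B x)"

definition slice ::
  "(nat \<Rightarrow> ('a, 'z) ordered_normed_space_scheme) \<Rightarrow> nat \<Rightarrow> ((nat \<Rightarrow> 'a) \<Rightarrow> real) \<Rightarrow> (nat \<Rightarrow> 'a) \<Rightarrow> 'a \<Rightarrow> real" where
  "slice E i B x = (\<lambda>u\<in>carrier (E i). B (x(i := u)))"

text \<open>The bar map for an arbitrary index set, so that a single step can be studied without the
  permutation.\<close>

definition eliminate ::
  "nat set \<Rightarrow> (nat \<Rightarrow> ('a, 'z) ordered_normed_space_scheme) \<Rightarrow> nat \<Rightarrow> (('a \<Rightarrow> real) \<Rightarrow> real)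
    \<Rightarrow> ((nat \<Rightarrow> 'a) \<Rightarrow> real) \<Rightarrow> ((nat \<Rightarrow> 'a) \<Rightarrow> real)" where
  "eliminate I E i \<xi> B = (\<lambda>x\<in>prod_carrier (I - {i}) E. \<xi> (slice E i B x))"

locale bounded_form_slice =
  fixes I :: "nat set" and E :: "nat \<Rightarrow> ('a, 'z) ordered_normed_space_scheme" and i :: nat
  assumes fin: "finite I" and i: "i \<in> I" and E: "\<And>j. j \<in> I \<Longrightarrow> banach_lattice (E j)"
begin

lemma dual_banach: "banach_lattice (dual_lattice (E i))"
  using banach_lattice.banach_lattice_dual[OF E[OF i]] .

lemma prod_norm_nonneg:
  assumes "x \<in> prod_carrier J E" "J \<subseteq> I"
  shows "0 \<le> (\<Prod>j\<in>J. vnorm (E j) (x j))"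
proof (rule prod_nonneg)
  fix j assume j: "j \<in> J"
  then have "banach_lattice (E j)" using E assms(2) by blast
  then show "0 \<le> vnorm (E j) (x j)"
    using prod_carrier_mem[OF assms(1) j] by (rule banach_lattice.norm_nonneg)
qed

lemma slice_bound:
  assumes B: "bounded_form I E K B" and x: "x \<in> prod_carrier (I - {i}) E" and u: "u \<in> carrier (E i)"
  shows "\<bar>B (x(i := u))\<bar> \<le> K * (\<Prod>j\<in>I - {i}. vnorm (E j) (x j)) * vnorm (E i) u"
proof -
  have "(\<Prod>j\<in>I. vnorm (E j) ((x(i := u)) j)) = vnorm (E i) u * (\<Prod>j\<in>I - {i}. vnorm (E j) (x j))"
    using prod.remove[OF fin i, of "\<lambda>j. vnorm (E j) ((x(i := u)) j)"] by simp
  moreover have "\<bar>B (x(i := u))\<bar> \<le> K * (\<Prod>j\<in>I. vnorm (E j) ((x(i := u)) j))"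
    using B prod_carrier_insert[OF x i u] unfolding bounded_form_def by blast
  ultimately show ?thesis by (simp add: mult_ac)
qed

lemma slice_closed:
  assumes B: "bounded_form I E K B" and x: "x \<in> prod_carrier (I - {i}) E"
  shows "slice E i B x \<in> carrier (dual_lattice (E i))"
proof -
  interpret Ei: banach_lattice "E i" by (rule E[OF i])
  have lin: "multilinear I E real_lattice B" using B by (simp add: bounded_form_def)
  have x0: "x(i := vzero (E i)) \<in> prod_carrier I E" by (rule prod_carrier_insert[OF x i Ei.vzero_closed])
  show ?thesis
    unfolding dual_carrier_iff
  proof (intro conjI ballI allI)
    show "slice E i B x \<in> extensional (carrier (E i))" by (simp add: slice_def)
    show "\<exists>C. \<forall>u\<in>carrier (E i). \<bar>slice E i B x u\<bar> \<le> C * vnorm (E i) u"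
      using slice_bound[OF B x] unfolding slice_def by (metis restrict_apply')
    fix u assume u: "u \<in> carrier (E i)"
    show "slice E i B x (vscale (E i) c u) = c * slice E i B x u" for c
      using multilinear_scale[OF lin x0 i u, of c] u by (simp add: slice_def real_lattice_simps)
    fix v assume v: "v \<in> carrier (E i)"
    show "slice E i B x (vadd (E i) u v) = slice E i B x u + slice E i B x v"
      using multilinear_add[OF lin x0 i u v] u v by (simp add: slice_def real_lattice_simps)
  qed
qed

lemma slice_norm_le:
  assumes B: "bounded_form I E K B" and x: "x \<in> prod_carrier (I - {i}) E"
  shows "vnorm (dual_lattice (E i)) (slice E i B x) \<le> K * (\<Prod>j\<in>I - {i}. vnorm (E j) (x j))"
proof (rule banach_lattice.dual_norm_le[OF E[OF i] slice_closed[OF B x]])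
  show "0 \<le> K * (\<Prod>j\<in>I - {i}. vnorm (E j) (x j))"
    using B prod_norm_nonneg[OF x] by (simp add: bounded_form_def)
  show "\<bar>slice E i B x u\<bar> \<le> K * (\<Prod>j\<in>I - {i}. vnorm (E j) (x j)) * vnorm (E i) u" if "u \<in> carrier (E i)" for u
    using slice_bound[OF B x that] that by (simp add: slice_def)
qed

text \<open>The slices depend multilinearly on the remaining variables and have dual norm at most
  \<open>K\<close> times the product of the remaining norms; composing with \<xi> contributes its
  norm.\<close>

lemma eliminate_bounded_form:
  assumes B: "bounded_form I E K B" and \<xi>: "\<xi> \<in> carrier (dual_lattice (dual_lattice (E i)))"
  shows "bounded_form (I - {i}) E (K * vnorm (dual_lattice (dual_lattice (E i))) \<xi>) (eliminate I E i \<xi> B)"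
proof -
  let ?D = "dual_lattice (E i)" and ?B = "eliminate I E i \<xi> B"
  interpret D: banach_lattice ?D by (rule dual_banach)
  have lin: "multilinear I E real_lattice B" and K: "0 \<le> K" using B by (simp_all add: bounded_form_def)
  show ?thesis
    unfolding bounded_form_def
  proof (intro conjI ballI)
    show "0 \<le> K * vnorm (dual_lattice ?D) \<xi>"
      using K D.dual_norm_nonneg[OF \<xi>] by simp
  next
    fix x assume x: "x \<in> prod_carrier (I - {i}) E"
    have "\<bar>?B x\<bar> \<le> vnorm (dual_lattice ?D) \<xi> * vnorm ?D (slice E i B x)"
      using D.dual_norm_bound[OF \<xi> slice_closed[OF B x]] x by (simp add: eliminate_def)
    also have "\<dots> \<le> vnorm (dual_lattice ?D) \<xi> * (K * (\<Prod>j\<in>I - {i}. vnorm (E j) (x j)))"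
      by (intro mult_left_mono slice_norm_le[OF B x] D.dual_norm_nonneg[OF \<xi>])
    finally show "\<bar>?B x\<bar> \<le> K * vnorm (dual_lattice ?D) \<xi> * (\<Prod>j\<in>I - {i}. vnorm (E j) (x j))"
      by (simp add: mult_ac)
  next
    show "multilinear (I - {i}) E real_lattice ?B"
      unfolding multilinear_def linear_operator_def real_lattice_simps
    proof (intro conjI ballI allI)
      fix x j assume x: "x \<in> prod_carrier (I - {i}) E" and j: "j \<in> I - {i}"
      interpret Ej: banach_lattice "E j" using E j by blast
      have upd: "x(j := u) \<in> prod_carrier (I - {i}) E" if "u \<in> carrier (E j)" for u
        using x j that by (rule prod_carrier_upd)
      \<comment> \<open>Updates at the distinct indices \<open>i\<close> and \<open>j\<close>
        commute, so linearity of \<open>B\<close> in variable \<open>j\<close> becomes linearity of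
        the slice.\<close>
      have swap: "x(j := u, i := w) = x(i := w, j := u)" for u w
        using j by (auto simp: fun_upd_twist)
      fix u assume u: "u \<in> carrier (E j)"
      show "?B (x(j := vscale (E j) c u)) = c * ?B (x(j := u))" for c
      proof -
        have "slice E i B (x(j := vscale (E j) c u)) = vscale ?D c (slice E i B (x(j := u)))"
          using multilinear_scale[OF lin prod_carrier_insert[OF x i], of _ j u] j u
          by (auto simp: slice_def dual_lattice_simps real_lattice_simps swap fun_eq_iff restrict_def)
        then show ?thesis
          using upd u dual_scale[OF \<xi> slice_closed[OF B upd[OF u]]] by (simp add: eliminate_def)
      qed
      fix v assume v: "v \<in> carrier (E j)"
      have "slice E i B (x(j := vadd (E j) u v)) =
          vadd ?D (slice E i B (x(j := u))) (slice E i B (x(j := v)))"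
        using multilinear_add[OF lin prod_carrier_insert[OF x i], of _ j u v] j u v
        by (auto simp: slice_def dual_lattice_simps real_lattice_simps swap fun_eq_iff restrict_def)
      then show "?B (x(j := vadd (E j) u v)) = ?B (x(j := u)) + ?B (x(j := v))"
        using upd u v dual_add[OF \<xi> slice_closed[OF B upd[OF u]] slice_closed[OF B upd[OF v]]]
        by (simp add: eliminate_def)
    qed auto
  qed
qed

lemma eliminate_nonneg:
  assumes B: "bounded_form I E K B" "nonneg_form I E B"
    and \<xi>: "\<xi> \<in> carrier (dual_lattice (dual_lattice (E i)))"
      "vzero (dual_lattice (dual_lattice (E i))) \<sqsubseteq>\<^bsub>dual_lattice (dual_lattice (E i))\<^esub> \<xi>"
  shows "nonneg_form (I - {i}) E (eliminate I E i \<xi> B)"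
  unfolding nonneg_form_def
proof (intro ballI impI)
  fix x assume x: "x \<in> prod_carrier (I - {i}) E" and pos: "\<forall>j\<in>I - {i}. vzero (E j) \<sqsubseteq>\<^bsub>E j\<^esub> x j"
  have "0 \<le> B (x(i := u))" if "u \<in> carrier (E i)" "vzero (E i) \<sqsubseteq>\<^bsub>E i\<^esub> u" for u
    using B(2) prod_carrier_insert[OF x i that(1)] pos that by (auto simp: nonneg_form_def)
  then have "vzero (dual_lattice (E i)) \<sqsubseteq>\<^bsub>dual_lattice (E i)\<^esub> slice E i B x"
    by (auto simp: dual_lattice_simps slice_def)
  then have "0 \<le> \<xi> (slice E i B x)"
    using \<xi>(2) slice_closed[OF B(1) x] by (auto simp: dual_lattice_simps(1,3)[of "dual_lattice (E i)"])
  then show "0 \<le> eliminate I E i \<xi> B x" using x by (simp add: eliminate_def)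
qed

text \<open>The single combination \<open>c * B + C\<close> covers sums and multiples together. The
  rule serves twice: for the dependence on the initial form and for the dependence on an element
  eliminated at an earlier step.\<close>

lemma eliminate_linear_form:
  assumes B: "bounded_form I E K B" and C: "bounded_form I E L C"
    and \<xi>: "\<xi> \<in> carrier (dual_lattice (dual_lattice (E i)))"
    and eq: "\<And>x. x \<in> prod_carrier I E \<Longrightarrow> D x = c * B x + C x"
    and x: "x \<in> prod_carrier (I - {i}) E"
  shows "eliminate I E i \<xi> D x = c * eliminate I E i \<xi> B x + eliminate I E i \<xi> C x"
proof -
  interpret D: banach_lattice "dual_lattice (E i)" by (rule dual_banach)
  have "slice E i D x = vadd (dual_lattice (E i)) (vscale (dual_lattice (E i)) c (slice E i B x)) (slice E i C x)"
    using eq[OF prod_carrier_insert[OF x i]]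
    by (auto simp: slice_def dual_lattice_simps fun_eq_iff restrict_def)
  then show ?thesis
    using slice_closed[OF B x] slice_closed[OF C x] x
    by (simp add: eliminate_def dual_add[OF \<xi>] dual_scale[OF \<xi>])
qed

text \<open>The slice of \<open>B\<close> at \<open>x\<close> and the slice of \<open>C\<close> at
  the moduli stand in the relation required by \<open>abs_bidual_eq\<close>. The conclusion relates
  forms eliminated with different elements, so the hypothesis cannot be restricted to
  \<open>B = C\<close>.\<close>

lemma eliminate_abs:
  assumes B: "bounded_form I E K B" and C: "bounded_form I E L C"
    and \<xi>: "\<xi> \<in> carrier (dual_lattice (dual_lattice (E i)))"
    and abs: "\<And>x. x \<in> prod_carrier I E \<Longrightarrow> \<bar>B x\<bar> = C (\<lambda>j\<in>I. vabs (E j) (x j))"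
    and x: "x \<in> prod_carrier (I - {i}) E"
  shows "\<bar>eliminate I E i \<xi> B x\<bar> =
    eliminate I E i (vabs (dual_lattice (dual_lattice (E i))) \<xi>) C (\<lambda>j\<in>I - {i}. vabs (E j) (x j))"
proof -
  interpret Ei: banach_lattice "E i" by (rule E[OF i])
  let ?a = "\<lambda>j\<in>I - {i}. vabs (E j) (x j)"
  have a: "?a \<in> prod_carrier (I - {i}) E"
    using x E by (intro vabs_prod_carrier) auto
  have "\<bar>slice E i B x u\<bar> = slice E i C ?a (vabs (E i) u)" if u: "u \<in> carrier (E i)" for u
  proof -
    have "(\<lambda>j\<in>I. vabs (E j) ((x(i := u)) j)) = ?a(i := vabs (E i) u)"
      using i by (auto simp: fun_eq_iff)
    then show ?thesis
      using abs[OF prod_carrier_insert[OF x i u]] u by (simp add: slice_def)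
  qed
  then show ?thesis
    using Ei.abs_bidual_eq[OF slice_closed[OF B x] slice_closed[OF C a] _ \<xi>] x a
    by (simp add: eliminate_def)
qed

end

section \<open>Iterated elimination\<close>

lemma index_set_Suc: "index_set m \<rho> (Suc k) = index_set m \<rho> k - {\<rho> (Suc k)}"
  by (auto simp: index_set_def atLeastAtMostSuc_conv)

lemma bar_iter_Suc:
  "bar_iter E m \<rho> \<xi> B (Suc k) =
    eliminate (index_set m \<rho> k) E (\<rho> (Suc k)) (\<xi> (\<rho> (Suc k))) (bar_iter E m \<rho> \<xi> B k)"
  by (simp add: bar_map_def eliminate_def slice_def index_set_Suc)

locale bidual_product =
  fixes m :: nat and \<rho> :: "nat \<Rightarrow> nat" and E :: "nat \<Rightarrow> 'a ordered_normed_space"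
  assumes \<rho>: "\<rho> permutes {1..m}" and E: "\<And>i. i \<in> {1..m} \<Longrightarrow> banach_lattice (E i)"
begin

abbreviation bidual :: "nat \<Rightarrow> (('a \<Rightarrow> real) \<Rightarrow> real) ordered_normed_space" where
  "bidual i \<equiv> dual_lattice (dual_lattice (E i))"

lemma rho_in: "k \<in> {1..m} \<Longrightarrow> \<rho> k \<in> {1..m}"
  using permutes_in_image[OF \<rho>] by blast

lemma rho_eq_iff: "\<rho> k = \<rho> l \<longleftrightarrow> k = l"
  using permutes_inj[OF \<rho>] by (auto dest: injD)

lemma index_set_last: "index_set m \<rho> m = {}"
  using permutes_image[OF \<rho>] by (simp add: index_set_def del: One_nat_def)

lemma slice_step: "k < m \<Longrightarrow> bounded_form_slice (index_set m \<rho> k) E (\<rho> (Suc k))"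
  using rho_in[of "Suc k"] E by (intro bounded_form_slice.intro) (auto simp: index_set_def rho_eq_iff)

lemma bidual_mem: "\<lbrakk>\<xi> \<in> prod_carrier {1..m} bidual; k < m\<rbrakk> \<Longrightarrow> \<xi> (\<rho> (Suc k)) \<in> carrier (bidual (\<rho> (Suc k)))"
  by (rule prod_carrier_mem) (use rho_in[of "Suc k"] in auto)

lemma bar_iter_bounded_form:
  assumes "bounded_form {1..m} E K B" "\<xi> \<in> prod_carrier {1..m} bidual" "k \<le> m"
  shows "bounded_form (index_set m \<rho> k) E (K * (\<Prod>j=1..k. vnorm (bidual (\<rho> j)) (\<xi> (\<rho> j)))) (bar_iter E m \<rho> \<xi> B k)"
  using assms(3)
proof (induction k)
  case 0
  then show ?case using assms(1) by (simp add: index_set_def)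
next
  case (Suc k)
  then have "k < m" by simp
  from bounded_form_slice.eliminate_bounded_form[OF slice_step[OF this] Suc.IH bidual_mem[OF assms(2) this]]
  show ?case using Suc.prems by (simp only: bar_iter_Suc index_set_Suc) (simp add: mult_ac)
qed

lemma bar_iter_nonneg:
  assumes B: "bounded_form {1..m} E K B" "nonneg_form {1..m} E B" and \<xi>: "\<xi> \<in> prod_carrier {1..m} bidual"
    and pos: "\<And>i. i \<in> {1..m} \<Longrightarrow> vzero (bidual i) \<sqsubseteq>\<^bsub>bidual i\<^esub> \<xi> i" and "k \<le> m"
  shows "nonneg_form (index_set m \<rho> k) E (bar_iter E m \<rho> \<xi> B k)"
  using \<open>k \<le> m\<close>
proof (induction k)
  case 0
  then show ?case using B(2) by (simp add: index_set_def)
next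
  case (Suc k)
  then have k: "k < m" by simp
  have "vzero (bidual (\<rho> (Suc k))) \<sqsubseteq>\<^bsub>bidual (\<rho> (Suc k))\<^esub> \<xi> (\<rho> (Suc k))"
    using pos[OF rho_in] k by simp
  from bounded_form_slice.eliminate_nonneg[OF slice_step[OF k]
      bar_iter_bounded_form[OF B(1) \<xi> less_imp_le[OF k]] Suc.IH[OF less_imp_le[OF k]] bidual_mem[OF \<xi> k] this]
  show ?case by (simp only: bar_iter_Suc index_set_Suc)
qed

lemma bar_iter_linear_form:
  assumes B: "bounded_form {1..m} E K B" and C: "bounded_form {1..m} E L C"
    and \<xi>: "\<xi> \<in> prod_carrier {1..m} bidual"
    and eq: "\<And>x. x \<in> prod_carrier {1..m} E \<Longrightarrow> D x = c * B x + C x"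
    and "k \<le> m" "x \<in> prod_carrier (index_set m \<rho> k) E"
  shows "bar_iter E m \<rho> \<xi> D k x = c * bar_iter E m \<rho> \<xi> B k x + bar_iter E m \<rho> \<xi> C k x"
  using \<open>k \<le> m\<close> \<open>x \<in> prod_carrier (index_set m \<rho> k) E\<close>
proof (induction k arbitrary: x)
  case 0
  then show ?case using eq by (simp add: index_set_def)
next
  case (Suc k)
  then have k: "k < m" and k': "k \<le> m" by simp_all
  have x: "x \<in> prod_carrier (index_set m \<rho> k - {\<rho> (Suc k)}) E"
    using Suc.prems(2) by (simp only: index_set_Suc)
  from bounded_form_slice.eliminate_linear_form[OF slice_step[OF k] bar_iter_bounded_form[OF B \<xi> k']
      bar_iter_bounded_form[OF C \<xi> k'] bidual_mem[OF \<xi> k] Suc.IH[OF k'] x]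
  show ?case by (simp only: bar_iter_Suc)
qed

text \<open>The elements eliminated up to step \<open>k\<close> are those at the indices
  \<open>\<rho> 1\<close>, ..., \<open>\<rho> k\<close>; a change elsewhere is not yet
  visible.\<close>

lemma bar_iter_cong:
  assumes "\<And>j. \<lbrakk>1 \<le> j; j \<le> k\<rbrakk> \<Longrightarrow> \<xi> (\<rho> j) = \<eta> (\<rho> j)"
  shows "bar_iter E m \<rho> \<xi> B k = bar_iter E m \<rho> \<eta> B k"
  using assms by (induction k) (simp_all del: bar_iter.simps(2) add: bar_iter_Suc)

text \<open>Before step \<open>l\<close> the iterate does not see the varied element. At step
  \<open>l\<close> it evaluates that element at a fixed functional, and the operations of the bidual
  are pointwise. From then on the linear combination is carried along by linearity in the
  form.\<close>

lemma bar_iter_linear_arg: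
  assumes B: "bounded_form {1..m} E K B" and \<xi>: "\<xi> \<in> prod_carrier {1..m} bidual"
    and l: "l \<in> {1..m}" and u: "u \<in> carrier (bidual (\<rho> l))" and v: "v \<in> carrier (bidual (\<rho> l))"
    and w: "w = vadd (bidual (\<rho> l)) (vscale (bidual (\<rho> l)) c u) v"
    and "l \<le> k" "k \<le> m" "x \<in> prod_carrier (index_set m \<rho> k) E"
  shows "bar_iter E m \<rho> (\<xi>(\<rho> l := w)) B k x =
    c * bar_iter E m \<rho> (\<xi>(\<rho> l := u)) B k x + bar_iter E m \<rho> (\<xi>(\<rho> l := v)) B k x"
  using \<open>l \<le> k\<close> \<open>k \<le> m\<close> \<open>x \<in> prod_carrier (index_set m \<rho> k) E\<close>
proof (induction k arbitrary: x)
  case 0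
  then show ?case using l by simp
next
  case (Suc k)
  then have k: "k < m" and k': "k \<le> m" by simp_all
  interpret S: bounded_form_slice "index_set m \<rho> k" E "\<rho> (Suc k)" by (rule slice_step[OF k])
  have x: "x \<in> prod_carrier (index_set m \<rho> k - {\<rho> (Suc k)}) E"
    using Suc.prems(3) by (simp only: index_set_Suc)
  have upd: "\<xi>(\<rho> l := a) \<in> prod_carrier {1..m} bidual" if "a \<in> carrier (bidual (\<rho> l))" for a
    using \<xi> rho_in[OF l] that by (rule prod_carrier_upd)
  show ?case
  proof (cases "l = Suc k")
    case True
    let ?B = "bar_iter E m \<rho> \<xi> B k"
    have same: "bar_iter E m \<rho> (\<xi>(\<rho> l := a)) B k = ?B" for a
      by (rule bar_iter_cong) (use True in \<open>auto simp: rho_eq_iff\<close>)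
    have val: "bar_iter E m \<rho> (\<xi>(\<rho> l := a)) B (Suc k) x = a (slice E (\<rho> (Suc k)) ?B x)" for a
      unfolding bar_iter_Suc same using x True by (simp add: eliminate_def)
    have "slice E (\<rho> (Suc k)) ?B x \<in> carrier (dual_lattice (E (\<rho> (Suc k))))"
      by (rule S.slice_closed[OF bar_iter_bounded_form[OF B \<xi> k'] x])
    then show ?thesis
      unfolding val unfolding w True by (simp add: dual_lattice_simps(4,5)[of "dual_lattice (E (\<rho> (Suc k)))"])
  next
    case False
    then have lk: "l \<le> k" using Suc.prems by simp
    have same: "(\<xi>(\<rho> l := a)) (\<rho> (Suc k)) = \<xi> (\<rho> (Suc k))" for a
      using False by (simp add: rho_eq_iff)
    from S.eliminate_linear_form[OF bar_iter_bounded_form[OF B upd[OF u] k']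
        bar_iter_bounded_form[OF B upd[OF v] k'] bidual_mem[OF \<xi> k] Suc.IH[OF lk k'] x]
    show ?thesis by (simp only: bar_iter_Suc same)
  qed
qed

text \<open>Both sides start from the same \<open>B\<close>. At \<open>k = m\<close> no variable is
  left and the identity is one between two numbers.\<close>

lemma bar_iter_abs:
  assumes B: "bounded_form {1..m} E K B" and \<xi>: "\<xi> \<in> prod_carrier {1..m} bidual"
    and abs: "\<And>x. x \<in> prod_carrier {1..m} E \<Longrightarrow> \<bar>B x\<bar> = B (\<lambda>i\<in>{1..m}. vabs (E i) (x i))"
    and "k \<le> m" "x \<in> prod_carrier (index_set m \<rho> k) E"
  shows "\<bar>bar_iter E m \<rho> \<xi> B k x\<bar> =
    bar_iter E m \<rho> (\<lambda>i\<in>{1..m}. vabs (bidual i) (\<xi> i)) B k (\<lambda>i\<in>index_set m \<rho> k. vabs (E i) (x i))"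
  using \<open>k \<le> m\<close> \<open>x \<in> prod_carrier (index_set m \<rho> k) E\<close>
proof (induction k arbitrary: x)
  case 0
  have "index_set m \<rho> 0 = {1..m}" by (simp add: index_set_def)
  with 0 show ?case using abs by (simp only: bar_iter.simps(1))
next
  case (Suc k)
  then have k: "k < m" and k': "k \<le> m" by simp_all
  let ?\<eta> = "\<lambda>i\<in>{1..m}. vabs (bidual i) (\<xi> i)"
  have \<eta>: "?\<eta> \<in> prod_carrier {1..m} bidual"
    using \<xi> by (rule vabs_prod_carrier) (use E in \<open>auto intro: banach_lattice.banach_lattice_dual\<close>)
  have \<eta>_rho: "?\<eta> (\<rho> (Suc k)) = vabs (bidual (\<rho> (Suc k))) (\<xi> (\<rho> (Suc k)))"
    using rho_in[of "Suc k"] k by simp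
  have x: "x \<in> prod_carrier (index_set m \<rho> k - {\<rho> (Suc k)}) E"
    using Suc.prems(2) by (simp only: index_set_Suc)
  from bounded_form_slice.eliminate_abs[OF slice_step[OF k] bar_iter_bounded_form[OF B \<xi> k']
      bar_iter_bounded_form[OF B \<eta> k'] bidual_mem[OF \<xi> k] Suc.IH[OF k'] x]
  show ?case by (simp only: bar_iter_Suc index_set_Suc \<eta>_rho)
qed

end

section \<open>Schauder bases of Riesz homomorphisms\<close>

lemma real_lattice_join: "a \<squnion>\<^bsub>real_lattice\<^esub> b = max a b"
  unfolding join_def sup_def
  by (rule some_equality) (auto simp: least_def Upper_def real_lattice_simps intro: antisym)

context banach_lattice
begin

section \<open>Partial sums and independence of the basis functionals\<close>

lemma partial_sum_dual_closed:
  "(\<And>n. e n \<in> carrier (dual_lattice E)) \<Longrightarrow> partial_sum (dual_lattice E) a e n \<in> carrier (dual_lattice E)"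
  by (induction n) (simp_all add: dual_zero_closed dual_add_closed dual_scale_closed)

lemma partial_sum_dual_apply:
  "x \<in> carrier E \<Longrightarrow> partial_sum (dual_lattice E) a e n x = (\<Sum>k<n. a k * e k x)"
  by (induction n) (simp_all add: dual_lattice_simps)

lemma dual_partial_sum:
  assumes "\<And>n. e n \<in> carrier E" "f \<in> carrier (dual_lattice E)"
  shows "partial_sum E a e n \<in> carrier E \<and> f (partial_sum E a e n) = (\<Sum>k<n. a k * f (e k))"
  by (induction n) (use assms in \<open>simp_all add: dual_zero dual_add dual_scale\<close>)

text \<open>Otherwise the kernel of \<open>e k\<close> lies in that of \<open>e j\<close>, so
  \<open>e j\<close> is a multiple of \<open>e k\<close> and has two different expansions in the
  basis.\<close>

lemma schauder_basis_separates:
  assumes basis: "schauder_basis (dual_lattice E) e" and jk: "j \<noteq> k"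
  obtains u where "u \<in> carrier E" "e j u \<noteq> 0" "e k u = 0"
proof -
  let ?D = "dual_lattice E"
  interpret D: banach_lattice ?D by (rule banach_lattice_dual)
  have e: "e n \<in> carrier ?D" for n using basis by (auto simp: schauder_basis_def)
  \<comment> \<open>A partial sum of length \<open>N\<close> uses the indices below
    \<open>N\<close>, so it equals the single term exactly as soon as \<open>N > i\<close>.\<close>
  have single: "(\<lambda>N. vnorm ?D (vdiff ?D (vscale ?D c (e i)) (partial_sum ?D (\<lambda>n. if n = i then c else 0) e N)))
      \<longlonglongrightarrow> 0" for c i
  proof (rule tendsto_eventually)
    show "\<forall>\<^sub>F N in sequentially. vnorm ?D (vdiff ?D (vscale ?D c (e i))
        (partial_sum ?D (\<lambda>n. if n = i then c else 0) e N)) = 0"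
      using eventually_gt_at_top[of i]
    proof eventually_elim
      case (elim N)
      have "partial_sum ?D (\<lambda>n. if n = i then c else 0) e N = vscale ?D c (e i)"
      proof (rule dual_eqI[OF partial_sum_dual_closed[OF e] dual_scale_closed[OF e]])
        fix x assume x: "x \<in> carrier E"
        have "(\<Sum>n<N. (if n = i then c else 0) * e n x) = (\<Sum>n<N. if n = i then c * e n x else 0)"
          by (rule sum.cong) auto
        then show "partial_sum ?D (\<lambda>n. if n = i then c else 0) e N x = vscale ?D c (e i) x"
          using elim x by (simp add: partial_sum_dual_apply dual_lattice_simps(5))
      qed
      then show ?case using e by (simp add: D.vdiff_self)
    qed
  qed
  have "\<exists>u\<in>carrier E. e j u \<noteq> 0 \<and> e k u = 0"
  proof (rule ccontr)
    assume "\<not> ?thesis"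
    then have ker: "e j u = 0" if "u \<in> carrier E" "e k u = 0" for u using that by blast
    have "\<exists>c. \<forall>u\<in>carrier E. e j u = c * e k u"
    proof (cases "\<exists>v\<in>carrier E. e k v \<noteq> 0")
      case True
      then obtain v where v: "v \<in> carrier E" "e k v \<noteq> 0" by blast
      have "e j u = e j v / e k v * e k u" if u: "u \<in> carrier E" for u
        using ker[of "vdiff E u (vscale E (e k u / e k v) v)"] u v
        by (simp add: dual_vdiff[OF e] dual_scale[OF e] mult.commute)
      then show ?thesis by blast
    next
      case False
      then show ?thesis using ker by (intro exI[of _ 0]) auto
    qed
    then obtain c where "\<And>u. u \<in> carrier E \<Longrightarrow> e j u = c * e k u" by blast
    then have ej: "vscale ?D c (e k) = e j"
      by (intro dual_eqI[OF dual_scale_closed[OF e] e]) (simp add: dual_lattice_simps(5))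
    have "vscale ?D 1 (e j) = e j" using e by simp
    \<comment> \<open>Both sequences expand \<open>e j\<close>; they differ at index
      \<open>j\<close> whatever the value of \<open>c\<close>.\<close>
    then have "(\<lambda>n. if n = j then 1 else 0) = (\<lambda>n. if n = k then c else 0 :: real)"
      using single[of 1 j] single[of c k] basis e[of j] unfolding schauder_basis_def ej by metis
    from fun_cong[OF this, of j] show False using jk by simp
  qed
  then show ?thesis using that by blast
qed

end

locale riesz_schauder_basis = banach_lattice E for E (structure) +
  fixes e :: "nat \<Rightarrow> 'a \<Rightarrow> real"
  assumes basis: "schauder_basis (dual_lattice E) e"
    and riesz: "\<And>n. riesz_homomorphism E real_lattice (e n)"
begin

section \<open>Interpolation with Riesz homomorphisms\<close>

lemma basis_closed: "e n \<in> carrier (dual_lattice E)"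
  using basis by (auto simp: schauder_basis_def)

lemma basis_join: "\<lbrakk>x \<in> carrier E; y \<in> carrier E\<rbrakk> \<Longrightarrow> e n (x \<squnion> y) = max (e n x) (e n y)"
  using riesz[of n] by (simp add: riesz_homomorphism_def real_lattice_join)

lemma basis_minus: "x \<in> carrier E \<Longrightarrow> e n (vscale E (- 1) x) = - e n x"
  by (simp add: dual_scale[OF basis_closed])

lemma basis_vabs: "x \<in> carrier E \<Longrightarrow> e n (vabs E x) = \<bar>e n x\<bar>"
  by (simp add: vabs_def basis_join basis_minus)

lemma basis_vpos: "x \<in> carrier E \<Longrightarrow> e n (vpos E x) = max (e n x) 0"
  by (simp add: vpos_def basis_join dual_zero[OF basis_closed])

lemma basis_nonneg: "\<lbrakk>x \<in> carrier E; vzero E \<sqsubseteq> x\<rbrakk> \<Longrightarrow> 0 \<le> e n x"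
  using basis_vabs[of x n] by (simp add: vabs_eq_self)

text \<open>Riesz homomorphisms commute with the modulus, so a separating vector may be replaced by
  its modulus and normalised.\<close>

lemma basis_separate_two:
  assumes "j \<noteq> k"
  shows "\<exists>u\<in>carrier E. vzero E \<sqsubseteq> u \<and> e j u = 1 \<and> e k u = 0"
proof -
  obtain u where u: "u \<in> carrier E" "e j u \<noteq> 0" "e k u = 0"
    using schauder_basis_separates[OF basis assms] .
  then show ?thesis
    by (intro bexI[of _ "vscale E (1 / \<bar>e j u\<bar>) (vabs E u)"])
      (auto simp: dual_scale[OF basis_closed] basis_vabs intro!: scale_mono)
qed

text \<open>Riesz homomorphisms preserve infima: the infimum of two positive vectors on which
  \<open>e j\<close> is 1 is annihilated by every \<open>e k\<close> that annihilates one of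
  them.\<close>

lemma basis_separate:
  assumes "finite J" "j \<notin> J"
  shows "\<exists>u\<in>carrier E. vzero E \<sqsubseteq> u \<and> e j u = 1 \<and> (\<forall>k\<in>J. e k u = 0)"
  using assms
proof (induction J rule: finite_induct)
  case empty
  \<comment> \<open>The index \<open>Suc j\<close> is only a partner different from
    \<open>j\<close>, supplying a positive vector on which \<open>e j\<close> is 1.\<close>
  then show ?case using basis_separate_two[of j "Suc j"] by auto
next
  case (insert k J)
  then obtain u where u: "u \<in> carrier E" "vzero E \<sqsubseteq> u" "e j u = 1" "\<forall>k\<in>J. e k u = 0" by blast
  obtain v where v: "v \<in> carrier E" "vzero E \<sqsubseteq> v" "e j v = 1" "e k v = 0"
    using basis_separate_two[of j k] insert.prems by blast
  \<comment> \<open>the infimum of \<open>u\<close> and \<open>v\<close>\<close>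
  let ?w = "vdiff E u (vpos E (vdiff E u v))"
  have e_w: "e i ?w = min (e i u) (e i v)" for i
    using u v by (simp add: dual_vdiff[OF basis_closed] basis_vpos)
  have "vpos E (vdiff E u v) \<sqsubseteq> u"
    using u v by (intro vpos_least vdiff_le_self) auto
  then have "vzero E \<sqsubseteq> ?w" using u v by (simp add: vdiff_nonneg_iff)
  moreover have "e i ?w = 0" if "i \<in> insert k J" for i
    using that u v basis_nonneg[of u k] basis_nonneg[of v i] by (auto simp: e_w)
  ultimately show ?case
    using u v by (intro bexI[of _ ?w]) (auto simp: e_w simp del: vdiff_vdiff_cancel)
qed

text \<open>Triangular correction: the value at the new index is adjusted by a multiple of a vector
  annihilated by all earlier functionals.\<close>

lemma basis_interpolate: "\<exists>z\<in>carrier E. \<forall>k<N. e k z = c k"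
proof (induction N)
  case 0
  then show ?case by (auto intro: vzero_closed)
next
  case (Suc N)
  then obtain z where z: "z \<in> carrier E" "\<forall>k<N. e k z = c k" by blast
  obtain u where u: "u \<in> carrier E" "e N u = 1" "\<forall>k\<in>{..<N}. e k u = 0"
    using basis_separate[of "{..<N}" N] by auto
  let ?z = "vadd E z (vscale E (c N - e N z) u)"
  have "e k ?z = c k" if "k < Suc N" for k
    using that z u by (auto simp: dual_add[OF basis_closed] dual_scale[OF basis_closed] less_Suc_eq)
  then show ?case using z u by (intro bexI[of _ ?z]) auto
qed

text \<open>Truncation acts on the value of each \<open>e k\<close> by the same formula and leaves
  the prescribed value alone, because \<open>|s k * e k x| \<le> e k x\<close>. With signs for
  \<open>s\<close> this trades a change of coefficients for a change of the argument within an order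
  interval.\<close>

lemma basis_interpolate_between:
  assumes x: "x \<in> carrier E" "vzero E \<sqsubseteq> x" and s: "\<And>k. \<bar>s k\<bar> \<le> 1"
  shows "\<exists>t\<in>carrier E. vscale E (- 1) x \<sqsubseteq> t \<and> t \<sqsubseteq> x \<and> (\<forall>k<N. e k t = s k * e k x)"
proof -
  obtain z where z: "z \<in> carrier E" "\<forall>k<N. e k z = s k * e k x"
    using basis_interpolate[of N "\<lambda>k. s k * e k x"] by blast
  \<comment> \<open>\<open>z\<close> truncated to the order interval from \<open>- x\<close> to \<open>x\<close>\<close>
  let ?m = "vscale E (- 1) x"
  let ?y = "z \<squnion> ?m"
  let ?p = "vpos E (vdiff E x ?y)"
  let ?t = "vdiff E x ?p"
  have y: "?y \<in> carrier E" using x z by simp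
  have "vdiff E x ?y \<sqsubseteq> vdiff E x ?m"
    using minus_le_minus[of ?m ?y] x z y vadd_mono[of x x "vscale E (- 1) ?y" "vscale E (- 1) ?m"]
    by (simp add: vdiff_def join_right)
  moreover have "vzero E \<sqsubseteq> vdiff E x ?m"
    using x minus_le_self[of x] by (simp add: vdiff_nonneg_iff)
  ultimately have "?p \<sqsubseteq> vdiff E x ?m"
    using x y by (intro vpos_least) auto
  then have "vdiff E x (vdiff E x ?m) \<sqsubseteq> ?t"
    using x y vadd_mono[of x x "vscale E (- 1) (vdiff E x ?m)" "vscale E (- 1) ?p"]
      minus_le_minus[of ?p "vdiff E x ?m"] by (simp add: vdiff_def)
  then have lower: "?m \<sqsubseteq> ?t" using x by simp
  have upper: "?t \<sqsubseteq> x" using x y by (intro vdiff_le_self) auto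
  have "e k ?t = s k * e k x" if "k < N" for k
  proof -
    have "e k ?t = e k x - max (e k x - max (e k z) (- e k x)) 0"
      using x y z by (simp add: dual_vdiff[OF basis_closed] basis_vpos basis_join basis_minus)
    moreover have "\<bar>s k * e k x\<bar> \<le> e k x"
      using s[of k] basis_nonneg[OF x, of k] by (simp add: abs_mult mult_left_le_one_le)
    ultimately show ?thesis using z(2) that by auto
  qed
  then show ?thesis using lower upper x y by (intro bexI[of _ ?t]) auto
qed

text \<open>At a positive \<open>x\<close>, the sum with coefficients \<open>|a k|\<close> equals
  the original sum at some \<open>t\<close> between \<open>- x\<close> and \<open>x\<close>; as
  \<open>y t \<le> y x\<close>, this bounds it from above by \<open>y x\<close> plus the error. From
  below it dominates the original sum at \<open>x\<close>. The factor 2 comes from splitting a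
  general \<open>x\<close> into its two parts.\<close>

lemma abs_partial_sum_near:
  assumes y: "y \<in> carrier (dual_lattice E)" "vzero (dual_lattice E) \<sqsubseteq>\<^bsub>dual_lattice E\<^esub> y"
  shows "vnorm (dual_lattice E) (vdiff (dual_lattice E) y (partial_sum (dual_lattice E) (\<lambda>k. \<bar>a k\<bar>) e N)) \<le>
    2 * vnorm (dual_lattice E) (vdiff (dual_lattice E) y (partial_sum (dual_lattice E) a e N))"
proof -
  let ?D = "dual_lattice E"
  let ?s = "partial_sum ?D a e N" and ?g = "partial_sum ?D (\<lambda>k. \<bar>a k\<bar>) e N"
  let ?d = "vnorm ?D (vdiff ?D y ?s)"
  have ys: "vdiff ?D y ?s \<in> carrier ?D" and yg: "vdiff ?D y ?g \<in> carrier ?D"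
    using y basis_closed by (auto intro!: dual_vdiff_closed partial_sum_dual_closed)
  have near: "\<bar>vdiff ?D y ?g x\<bar> \<le> ?d * vnorm E x" if x: "x \<in> carrier E" "vzero E \<sqsubseteq> x" for x
  proof -
    define sg where "sg k = (if a k < 0 then - 1 else 1 :: real)" for k
    have "\<bar>sg k\<bar> \<le> 1" for k by (simp add: sg_def)
    from basis_interpolate_between[of x sg N, OF x this]
    obtain t where t: "t \<in> carrier E" "vscale E (- 1) x \<sqsubseteq> t" "t \<sqsubseteq> x" "\<forall>k<N. e k t = sg k * e k x"
      by blast
    have "?g x = ?s t"
      unfolding partial_sum_dual_apply[OF x(1)] partial_sum_dual_apply[OF t(1)]
      by (rule sum.cong) (use t in \<open>auto simp: sg_def\<close>)
    moreover have "y t \<le> y x"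
      using y t x by (intro dual_mono[OF y(1)]) (auto simp: dual_lattice_simps)
    moreover have "\<bar>y t - ?s t\<bar> \<le> ?d * vnorm E t"
      using dual_norm_bound[OF ys t(1)] t by (simp add: dual_vdiff_apply)
    moreover have "?d * vnorm E t \<le> ?d * vnorm E x"
      using t x by (intro mult_left_mono vnorm_le_of_between dual_norm_nonneg ys)
    moreover have "?s x \<le> ?g x"
      unfolding partial_sum_dual_apply[OF x(1)] by (intro sum_mono mult_right_mono basis_nonneg x) auto
    moreover have "\<bar>y x - ?s x\<bar> \<le> ?d * vnorm E x"
      using dual_norm_bound[OF ys x(1)] x by (simp add: dual_vdiff_apply)
    ultimately show ?thesis using x by (simp add: dual_vdiff_apply)
  qed
  show ?thesis
  proof (rule dual_norm_le[OF yg])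
    show "0 \<le> 2 * ?d" using dual_norm_nonneg[OF ys] by simp
    fix x assume x: "x \<in> carrier E"
    let ?p = "vpos E x" and ?n = "vpos E (vscale E (- 1) x)"
    have "?d * vnorm E ?p \<le> ?d * vnorm E x" "?d * vnorm E ?n \<le> ?d * vnorm E x"
      using x by (auto intro!: mult_left_mono dual_norm_nonneg ys vnorm_vpos_le vnorm_vpos_minus_le)
    then have "\<bar>vdiff ?D y ?g ?p\<bar> \<le> ?d * vnorm E x" "\<bar>vdiff ?D y ?g ?n\<bar> \<le> ?d * vnorm E x"
      using near[of ?p] near[of ?n] x by auto
    then show "\<bar>vdiff ?D y ?g x\<bar> \<le> 2 * ?d * vnorm E x"
      using dual_split[OF yg x] by linarith
  qed
qed

text \<open>
  By the previous lemma a positive \<open>y = \<Sum>\<^sub>k a\<^sub>k e\<^sub>k\<close> also equals \<open>\<Sum>\<^sub>k \<bar>a\<^sub>k\<bar> e\<^sub>k\<close>,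
  hence all \<open>a\<^sub>k\<close> are nonnegative.
\<close>

lemma positive_expansion:
  assumes y: "y \<in> carrier (dual_lattice E)" "vzero (dual_lattice E) \<sqsubseteq>\<^bsub>dual_lattice E\<^esub> y"
  obtains a where "\<And>k. 0 \<le> a k"
    "(\<lambda>n. vnorm (dual_lattice E) (vdiff (dual_lattice E) y (partial_sum (dual_lattice E) a e n))) \<longlonglongrightarrow> 0"
proof -
  let ?D = "dual_lattice E"
  let ?r = "\<lambda>a n. vnorm ?D (vdiff ?D y (partial_sum ?D a e n))"
  obtain a where a: "?r a \<longlonglongrightarrow> 0"
    using basis y(1) unfolding schauder_basis_def by blast
  have "?r (\<lambda>k. \<bar>a k\<bar>) \<longlonglongrightarrow> 0"
  proof (rule tendsto_sandwich)
    show "\<forall>\<^sub>F n in sequentially. 0 \<le> ?r (\<lambda>k. \<bar>a k\<bar>) n"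
      by (intro always_eventually allI dual_norm_nonneg dual_vdiff_closed y partial_sum_dual_closed basis_closed)
    show "\<forall>\<^sub>F n in sequentially. ?r (\<lambda>k. \<bar>a k\<bar>) n \<le> 2 * ?r a n"
      using abs_partial_sum_near[OF y] by simp
    show "(\<lambda>n. 2 * ?r a n) \<longlonglongrightarrow> 0" using tendsto_mult_left[OF a, of 2] by simp
  qed simp
  then show ?thesis by (intro that[of "\<lambda>k. \<bar>a k\<bar>"]) simp_all
qed

text \<open>By continuity \<open>M y\<close> is a limit of sums of the products
  \<open>a k * M (e k)\<close> with \<open>a k \<ge> 0\<close>. Consequently the order of the bidual
  can be tested on the basis.\<close>

lemma bidual_nonneg:
  assumes M: "M \<in> carrier (dual_lattice (dual_lattice E))" and pos: "\<And>n. 0 \<le> M (e n)"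
  shows "vzero (dual_lattice (dual_lattice E)) \<sqsubseteq>\<^bsub>dual_lattice (dual_lattice E)\<^esub> M"
proof -
  let ?D = "dual_lattice E"
  interpret D: banach_lattice ?D by (rule banach_lattice_dual)
  have "0 \<le> M y" if y: "y \<in> carrier ?D" "vzero ?D \<sqsubseteq>\<^bsub>?D\<^esub> y" for y
  proof -
    obtain a where a: "\<And>k. 0 \<le> a k"
      "(\<lambda>n. vnorm ?D (vdiff ?D y (partial_sum ?D a e n))) \<longlonglongrightarrow> 0"
      by (rule positive_expansion[OF y]) (rule that)
    let ?s = "partial_sum ?D a e"
    have s: "?s n \<in> carrier ?D" "M (?s n) = (\<Sum>k<n. a k * M (e k))" for n
      using D.dual_partial_sum[where e = e and a = a and n = n, OF basis_closed M] by auto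
    have "(\<lambda>n. - (vnorm (dual_lattice ?D) M * vnorm ?D (vdiff ?D y (?s n)))) \<longlonglongrightarrow> - (vnorm (dual_lattice ?D) M * 0)"
      by (intro tendsto_intros a)
    moreover have "- (vnorm (dual_lattice ?D) M * vnorm ?D (vdiff ?D y (?s n))) \<le> M y" for n
    proof -
      have "\<bar>M y - M (?s n)\<bar> \<le> vnorm (dual_lattice ?D) M * vnorm ?D (vdiff ?D y (?s n))"
        using D.dual_norm_bound[OF M, of "vdiff ?D y (?s n)"] y s by (simp add: D.dual_vdiff[OF M])
      moreover have "0 \<le> M (?s n)"
        unfolding s(2) by (intro sum_nonneg mult_nonneg_nonneg a pos)
      ultimately show ?thesis by linarith
    qed
    ultimately show ?thesis
      by (intro tendsto_upperbound[of _ 0 sequentially "M y"]) auto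
  qed
  then show ?thesis by (simp add: dual_lattice_simps(1,3)[of "dual_lattice E"])
qed

end

section \<open>The Aron-Berner extension\<close>

context bidual_product
begin

lemma banach_lattice_bidual: "i \<in> {1..m} \<Longrightarrow> banach_lattice (bidual i)"
  by (intro banach_lattice.banach_lattice_dual E)

lemma undefined_mem: "(\<lambda>_. undefined) \<in> prod_carrier (index_set m \<rho> m) E"
  by (simp add: index_set_last prod_carrier_def)

end

locale aron_berner_riesz = bidual_product m \<rho> E
  for m :: nat and \<rho> :: "nat \<Rightarrow> nat" and E :: "nat \<Rightarrow> 'a ordered_normed_space" +
  fixes F :: "'f ordered_normed_space" and A :: "(nat \<Rightarrow> 'a) \<Rightarrow> 'f"
  assumes F: "banach_lattice F" and A: "riesz_multimorphism {1..m} E F A"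
begin

sublocale F: banach_lattice F by (rule F)
sublocale DF: banach_lattice "dual_lattice F" by (rule F.banach_lattice_dual)
sublocale DDF: banach_lattice "dual_lattice (dual_lattice F)" by (rule DF.banach_lattice_dual)

section \<open>Boundedness, linearity and positivity of the extension\<close>

definition form :: "('f \<Rightarrow> real) \<Rightarrow> (nat \<Rightarrow> 'a) \<Rightarrow> real" where
  "form \<phi> = (\<lambda>x\<in>prod_carrier {1..m} E. \<phi> (A x))"

abbreviation AB :: "(nat \<Rightarrow> ('a \<Rightarrow> real) \<Rightarrow> real) \<Rightarrow> ('f \<Rightarrow> real) \<Rightarrow> real" where
  "AB \<equiv> aron_berner E F m \<rho> A"

lemma form_apply [simp]: "x \<in> prod_carrier {1..m} E \<Longrightarrow> form \<phi> x = \<phi> (A x)"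
  by (simp add: form_def)

lemma A_positive: "positive_multilinear {1..m} E F A"
  by (rule riesz_multimorphism_positive[OF A E F])

lemma A_multilinear: "multilinear {1..m} E F A"
  using A_positive by (simp add: positive_multilinear_def)

text \<open>One constant \<open>K\<close> serves all \<phi>; this uniformity gives the continuity in
  \<phi> of the extension.\<close>

lemma form_bounded:
  "\<exists>K. \<forall>\<phi>\<in>carrier (dual_lattice F). bounded_form {1..m} E (K * vnorm (dual_lattice F) \<phi>) (form \<phi>)"
proof -
  obtain K where K: "0 \<le> K"
    "\<And>x. x \<in> prod_carrier {1..m} E \<Longrightarrow> vnorm F (A x) \<le> K * (\<Prod>i=1..m. vnorm (E i) (x i))"
    by (rule riesz_multimorphism_bounded[OF A finite_atLeastAtMost E F]) (assumption, rule that)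
  have "bounded_form {1..m} E (K * vnorm (dual_lattice F) \<phi>) (form \<phi>)"
    if \<phi>: "\<phi> \<in> carrier (dual_lattice F)" for \<phi>
    unfolding bounded_form_def
  proof (intro conjI ballI)
    show "0 \<le> K * vnorm (dual_lattice F) \<phi>" using K F.dual_norm_nonneg[OF \<phi>] by simp
  next
    show "multilinear {1..m} E real_lattice (form \<phi>)"
      unfolding multilinear_def linear_operator_def real_lattice_simps
    proof (intro conjI ballI allI)
      fix x i assume x: "x \<in> prod_carrier {1..m} E" and i: "i \<in> {1..m}"
      interpret Ei: banach_lattice "E i" by (rule E[OF i])
      have upd: "x(i := u) \<in> prod_carrier {1..m} E" "A (x(i := u)) \<in> carrier F" if "u \<in> carrier (E i)" for u
        using prod_carrier_upd[OF x i that] multilinear_closed[OF A_multilinear] by auto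
      fix u assume u: "u \<in> carrier (E i)"
      show "form \<phi> (x(i := vscale (E i) c u)) = c * form \<phi> (x(i := u))" for c
        using upd u multilinear_scale[OF A_multilinear x i u] by (simp add: dual_scale[OF \<phi>])
      fix v assume v: "v \<in> carrier (E i)"
      show "form \<phi> (x(i := vadd (E i) u v)) = form \<phi> (x(i := u)) + form \<phi> (x(i := v))"
        using upd u v multilinear_add[OF A_multilinear x i u v] by (simp add: dual_add[OF \<phi>])
    qed auto
  next
    fix x assume x: "x \<in> prod_carrier {1..m} E"
    have "\<bar>form \<phi> x\<bar> \<le> vnorm (dual_lattice F) \<phi> * vnorm F (A x)"
      using x F.dual_norm_bound[OF \<phi> multilinear_closed[OF A_multilinear x]] by simp
    also have "\<dots> \<le> vnorm (dual_lattice F) \<phi> * (K * (\<Prod>i=1..m. vnorm (E i) (x i)))"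
      by (intro mult_left_mono K x F.dual_norm_nonneg \<phi>)
    finally show "\<bar>form \<phi> x\<bar> \<le> K * vnorm (dual_lattice F) \<phi> * (\<Prod>i\<in>{1..m}. vnorm (E i) (x i))"
      by (simp add: mult_ac)
  qed
  then show ?thesis by blast
qed

lemma AB_apply:
  "\<phi> \<in> carrier (dual_lattice F) \<Longrightarrow> AB \<xi> \<phi> = bar_iter E m \<rho> \<xi> (form \<phi>) m (\<lambda>_. undefined)"
  by (simp add: aron_berner_def form_def)

lemma AB_linear:
  assumes \<xi>: "\<xi> \<in> prod_carrier {1..m} bidual"
    and \<phi>: "\<phi> \<in> carrier (dual_lattice F)" and \<psi>: "\<psi> \<in> carrier (dual_lattice F)"
  shows "AB \<xi> (vadd (dual_lattice F) (vscale (dual_lattice F) c \<phi>) \<psi>) = c * AB \<xi> \<phi> + AB \<xi> \<psi>"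
proof -
  obtain K where K: "\<And>\<phi>. \<phi> \<in> carrier (dual_lattice F) \<Longrightarrow>
      bounded_form {1..m} E (K * vnorm (dual_lattice F) \<phi>) (form \<phi>)"
    using form_bounded by blast
  have "form (vadd (dual_lattice F) (vscale (dual_lattice F) c \<phi>) \<psi>) x = c * form \<phi> x + form \<psi> x"
    if "x \<in> prod_carrier {1..m} E" for x
    using that multilinear_closed[OF A_multilinear that] by (simp add: dual_lattice_simps)
  from bar_iter_linear_form[OF K[OF \<phi>] K[OF \<psi>] \<xi> this order_refl undefined_mem]
  show ?thesis using \<phi> \<psi> by (simp add: AB_apply)
qed

lemma AB_closed:
  assumes \<xi>: "\<xi> \<in> prod_carrier {1..m} bidual"
  shows "AB \<xi> \<in> carrier (dual_lattice (dual_lattice F))"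
  unfolding dual_carrier_iff[of _ "dual_lattice F"]
proof (intro conjI ballI allI)
  show "AB \<xi> \<in> extensional (carrier (dual_lattice F))" by (simp add: aron_berner_def)
  fix \<phi> assume \<phi>: "\<phi> \<in> carrier (dual_lattice F)"
  \<comment> \<open>Homogeneity is read off from additivity with a factor by writing
    \<open>c \<phi>\<close> as \<open>(c - 1) \<phi> + \<phi>\<close>.\<close>
  show "AB \<xi> (vscale (dual_lattice F) c \<phi>) = c * AB \<xi> \<phi>" for c
    using AB_linear[OF \<xi> \<phi> \<phi>, of "c - 1"] DF.scale_add_left[OF \<phi>, of "c - 1" 1] \<phi>
    by (simp add: algebra_simps)
  fix \<psi> assume \<psi>: "\<psi> \<in> carrier (dual_lattice F)"
  show "AB \<xi> (vadd (dual_lattice F) \<phi> \<psi>) = AB \<xi> \<phi> + AB \<xi> \<psi>"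
    using AB_linear[OF \<xi> \<phi> \<psi>, of 1] \<phi> by simp
next
  obtain K where K: "\<And>\<phi>. \<phi> \<in> carrier (dual_lattice F) \<Longrightarrow>
      bounded_form {1..m} E (K * vnorm (dual_lattice F) \<phi>) (form \<phi>)"
    using form_bounded by blast
  have "\<bar>AB \<xi> \<phi>\<bar> \<le> K * (\<Prod>j=1..m. vnorm (bidual (\<rho> j)) (\<xi> (\<rho> j))) * vnorm (dual_lattice F) \<phi>"
    if \<phi>: "\<phi> \<in> carrier (dual_lattice F)" for \<phi>
    using bar_iter_bounded_form[OF K[OF \<phi>] \<xi> order_refl] undefined_mem \<phi>
    by (auto simp: bounded_form_def AB_apply index_set_last mult_ac)
  then show "\<exists>C. \<forall>\<phi>\<in>carrier (dual_lattice F). \<bar>AB \<xi> \<phi>\<bar> \<le> C * vnorm (dual_lattice F) \<phi>" by blast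
qed

lemma AB_linear_arg:
  assumes \<xi>: "\<xi> \<in> prod_carrier {1..m} bidual" and i: "i \<in> {1..m}"
    and u: "u \<in> carrier (bidual i)" and v: "v \<in> carrier (bidual i)"
  shows "AB (\<xi>(i := vadd (bidual i) (vscale (bidual i) c u) v)) =
    vadd (dual_lattice (dual_lattice F)) (vscale (dual_lattice (dual_lattice F)) c (AB (\<xi>(i := u)))) (AB (\<xi>(i := v)))"
proof -
  interpret Bi: banach_lattice "bidual i" by (rule banach_lattice_bidual[OF i])
  obtain K where K: "\<And>\<phi>. \<phi> \<in> carrier (dual_lattice F) \<Longrightarrow>
      bounded_form {1..m} E (K * vnorm (dual_lattice F) \<phi>) (form \<phi>)"
    using form_bounded by blast
  obtain l where l: "l \<in> {1..m}" "i = \<rho> l"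
    using i permutes_image[OF \<rho>] by blast
  have "l \<le> m" using l by simp
  have closed: "AB (\<xi>(i := w)) \<in> carrier (dual_lattice (dual_lattice F))" if "w \<in> carrier (bidual i)" for w
    by (rule AB_closed[OF prod_carrier_upd[OF \<xi> i that]])
  show ?thesis
  proof (rule dual_eqI)
    fix \<phi> assume \<phi>: "\<phi> \<in> carrier (dual_lattice F)"
    show "AB (\<xi>(i := vadd (bidual i) (vscale (bidual i) c u) v)) \<phi> =
        vadd (dual_lattice (dual_lattice F)) (vscale (dual_lattice (dual_lattice F)) c (AB (\<xi>(i := u)))) (AB (\<xi>(i := v))) \<phi>"
      using bar_iter_linear_arg[OF K[OF \<phi>] \<xi> l(1) u[unfolded l(2)] v[unfolded l(2)] refl \<open>l \<le> m\<close> order_refl undefined_mem] \<phi>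
      by (simp add: AB_apply l(2) dual_lattice_simps(4,5)[of "dual_lattice F"])
  qed (use u v in \<open>auto intro!: closed DDF.vadd_closed DDF.scale_closed\<close>)
qed

lemma AB_multilinear: "multilinear {1..m} bidual (dual_lattice (dual_lattice F)) AB"
  unfolding multilinear_def linear_operator_def
proof (intro conjI ballI allI funcsetI)
  show "AB \<xi> \<in> carrier (dual_lattice (dual_lattice F))" if "\<xi> \<in> prod_carrier {1..m} bidual" for \<xi>
    using that by (rule AB_closed)
next
  fix \<xi> i assume \<xi>: "\<xi> \<in> prod_carrier {1..m} bidual" and i: "i \<in> {1..m}"
  interpret Bi: banach_lattice "bidual i" by (rule banach_lattice_bidual[OF i])
  show closed: "AB (\<xi>(i := u)) \<in> carrier (dual_lattice (dual_lattice F))" if "u \<in> carrier (bidual i)" for u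
    by (rule AB_closed[OF prod_carrier_upd[OF \<xi> i that]])
  fix u assume u: "u \<in> carrier (bidual i)"
  show "AB (\<xi>(i := vscale (bidual i) c u)) = vscale (dual_lattice (dual_lattice F)) c (AB (\<xi>(i := u)))" for c
    using AB_linear_arg[OF \<xi> i u u, of "c - 1"] Bi.scale_add_left[OF u, of "c - 1" 1] u
      DDF.scale_add_left[OF closed[OF u], of "c - 1" 1] closed[OF u] by simp
  fix v assume v: "v \<in> carrier (bidual i)"
  show "AB (\<xi>(i := vadd (bidual i) u v)) =
      vadd (dual_lattice (dual_lattice F)) (AB (\<xi>(i := u))) (AB (\<xi>(i := v)))"
    using AB_linear_arg[OF \<xi> i u v, of 1] u closed[OF u] by simp
qed

lemma AB_positive: "positive_multilinear {1..m} bidual (dual_lattice (dual_lattice F)) AB"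
  unfolding positive_multilinear_def
proof (intro conjI ballI impI AB_multilinear)
  fix \<xi> assume \<xi>: "\<xi> \<in> prod_carrier {1..m} bidual"
    and pos: "\<forall>i\<in>{1..m}. vzero (bidual i) \<sqsubseteq>\<^bsub>bidual i\<^esub> \<xi> i"
  obtain K where K: "\<And>\<phi>. \<phi> \<in> carrier (dual_lattice F) \<Longrightarrow>
      bounded_form {1..m} E (K * vnorm (dual_lattice F) \<phi>) (form \<phi>)"
    using form_bounded by blast
  have "0 \<le> AB \<xi> \<phi>"
    if \<phi>: "\<phi> \<in> carrier (dual_lattice F)" "vzero (dual_lattice F) \<sqsubseteq>\<^bsub>dual_lattice F\<^esub> \<phi>" for \<phi>
  proof -
    have "nonneg_form {1..m} E (form \<phi>)"
      using A_positive \<phi>(2) multilinear_closed[OF A_multilinear]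
      by (auto simp: nonneg_form_def positive_multilinear_def dual_lattice_simps)
    from bar_iter_nonneg[OF K[OF \<phi>(1)] this \<xi> _ order_refl] pos
    have "nonneg_form (index_set m \<rho> m) E (bar_iter E m \<rho> \<xi> (form \<phi>) m)" by blast
    then show ?thesis
      using undefined_mem \<phi>(1) by (simp add: nonneg_form_def AB_apply index_set_last)
  qed
  then show "vzero (dual_lattice (dual_lattice F)) \<sqsubseteq>\<^bsub>dual_lattice (dual_lattice F)\<^esub> AB \<xi>"
    by (simp add: dual_lattice_simps(1,3)[of "dual_lattice F"])
qed

text \<open>A positive operator is the difference of itself and the zero operator.\<close>

lemma AB_regular: "regular_multilinear {1..m} bidual (dual_lattice (dual_lattice F)) AB"
  unfolding regular_multilinear_def
proof (rule exI[of _ AB], rule exI[of _ "\<lambda>_. vzero (dual_lattice (dual_lattice F))"], intro conjI ballI)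
  show "positive_multilinear {1..m} bidual (dual_lattice (dual_lattice F)) (\<lambda>_. vzero (dual_lattice (dual_lattice F)))"
    by (simp add: positive_multilinear_def multilinear_def linear_operator_def)
  show "AB \<xi> = vdiff (dual_lattice (dual_lattice F)) (AB \<xi>) (vzero (dual_lattice (dual_lattice F)))"
    if "\<xi> \<in> prod_carrier {1..m} bidual" for \<xi>
    using AB_closed[OF that] by simp
qed (rule AB_positive)

text \<open>The order of the bidual of \<open>F\<close> is tested on the basis, where the value of
  the extension at the moduli is \<open>|AB \<xi> (e n)|\<close>. It dominates
  \<open>AB \<xi>\<close> and its negative, hence the modulus; conversely it lies below the modulus
  because each \<open>e n\<close> is positive.\<close>

lemma AB_riesz_multimorphism:
  assumes basis: "schauder_basis (dual_lattice F) e" and riesz: "\<And>n. riesz_homomorphism F real_lattice (e n)"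
  shows "riesz_multimorphism {1..m} bidual (dual_lattice (dual_lattice F)) AB"
  unfolding riesz_multimorphism_def
proof (intro conjI ballI AB_regular)
  interpret B: riesz_schauder_basis F e
    by unfold_locales (rule basis riesz)+
  let ?G = "dual_lattice (dual_lattice F)"
  fix \<xi> assume \<xi>: "\<xi> \<in> prod_carrier {1..m} bidual"
  let ?\<eta> = "\<lambda>i\<in>{1..m}. vabs (bidual i) (\<xi> i)"
  obtain K where K: "\<And>\<phi>. \<phi> \<in> carrier (dual_lattice F) \<Longrightarrow>
      bounded_form {1..m} E (K * vnorm (dual_lattice F) \<phi>) (form \<phi>)"
    using form_bounded by blast
  have \<eta>: "?\<eta> \<in> prod_carrier {1..m} bidual"
    by (rule vabs_prod_carrier[OF \<xi> banach_lattice_bidual])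
  have T: "AB \<xi> \<in> carrier ?G" and S: "AB ?\<eta> \<in> carrier ?G"
    using AB_closed \<xi> \<eta> by blast+
  have on_basis: "\<bar>AB \<xi> (e n)\<bar> = AB ?\<eta> (e n)" for n
  proof -
    \<comment> \<open>The starting relation, with the same form in both roles: \<open>A\<close> and
      \<open>e n\<close> both commute with the modulus.\<close>
    have "\<bar>form (e n) x\<bar> = form (e n) (\<lambda>i\<in>{1..m}. vabs (E i) (x i))"
      if x: "x \<in> prod_carrier {1..m} E" for x
    proof -
      have "A (\<lambda>i\<in>{1..m}. vabs (E i) (x i)) = vabs F (A x)"
        using A x by (simp add: riesz_multimorphism_def)
      then show ?thesis
        using x vabs_prod_carrier[OF x E] B.basis_vabs[OF multilinear_closed[OF A_multilinear x]] by simp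
    qed
    from bar_iter_abs[OF K[OF B.basis_closed] \<xi> this order_refl undefined_mem]
    show ?thesis
      by (simp add: AB_apply B.basis_closed index_set_last restrict_def)
  qed
  have le: "f \<sqsubseteq>\<^bsub>?G\<^esub> g" if "f \<in> carrier ?G" "g \<in> carrier ?G" "\<And>n. f (e n) \<le> g (e n)" for f g
    using B.bidual_nonneg[of "vdiff ?G g f"] that
    by (simp add: DDF.vdiff_nonneg_iff dual_vdiff_apply B.basis_closed)
  show "vabs ?G (AB \<xi>) = AB ?\<eta>"
  proof (rule DDF.le_antisym)
    have "AB \<xi> (e n) \<le> AB ?\<eta> (e n)" "vscale ?G (- 1) (AB \<xi>) (e n) \<le> AB ?\<eta> (e n)" for n
      using on_basis[of n] by (auto simp: dual_lattice_simps(5)[of "dual_lattice F"] B.basis_closed)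
    then show "vabs ?G (AB \<xi>) \<sqsubseteq>\<^bsub>?G\<^esub> AB ?\<eta>"
      by (intro DDF.vabs_least le T S DDF.scale_closed)
    have "AB ?\<eta> (e n) \<le> vabs ?G (AB \<xi>) (e n)" for n
    proof -
      have "vzero (dual_lattice F) \<sqsubseteq>\<^bsub>dual_lattice F\<^esub> e n"
        by (simp add: dual_lattice_simps B.basis_nonneg)
      from DF.le_vabs_dual[OF T B.basis_closed this] show ?thesis
        unfolding on_basis .
    qed
    then show "AB ?\<eta> \<sqsubseteq>\<^bsub>?G\<^esub> vabs ?G (AB \<xi>)"
      by (intro le S DDF.vabs_closed T)
  qed (use T S in auto)
qed

end

theorem corollary3p7:
  fixes F :: "'f ordered_normed_space"
    and E :: "nat \<Rightarrow> 'a ordered_normed_space"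
    and A :: "(nat \<Rightarrow> 'a) \<Rightarrow> 'f"
    and e :: "nat \<Rightarrow> ('f \<Rightarrow> real)"
    and \<rho> :: "nat \<Rightarrow> nat"
    and m :: nat
  assumes "banach_lattice F"
    and "schauder_basis (dual_lattice F) e"
    and "\<And>n. riesz_homomorphism F real_lattice (e n)"
    and "m \<ge> 1"
    and "\<And>i. i \<in> {1..m} \<Longrightarrow> banach_lattice (E i)"
    and "riesz_multimorphism {1..m} E F A"
    and "\<rho> permutes {1..m}"
  shows "riesz_multimorphism {1..m} (\<lambda>i. dual_lattice (dual_lattice (E i)))
           (dual_lattice (dual_lattice F)) (aron_berner E F m \<rho> A)"
proof -
  have "aron_berner_riesz m \<rho> E F A"
    by (intro aron_berner_riesz.intro bidual_product.intro aron_berner_riesz_axioms.intro assms)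
  then show ?thesis
    using assms(2,3) by (rule aron_berner_riesz.AB_riesz_multimorphism)
qed

end
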